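(* Let $\alpha,\beta\ge0$. Then $\partial_t^\alpha(\partial_t^\beta v)=\partial_t^{\alpha+\beta}v$ for all $v\in H_{\alpha+\beta}(0,T)$.
   Context: Let $T>0$. For $\alpha>0$, $(J^\alpha v)(t)=\frac1{\Gamma(\alpha)}\int_0^t(t-s)^{\alpha-1}v(s)ds$ for $v\in L^2(0,T)$, and $J^0=I$. Spaces. For $0<\sigma<1$, $H^\sigma(0,T)$ is the Sobolev–Slobodeckij space; for $m\in\mathbb{N}$, $H^m(0,T)$ is the usual Sobolev space. Set $H_0(0,T)=L^2(0,T)$. For $0<\sigma\le1$: $H_\sigma(0,T)=H^\sigma(0,T)$ if $\sigma<\frac12$; $H_{1/2}(0,T)=\{v\in H^{1/2}(0,T): \int_0^T\frac{|v(t)|^2}{t}dt<\infty\}$; $H_\sigma(0,T)=\{v\in H^\sigma(0,T): v(0)=0\}$ if $\frac12<\sigma\le 1$. For $m\in\mathbb{N}$, $H_m(0,T)=\{v\in H^m(0,T): v(0)=\dots=\frac{d^{m-1}v}{dt^{m-1}}(0)=0\}$ and, for $0<\sigma\le1$, $H_{m+\sigma}(0,T)=\{v\in H_m(0,T):\frac{d^mv}{dt^m}\in H_\sigma(0,T)\}$. The operator $J^\alpha:L^2(0,T)\to H_\alpha(0,T)$ is an isomorphism, so $H_\alpha(0,T)=J^\alpha L^2(0,T)$, and $\partial_t^\alpha:=(J^\alpha)^{-1}$ with domain $H_\alpha(0,T)$ and values in $L^2(0,T)$; $\partial_t^0=I$ on $L^2(0,T)$. *)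

theory Defs
  imports "HOL-Analysis.Analysis"
begin

text \<open>
  Elements of \<open>L\<^sup>2(0,T)\<close> are represented by real functions on the line of which only the
  restriction to \<open>(0,T)\<close> matters, and only up to a null set.  All sets of functions below
  are closed under \<open>ae_eq T\<close>.
\<close>

definition ae_eq :: "real \<Rightarrow> (real \<Rightarrow> real) \<Rightarrow> (real \<Rightarrow> real) \<Rightarrow> bool" where
  "ae_eq T u v \<longleftrightarrow> (AE t in lebesgue_on {0<..<T}. u t = v t)"

definition L2 :: "real \<Rightarrow> (real \<Rightarrow> real) set" where
  "L2 T = {v. v \<in> borel_measurable (lebesgue_on {0<..<T}) \<and>
              integrable (lebesgue_on {0<..<T}) (\<lambda>t. (v t)\<^sup>2)}"

definition J :: "real \<Rightarrow> (real \<Rightarrow> real) \<Rightarrow> real \<Rightarrow> real" where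
  "J \<alpha> v t = (if \<alpha> = 0 then v t
     else 1 / Gamma \<alpha> * (LINT s:{0<..<t}|lebesgue. (t - s) powr (\<alpha> - 1) * v s))"

definition test_functions :: "real \<Rightarrow> (real \<Rightarrow> real) set" where
  "test_functions T = {\<phi>. (\<forall>n x. (deriv ^^ n) \<phi> differentiable at x) \<and>
     (\<exists>a b. 0 < a \<and> b < T \<and> (\<forall>x. x \<notin> {a..b} \<longrightarrow> \<phi> x = 0))}"

text \<open>\<open>w\<close> is the weak (distributional) derivative of order \<open>k\<close> of \<open>v\<close>, both in \<open>L\<^sup>2(0,T)\<close>.\<close>

definition weak_deriv :: "real \<Rightarrow> nat \<Rightarrow> (real \<Rightarrow> real) \<Rightarrow> (real \<Rightarrow> real) \<Rightarrow> bool" where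
  "weak_deriv T k v w \<longleftrightarrow> v \<in> L2 T \<and> w \<in> L2 T \<and>
     (\<forall>\<phi>\<in>test_functions T.
        (LINT t:{0<..<T}|lebesgue. v t * (deriv ^^ k) \<phi> t) =
        (- 1) ^ k * (LINT t:{0<..<T}|lebesgue. w t * \<phi> t))"

definition Sobolev :: "real \<Rightarrow> nat \<Rightarrow> (real \<Rightarrow> real) set" where
  "Sobolev T m = {v \<in> L2 T. \<forall>k\<le>m. \<exists>w. weak_deriv T k v w}"

definition Slobodeckij :: "real \<Rightarrow> real \<Rightarrow> (real \<Rightarrow> real) set" where
  "Slobodeckij T \<sigma> = {v \<in> L2 T.
     (\<integral>\<^sup>+t\<in>{0<..<T}. (\<integral>\<^sup>+s\<in>{0<..<T}.
        ennreal (\<bar>v t - v s\<bar>\<^sup>2 / \<bar>t - s\<bar> powr (1 + 2 * \<sigma>)) \<partial>lebesgue) \<partial>lebesgue) < \<infinity>}"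

text \<open>The condition \<open>v(0) = 0\<close> refers to the continuous representative of \<open>v\<close>, which is unique;
  it exists for \<open>H\<^sup>\<sigma>(0,T)\<close> with \<open>\<sigma> > 1/2\<close> and for \<open>H\<^sup>m(0,T)\<close> with \<open>m \<ge> 1\<close>.\<close>

definition zero_trace :: "real \<Rightarrow> (real \<Rightarrow> real) \<Rightarrow> bool" where
  "zero_trace T v \<longleftrightarrow> (\<exists>u. continuous_on {0..T} u \<and> ae_eq T v u \<and> u 0 = 0)"

text \<open>\<open>H\<^sub>m(0,T)\<close> for \<open>m \<in> \<nat>\<close>; for \<open>m = 0\<close> this is \<open>L\<^sup>2(0,T)\<close>.\<close>

definition H_nat :: "real \<Rightarrow> nat \<Rightarrow> (real \<Rightarrow> real) set" where
  "H_nat T m = {v \<in> Sobolev T m. \<forall>k<m. \<exists>w. weak_deriv T k v w \<and> zero_trace T w}"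

text \<open>\<open>H\<^sub>\<sigma>(0,T)\<close> for \<open>0 < \<sigma> < 1\<close>.\<close>

definition H_frac :: "real \<Rightarrow> real \<Rightarrow> (real \<Rightarrow> real) set" where
  "H_frac T \<sigma> =
     (if \<sigma> < 1/2 then Slobodeckij T \<sigma>
      else if \<sigma> = 1/2 then
        {v \<in> Slobodeckij T \<sigma>. (\<integral>\<^sup>+t\<in>{0<..<T}. ennreal (\<bar>v t\<bar>\<^sup>2 / t) \<partial>lebesgue) < \<infinity>}
      else {v \<in> Slobodeckij T \<sigma>. zero_trace T v})"

text \<open>\<open>H\<^sub>\<gamma>(0,T)\<close> for real \<open>\<gamma> \<ge> 0\<close>, with \<open>m = \<lfloor>\<gamma>\<rfloor>\<close> and \<open>\<sigma> = \<gamma> - m\<close>.  Integer orders are covered by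
  \<open>H_nat\<close>, so \<open>\<sigma> = 1\<close> is not needed in \<open>H_frac\<close>.  For \<open>m = 0\<close> the weak derivative of order \<open>0\<close>
  is \<open>v\<close> itself.\<close>

definition H :: "real \<Rightarrow> real \<Rightarrow> (real \<Rightarrow> real) set" where
  "H T \<gamma> =
     (if \<gamma> \<in> \<nat> then H_nat T (nat \<lfloor>\<gamma>\<rfloor>)
      else {v \<in> H_nat T (nat \<lfloor>\<gamma>\<rfloor>). \<exists>w \<in> H_frac T (frac \<gamma>). weak_deriv T (nat \<lfloor>\<gamma>\<rfloor>) v w})"

text \<open>The inverse of \<open>J\<^sup>\<alpha> : L\<^sup>2(0,T) \<rightarrow> H\<^sub>\<alpha>(0,T)\<close>, with domain \<open>H\<^sub>\<alpha>(0,T)\<close> (and the value \<open>undefined\<close>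
  outside).  The choice is only among almost everywhere equal representatives, since \<open>J\<^sup>\<alpha>\<close> is
  injective on \<open>L\<^sup>2(0,T)\<close>.\<close>

definition frac_deriv :: "real \<Rightarrow> real \<Rightarrow> (real \<Rightarrow> real) \<Rightarrow> real \<Rightarrow> real" where
  "frac_deriv T \<alpha> = (\<lambda>v\<in>H T \<alpha>. SOME w. w \<in> L2 T \<and> ae_eq T (J \<alpha> w) v)"

end

theory Submission imports Defs begin

text \<open>
  The theorem is the semigroup law \<open>J\<^sup>\<beta> J\<^sup>\<alpha> = J\<^sup>\<alpha>\<^sup>+\<^sup>\<beta>\<close> read backwards.  For every
  \<open>\<gamma> \<ge> 0\<close> the space \<open>H T \<gamma>\<close> consists exactly of the functions that agree almost everywhere with
  \<open>J\<^sup>\<gamma> z\<close> for some square-integrable \<open>z\<close> (lemma \<open>H_iff_Jx\<close>), and \<open>z\<close> is unique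
  (\<open>Jx_injective\<close>).  Hence \<open>v\<close> of order \<open>\<alpha> + \<beta>\<close> is \<open>J\<^sup>\<beta> (J\<^sup>\<alpha> z)\<close>, its derivative of order
  \<open>\<beta>\<close> is \<open>J\<^sup>\<alpha> z\<close>, and the derivative of order \<open>\<alpha>\<close> of the latter is \<open>z\<close>, which is also the derivative
  of order \<open>\<alpha> + \<beta>\<close> of \<open>v\<close>.

  For integer orders the description of \<open>H T m\<close> is integration by parts in one direction and the lemma of
  du Bois-Reymond in the other; the zero traces remove the constants of integration.  The work lies in the
  orders \<open>0 < \<sigma> < 1\<close>, where the Slobodeckij seminorm must be compared with the \<open>L\<^sup>2\<close> norm of \<open>z\<close>.
  Estimates by absolute values diverge logarithmically, so cancellation has to be used.

  The tool is an exact identity on the whole line (\<open>square_function_identity\<close>).  If \<open>g\<close> is integrable with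
  mean zero and finite logarithmic energy, and \<open>g\<^sub>h\<close> is its dilate by \<open>h\<close>, then the integral of
  \<open>\<parallel>g\<^sub>h * f\<parallel>\<^sup>2\<close> against \<open>dh/h\<close> equals \<open>c \<parallel>f\<parallel>\<^sup>2\<close>, where \<open>c\<close> depends only on \<open>g\<close>.
  Expanding the square leaves the autocorrelation of \<open>f\<close>, and the integral over dilations becomes a Frullani
  integral.  With \<open>g(x) = k(x + 1) - k(x)\<close>, where \<open>k\<close> is the kernel of \<open>J\<^sup>\<sigma>\<close>, the left-hand side is half
  the squared Slobodeckij seminorm of \<open>J\<^sup>\<sigma> f\<close> on the line (\<open>rl_energy\<close>).  This shows at once that \<open>J\<^sup>\<sigma>\<close> maps
  into \<open>H\<^sub>\<sigma>\<close>; the weighted condition for \<open>\<sigma> = 1/2\<close> comes from those pairs of points that lie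
  on different sides of \<open>0\<close> (\<open>energy_ge_hardy\<close>).

  Conversely, a function of \<open>H\<^sub>\<sigma>\<close> satisfies the fractional Hardy inequality (\<open>hardy_small\<close>, \<open>hardy_large\<close>, or the
  definition if \<open>\<sigma> = 1/2\<close>), which is what is needed to extend it by zero to the left with finite energy; reflection at
  \<open>T\<close> then gives a function \<open>V\<close> on the line with compact support.  The averages of \<open>V\<close> over short intervals are
  explicit fractional integrals \<open>J\<^sup>\<sigma> w\<^sub>\<delta>\<close>.  They converge to \<open>V\<close> in energy, so by the identity the
  \<open>w\<^sub>\<delta>\<close> form a Cauchy sequence in \<open>L\<^sup>2\<close>, and their limit \<open>w\<close> satisfies \<open>J\<^sup>\<sigma> w = V\<close>
  (\<open>finite_energy_imp_rl\<close>).
\<close>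

section \<open>Square-integrable functions on the line\<close>

definition L2R :: "(real \<Rightarrow> real) set" where
  "L2R = {f. f \<in> borel_measurable borel \<and> integrable lborel (\<lambda>x. (f x)\<^sup>2)}"

lemma L2R_measurable [measurable_dest]: "f \<in> L2R \<Longrightarrow> f \<in> borel_measurable borel"
  by (simp add: L2R_def)

lemma L2R_square: "f \<in> L2R \<Longrightarrow> integrable lborel (\<lambda>x. (f x)\<^sup>2)"
  by (simp add: L2R_def)

lemma L2R_I: "f \<in> borel_measurable borel \<Longrightarrow> integrable lborel (\<lambda>x. (f x)\<^sup>2) \<Longrightarrow> f \<in> L2R"
  by (simp add: L2R_def)

lemma L2R_I_nn:
  assumes [measurable]: "f \<in> borel_measurable borel"
    and "(\<integral>\<^sup>+x. ennreal ((f x)\<^sup>2) \<partial>lborel) < \<infinity>"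
  shows "f \<in> L2R"
  using assms(2) by (intro L2R_I integrableI_nonneg) auto

lemma L2R_nn:
  assumes "f \<in> L2R"
  shows "(\<integral>\<^sup>+x. ennreal ((f x)\<^sup>2) \<partial>lborel) = ennreal (\<integral>x. (f x)\<^sup>2 \<partial>lborel)"
  using assms by (intro nn_integral_eq_integral L2R_square) auto

lemma L2R_mult_integrable:
  assumes f: "f \<in> L2R" and g: "g \<in> L2R"
  shows "integrable lborel (\<lambda>x. f x * g x)"
proof (rule Bochner_Integration.integrable_bound)
  show "integrable lborel (\<lambda>x. (f x)\<^sup>2 + (g x)\<^sup>2)"
    using f g by (intro Bochner_Integration.integrable_add L2R_square)
  show "(\<lambda>x. f x * g x) \<in> borel_measurable lborel"
    using f[THEN L2R_measurable] g[THEN L2R_measurable] by measurable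
  show "AE x in lborel. norm (f x * g x) \<le> norm ((f x)\<^sup>2 + (g x)\<^sup>2)"
  proof (intro AE_I2)
    fix x
    have "0 \<le> (\<bar>f x\<bar> - \<bar>g x\<bar>)\<^sup>2" by simp
    also have "\<dots> = (f x)\<^sup>2 + (g x)\<^sup>2 - 2 * \<bar>f x * g x\<bar>"
      unfolding power2_diff by (simp add: abs_mult)
    finally show "norm (f x * g x) \<le> norm ((f x)\<^sup>2 + (g x)\<^sup>2)" by simp
  qed
qed

lemma L2R_add:
  assumes f: "f \<in> L2R" and g: "g \<in> L2R"
  shows "(\<lambda>x. f x + g x) \<in> L2R"
proof (rule L2R_I)
  show "(\<lambda>x. f x + g x) \<in> borel_measurable borel"
    using f[THEN L2R_measurable] g[THEN L2R_measurable] by measurable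
  have "integrable lborel (\<lambda>x. (f x)\<^sup>2 + (g x)\<^sup>2 + 2 * (f x * g x))"
    by (intro Bochner_Integration.integrable_add L2R_square f g integrable_mult_right L2R_mult_integrable)
  then show "integrable lborel (\<lambda>x. (f x + g x)\<^sup>2)"
    by (simp add: power2_sum mult.assoc)
qed

lemma L2R_scale:
  assumes "f \<in> L2R" shows "(\<lambda>x. c * f x) \<in> L2R"
  using assms by (auto simp: L2R_def power_mult_distrib)

lemma L2R_diff:
  assumes f: "f \<in> L2R" and g: "g \<in> L2R"
  shows "(\<lambda>x. f x - g x) \<in> L2R"
  using L2R_add[OF f L2R_scale[OF g, of "-1"]] by simp

lemma L2R_affine:
  assumes "f \<in> L2R" "a \<noteq> 0" shows "(\<lambda>x. f (b + a * x)) \<in> L2R"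
proof (rule L2R_I)
  show "(\<lambda>x. f (b + a * x)) \<in> borel_measurable borel"
    using assms(1)[THEN L2R_measurable] by measurable
  show "integrable lborel (\<lambda>x. (f (b + a * x))\<^sup>2)"
    using lborel_integrable_real_affine[OF L2R_square[OF assms(1)] assms(2), of b] by simp
qed

lemma integrable_shift: "integrable lborel f \<Longrightarrow> integrable lborel (\<lambda>x. f (x + r))" for f :: "real \<Rightarrow> real"
  using lborel_integrable_real_affine[of f 1 r] by (simp add: add.commute)

lemma integral_shift: "(\<integral>x. f (x + r) \<partial>lborel) = (\<integral>x. f x \<partial>lborel)" for f :: "real \<Rightarrow> real"
  using lborel_integral_real_affine[of 1 f r] by (simp add: add.commute)

lemma nn_integral_shift:
  fixes f :: "real \<Rightarrow> ennreal"
  assumes "f \<in> borel_measurable borel"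
  shows "(\<integral>\<^sup>+x. f (x + r) \<partial>lborel) = (\<integral>\<^sup>+x. f x \<partial>lborel)"
  using nn_integral_real_affine[OF assms, of 1 r] by (simp add: add.commute)

lemma L2R_shift: "f \<in> L2R \<Longrightarrow> (\<lambda>x. f (x + r)) \<in> L2R"
  using L2R_affine[of f 1 r] by (simp add: add.commute)

lemma L2R_Cauchy_Schwarz:
  assumes f: "f \<in> L2R" and g: "g \<in> L2R"
  shows "\<bar>\<integral>x. f x * g x \<partial>lborel\<bar> \<le> sqrt (\<integral>x. (f x)\<^sup>2 \<partial>lborel) * sqrt (\<integral>x. (g x)\<^sup>2 \<partial>lborel)"
proof -
  note [measurable] = f[THEN L2R_measurable] g[THEN L2R_measurable]
  have "ennreal ((\<integral>x. \<bar>f x * g x\<bar> \<partial>lborel)\<^sup>2) = (\<integral>\<^sup>+x. ennreal \<bar>f x\<bar> * ennreal \<bar>g x\<bar> \<partial>lborel)\<^sup>2"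
    using L2R_mult_integrable[OF f g]
    by (subst ennreal_power[symmetric], simp)
       (subst nn_integral_eq_integral[symmetric], auto simp: abs_mult[symmetric] ennreal_mult[symmetric])
  also have "\<dots> \<le> (\<integral>\<^sup>+x. (ennreal \<bar>f x\<bar>)\<^sup>2 \<partial>lborel) * (\<integral>\<^sup>+x. (ennreal \<bar>g x\<bar>)\<^sup>2 \<partial>lborel)"
    by (rule Cauchy_Schwarz_nn_integral) auto
  also have "\<dots> = ennreal ((\<integral>x. (f x)\<^sup>2 \<partial>lborel) * (\<integral>x. (g x)\<^sup>2 \<partial>lborel))"
    using L2R_nn[OF f] L2R_nn[OF g] by (simp add: ennreal_power ennreal_mult)
  finally have "(\<integral>x. \<bar>f x * g x\<bar> \<partial>lborel)\<^sup>2 \<le> (\<integral>x. (f x)\<^sup>2 \<partial>lborel) * (\<integral>x. (g x)\<^sup>2 \<partial>lborel)"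
    by (subst (asm) ennreal_le_iff) auto
  then have "(\<integral>x. \<bar>f x * g x\<bar> \<partial>lborel) \<le> sqrt (\<integral>x. (f x)\<^sup>2 \<partial>lborel) * sqrt (\<integral>x. (g x)\<^sup>2 \<partial>lborel)"
    by (metis real_le_rsqrt real_sqrt_mult)
  moreover have "\<bar>\<integral>x. f x * g x \<partial>lborel\<bar> \<le> (\<integral>x. \<bar>f x * g x\<bar> \<partial>lborel)"
    using integral_norm_bound[of lborel "\<lambda>x. f x * g x"] by simp
  ultimately show ?thesis by linarith
qed

text \<open>
  For an open set \<open>U\<close> of finite measure the absolute value \<open>|1\<^sub>U(x + r) - 1\<^sub>U(x)|\<close> is the difference itself plus
  \<open>2 \<cdot> 1\<^sub>U(x) (1 - 1\<^sub>U(x + r))\<close>.  The difference has integral \<open>0\<close>, and the second term tends to \<open>0\<close>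
  pointwise because \<open>U\<close> is open.  Outer regularity transfers this to \<open>A\<close>.
\<close>

lemma indicator_translation_continuous:
  fixes X :: "nat \<Rightarrow> real"
  assumes A: "A \<in> sets borel" "emeasure lborel A < \<infinity>" and X: "X \<longlonglongrightarrow> 0"
  shows "(\<lambda>n. \<integral>x. \<bar>indicator A (x + X n) - indicator A x :: real\<bar> \<partial>lborel) \<longlonglongrightarrow> 0"
proof (rule LIMSEQ_I)
  fix e :: real assume e: "e > 0"
  obtain U where U: "open U" "A \<subseteq> U" "emeasure lborel (U - A) < ennreal (e / 4)"
    using outer_regular_lborel[of A "e/4"] A e by auto
  define i :: "real \<Rightarrow> real" where "i = indicator U"
  define d :: "real \<Rightarrow> real" where "d = indicator (U - A)"
  have mU [measurable]: "U \<in> sets borel" "U - A \<in> sets borel" using U A by auto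
  note [measurable] = A(1)
  have "emeasure lborel U \<le> emeasure lborel A + emeasure lborel (U - A)"
    using U(2) A(1) mU by (subst plus_emeasure) (auto intro!: emeasure_mono)
  also have "\<dots> < \<infinity>"
    using A(2) order_less_trans[OF U(3) ennreal_less_top] by (simp add: less_top)
  finally have fU: "emeasure lborel U < \<infinity>" .
  have fd: "emeasure lborel (U - A) < \<infinity>" using order_less_trans[OF U(3) ennreal_less_top] by simp
  have ii: "integrable lborel i" unfolding i_def using fU by simp
  have id: "integrable lborel d" unfolding d_def using fd by simp
  have ii': "integrable lborel (\<lambda>x. i (x + r))" for r
    using lborel_integrable_real_affine[OF ii, of 1 r] by (simp add: add.commute)
  have id': "integrable lborel (\<lambda>x. d (x + r))" for r
    using lborel_integrable_real_affine[OF id, of 1 r] by (simp add: add.commute)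
  have intd: "(\<integral>x. d x \<partial>lborel) < e/4"
  proof -
    have "ennreal (measure lborel (U - A)) < ennreal (e/4)"
      using U(3) fd emeasure_eq_ennreal_measure[of lborel "U - A"] by (simp add: less_top)
    then show ?thesis unfolding d_def by (simp add: ennreal_less_iff)
  qed
  have im [measurable]: "i \<in> borel_measurable borel" "d \<in> borel_measurable borel" unfolding i_def d_def by measurable
  have "(\<lambda>n. \<integral>x. i x * (1 - i (x + X n)) \<partial>lborel) \<longlonglongrightarrow> (\<integral>x. 0 \<partial>(lborel :: real measure))"
  proof (rule integral_dominated_convergence[where w = i])
    show "AE x in lborel. (\<lambda>n. i x * (1 - i (x + X n))) \<longlonglongrightarrow> 0"
    proof (intro AE_I2)
      fix x :: real
      show "(\<lambda>n. i x * (1 - i (x + X n))) \<longlonglongrightarrow> 0"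
      proof (cases "x \<in> U")
        case True
        have "(\<lambda>n. x + X n) \<longlonglongrightarrow> x" using tendsto_add[OF tendsto_const X, of x] by simp
        then have "\<forall>\<^sub>F n in sequentially. x + X n \<in> U"
          using U(1) True by (rule topological_tendstoD)
        then have "\<forall>\<^sub>F n in sequentially. i x * (1 - i (x + X n)) = 0"
          by eventually_elim (simp add: i_def)
        then show ?thesis by (rule tendsto_eventually)
      qed (simp add: i_def)
    qed
  qed (use ii im(1) in \<open>auto simp: i_def indicator_def\<close>)
  then have "(\<lambda>n. \<integral>x. i x * (1 - i (x + X n)) \<partial>lborel) \<longlonglongrightarrow> 0" by simp
  from LIMSEQ_D[OF this, of "e/4"] e obtain N where
    N: "\<And>n. n \<ge> N \<Longrightarrow> \<bar>\<integral>x. i x * (1 - i (x + X n)) \<partial>lborel\<bar> < e/4" by auto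
  have "norm ((\<integral>x. \<bar>indicator A (x + X n) - indicator A x :: real\<bar> \<partial>lborel) - 0) < e" if "n \<ge> N" for n
  proof -
    have p: "\<bar>indicator A (x + X n) - indicator A x :: real\<bar>
       \<le> i (x + X n) - i x + 2 * (i x * (1 - i (x + X n))) + d (x + X n) + d x" for x
      using U(2) by (auto simp: i_def d_def indicator_def)
    have in1: "integrable lborel (\<lambda>x. i x * (1 - i (x + X n)))"
      by (rule Bochner_Integration.integrable_bound[OF ii]) (auto simp: i_def indicator_def)
    have "(\<integral>x. \<bar>indicator A (x + X n) - indicator A x :: real\<bar> \<partial>lborel)
      \<le> (\<integral>x. i (x + X n) - i x + 2 * (i x * (1 - i (x + X n))) + d (x + X n) + d x \<partial>lborel)"
      by (rule integral_mono'[OF _ p order_trans[OF abs_ge_zero p]])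
         (intro Bochner_Integration.integrable_add Bochner_Integration.integrable_diff ii ii' in1 id id' integrable_mult_right)
    also have "\<dots> = 2 * (\<integral>x. i x * (1 - i (x + X n)) \<partial>lborel) + 2 * (\<integral>x. d x \<partial>lborel)"
      using ii ii' in1 id id' by (simp add: integral_shift)
    also have "\<dots> < e" using N[OF that] intd by linarith
    finally show ?thesis by simp
  qed
  then show "\<exists>no. \<forall>n\<ge>no. norm ((\<integral>x. \<bar>indicator A (x + X n) - indicator A x :: real\<bar> \<partial>lborel) - 0) < e"
    by blast
qed

lemma L1_translation_continuous:
  fixes X :: "nat \<Rightarrow> real"
  assumes f: "integrable lborel (f :: real \<Rightarrow> real)" and X: "X \<longlonglongrightarrow> 0"
  shows "(\<lambda>n. \<integral>x. \<bar>f (x + X n) - f x\<bar> \<partial>lborel) \<longlonglongrightarrow> 0"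
  using f
proof (induct rule: integrable_induct)
  case (base A c)
  have "(\<lambda>n. (\<integral>x. \<bar>indicator A (x + X n) - indicator A x :: real\<bar> \<partial>lborel) * \<bar>c\<bar>) \<longlonglongrightarrow> 0 * \<bar>c\<bar>"
    using base X by (intro tendsto_mult indicator_translation_continuous tendsto_const) auto
  moreover have "(\<integral>x. \<bar>indicator A (x + X n) - indicator A x :: real\<bar> \<partial>lborel) * \<bar>c\<bar>
      = (\<integral>x. \<bar>indicat_real A (x + X n) *\<^sub>R c - indicat_real A x *\<^sub>R c\<bar> \<partial>lborel)" for n
    by (subst integral_mult_left_zero[symmetric])
       (auto intro!: Bochner_Integration.integral_cong simp: abs_mult[symmetric] algebra_simps)
  ultimately show ?case by simp
next
  case (add f g)
  have b: "(\<integral>x. \<bar>f (x + X n) + g (x + X n) - (f x + g x)\<bar> \<partial>lborel) \<le>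
     (\<integral>x. \<bar>f (x + X n) - f x\<bar> \<partial>lborel) + (\<integral>x. \<bar>g (x + X n) - g x\<bar> \<partial>lborel)" for n
    using add(1,3) by (subst Bochner_Integration.integral_add[symmetric])
        (auto intro!: integral_mono' integrable_abs Bochner_Integration.integrable_diff integrable_shift)
  have "(\<lambda>n. (\<integral>x. \<bar>f (x + X n) - f x\<bar> \<partial>lborel) + (\<integral>x. \<bar>g (x + X n) - g x\<bar> \<partial>lborel)) \<longlonglongrightarrow> 0"
    using tendsto_add[OF add(2,4)] by simp
  then show ?case
    by (rule tendsto_sandwich[OF _ _ tendsto_const, rotated 2]) (auto intro!: always_eventually b)
next
  case (lim f s)
  have l: "(\<lambda>i. \<integral>x. \<bar>s i x - f x\<bar> \<partial>lborel) \<longlonglongrightarrow> (\<integral>x. 0 \<partial>(lborel :: real measure))"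
  proof (rule integral_dominated_convergence[where w = "\<lambda>x. 3 * \<bar>f x\<bar>"])
    show "AE x in lborel. (\<lambda>i. \<bar>s i x - f x\<bar>) \<longlonglongrightarrow> 0"
    proof (intro AE_I2)
      fix x :: real
      have "(\<lambda>i. s i x) \<longlonglongrightarrow> f x" using lim(3) by simp
      then show "(\<lambda>i. \<bar>s i x - f x\<bar>) \<longlonglongrightarrow> 0"
        using LIM_zero tendsto_rabs_zero by blast
    qed
    show "AE x in lborel. norm \<bar>s i x - f x\<bar> \<le> 3 * \<bar>f x\<bar>" for i
    proof (intro AE_I2)
      fix x :: real
      show "norm \<bar>s i x - f x\<bar> \<le> 3 * \<bar>f x\<bar>" using lim(4)[of x i] by auto
    qed
  qed (use lim(1,5) in \<open>auto intro!: measurable\<close>)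
  show ?case
  proof (rule LIMSEQ_I)
    fix e :: real assume e: "e > 0"
    from LIMSEQ_D[OF l, of "e/4"] e obtain i where i: "(\<integral>x. \<bar>s i x - f x\<bar> \<partial>lborel) < e/4" by auto
    from LIMSEQ_D[OF lim(2)[of i], of "e/4"] e obtain N where
      N: "\<And>n. n \<ge> N \<Longrightarrow> (\<integral>x. \<bar>s i (x + X n) - s i x\<bar> \<partial>lborel) < e/4" by auto
    have "norm ((\<integral>x. \<bar>f (x + X n) - f x\<bar> \<partial>lborel) - 0) < e" if "n \<ge> N" for n
    proof -
      have is': "integrable lborel (\<lambda>x. \<bar>s i x - f x\<bar>)"
        using lim(1,5) by auto
      have is2: "integrable lborel (\<lambda>x. \<bar>s i (x + X n) - s i x\<bar>)"
        by (intro integrable_abs Bochner_Integration.integrable_diff lim(1) integrable_shift)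
      have "(\<integral>x. \<bar>f (x + X n) - f x\<bar> \<partial>lborel) \<le>
        (\<integral>x. \<bar>s i (x + X n) - f (x + X n)\<bar> + \<bar>s i (x + X n) - s i x\<bar> + \<bar>s i x - f x\<bar> \<partial>lborel)"
        using is' is2 integrable_shift[OF is', of "X n"]
        by (intro integral_mono' Bochner_Integration.integrable_add) auto
      also have "\<dots> = (\<integral>x. \<bar>s i (x + X n) - f (x + X n)\<bar> \<partial>lborel) + (\<integral>x. \<bar>s i (x + X n) - s i x\<bar> \<partial>lborel)
         + (\<integral>x. \<bar>s i x - f x\<bar> \<partial>lborel)"
        using is' is2 integrable_shift[OF is', of "X n"] by simp
      also have "\<dots> < e"
        using i N[OF that] e integral_shift[of "\<lambda>x. \<bar>s i x - f x\<bar>" "X n"] by linarith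
      finally show ?thesis by simp
    qed
    then show "\<exists>no. \<forall>n\<ge>no. norm ((\<integral>x. \<bar>f (x + X n) - f x\<bar> \<partial>lborel) - 0) < e" by blast
  qed
qed

text \<open>
  A function bounded by \<open>N\<close> changes under translation by at most \<open>2N\<close>, so the square of the change is at most
  \<open>2N\<close> times the change, and continuity in \<open>L\<^sup>1\<close> applies.  Every square-integrable function is close in
  \<open>L\<^sup>2\<close> to one that is bounded and has bounded support.
\<close>

lemma L2R_translation_continuous:
  fixes X :: "nat \<Rightarrow> real"
  assumes f: "f \<in> L2R" and X: "X \<longlonglongrightarrow> 0"
  shows "(\<lambda>n. \<integral>x. (f (x + X n) - f x)\<^sup>2 \<partial>lborel) \<longlonglongrightarrow> 0"
proof -
  note [measurable] = f[THEN L2R_measurable]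
  define t where "t N x = (if \<bar>x\<bar> \<le> real N \<and> \<bar>f x\<bar> \<le> real N then f x else 0)" for N x
  have tm [measurable]: "t N \<in> borel_measurable borel" for N unfolding t_def by measurable
  have ti: "integrable lborel (t N)" for N
  proof (rule Bochner_Integration.integrable_bound)
    show "integrable lborel (\<lambda>x. real N * indicator {-real N..real N} x)"
      by (intro integrable_mult_right integrable_real_indicator) auto
  qed (auto simp: t_def indicator_def abs_le_iff)
  have tL: "t N \<in> L2R" for N
    by (rule L2R_I[OF tm], rule Bochner_Integration.integrable_bound[OF L2R_square[OF f]]) (auto simp: t_def)
  have l: "(\<lambda>N. \<integral>x. (t N x - f x)\<^sup>2 \<partial>lborel) \<longlonglongrightarrow> (\<integral>x. 0 \<partial>(lborel :: real measure))"
  proof (rule integral_dominated_convergence[where w = "\<lambda>x. (f x)\<^sup>2"])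
    show "AE x in lborel. (\<lambda>N. (t N x - f x)\<^sup>2) \<longlonglongrightarrow> 0"
    proof (intro AE_I2)
      fix x :: real
      obtain M :: nat where "\<bar>x\<bar> \<le> M" "\<bar>f x\<bar> \<le> M"
        using real_arch_simple[of "max \<bar>x\<bar> \<bar>f x\<bar>"] by auto
      then have "\<forall>\<^sub>F N in sequentially. (t N x - f x)\<^sup>2 = 0"
        by (intro eventually_sequentiallyI[of M]) (auto simp: t_def)
      then show "(\<lambda>N. (t N x - f x)\<^sup>2) \<longlonglongrightarrow> 0" by (rule tendsto_eventually)
    qed
  qed (auto simp: t_def L2R_square[OF f])
  show ?thesis
  proof (rule LIMSEQ_I)
    fix e :: real assume e: "e > 0"
    from LIMSEQ_D[OF l, of "e/12"] e obtain N where N: "(\<integral>x. (t N x - f x)\<^sup>2 \<partial>lborel) < e/12" by auto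
    have "(\<lambda>n. 2 * real N * (\<integral>x. \<bar>t N (x + X n) - t N x\<bar> \<partial>lborel)) \<longlonglongrightarrow> 2 * real N * 0"
      by (intro tendsto_mult tendsto_const L1_translation_continuous ti X)
    from LIMSEQ_D[OF this, of "e/12"] e obtain M where
      M: "\<And>n. n \<ge> M \<Longrightarrow> 2 * real N * (\<integral>x. \<bar>t N (x + X n) - t N x\<bar> \<partial>lborel) < e/12" by auto
    have "norm ((\<integral>x. (f (x + X n) - f x)\<^sup>2 \<partial>lborel) - 0) < e" if "n \<ge> M" for n
    proof -
      have iX: "integrable lborel (\<lambda>x. \<bar>t N (x + X n) - t N x\<bar>)"
        using ti[of N] lborel_integrable_real_affine[OF ti[of N], of 1 "X n"]
        by (auto simp: add.commute)
      have s1: "(\<lambda>x. t N x - f x) \<in> L2R" using L2R_diff[OF tL f] .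
      have s2: "(\<lambda>x. t N (x + X n) - f (x + X n)) \<in> L2R" using L2R_shift[OF s1] .
      have pw: "(f (x + X n) - f x)\<^sup>2 \<le> 3 * (t N (x + X n) - f (x + X n))\<^sup>2 + 3 * (2 * real N * \<bar>t N (x + X n) - t N x\<bar>)
          + 3 * (t N x - f x)\<^sup>2" for x
      proof -
        have sq: "(a + b + c)\<^sup>2 \<le> 3 * a\<^sup>2 + 3 * b\<^sup>2 + 3 * c\<^sup>2" for a b c :: real
          using zero_le_power2[of "a - b"] zero_le_power2[of "b - c"] zero_le_power2[of "a - c"]
          by (simp add: power2_eq_square algebra_simps)
        have "\<bar>t N (x + X n) - t N x\<bar> \<le> 2 * real N" unfolding t_def by auto
        then have "(t N (x + X n) - t N x)\<^sup>2 \<le> 2 * real N * \<bar>t N (x + X n) - t N x\<bar>"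
          by (metis abs_ge_zero mult_right_mono power2_abs power2_eq_square)
        then show ?thesis
          using sq[of "-(t N (x + X n) - f (x + X n))" "t N (x + X n) - t N x" "t N x - f x"]
            power2_commute[of "f (x + X n)" "t N (x + X n)"] by simp
      qed
      have "(\<integral>x. (f (x + X n) - f x)\<^sup>2 \<partial>lborel) \<le> (\<integral>x. 3 * (t N (x + X n) - f (x + X n))\<^sup>2 + 3 * (2 * real N * \<bar>t N (x + X n) - t N x\<bar>)
          + 3 * (t N x - f x)\<^sup>2 \<partial>lborel)"
        by (rule integral_mono'[OF _ pw])
           (auto intro!: Bochner_Integration.integrable_add integrable_mult_right iX L2R_square s1 s2)
      also have "\<dots> = 3 * (\<integral>x. (t N (x + X n) - f (x + X n))\<^sup>2 \<partial>lborel) + 3 * (2 * real N * (\<integral>x. \<bar>t N (x + X n) - t N x\<bar> \<partial>lborel))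
          + 3 * (\<integral>x. (t N x - f x)\<^sup>2 \<partial>lborel)"
        using iX L2R_square[OF s1] L2R_square[OF s2] by simp
      also have "\<dots> < e"
        using N M[OF that] e integral_shift[of "\<lambda>x. (t N x - f x)\<^sup>2" "X n"] by linarith
      finally show ?thesis by simp
    qed
    then show "\<exists>no. \<forall>n\<ge>no. norm ((\<integral>x. (f (x + X n) - f x)\<^sup>2 \<partial>lborel) - 0) < e" by blast
  qed
qed

section \<open>Autocorrelation of a square-integrable function\<close>

definition autocorr :: "(real \<Rightarrow> real) \<Rightarrow> real \<Rightarrow> real" where
  "autocorr f r = (\<integral>s. f s * f (s + r) \<partial>lborel)"

lemma autocorr_0: "autocorr f 0 = (\<integral>s. (f s)\<^sup>2 \<partial>lborel)"
  by (simp add: autocorr_def power2_eq_square)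

lemma autocorr_minus: "autocorr f (- r) = autocorr f r"
  unfolding autocorr_def
  using integral_shift[of "\<lambda>s. f s * f (s + - r)" r] by (simp add: mult.commute)

lemma autocorr_abs: "autocorr f \<bar>r\<bar> = autocorr f r"
  by (cases "r \<ge> 0") (auto simp: autocorr_minus)

lemma autocorr_bound:
  assumes f: "f \<in> L2R"
  shows "\<bar>autocorr f r\<bar> \<le> (\<integral>s. (f s)\<^sup>2 \<partial>lborel)"
  using L2R_Cauchy_Schwarz[OF f L2R_shift[OF f, of r]] integral_shift[of "\<lambda>s. (f s)\<^sup>2" r]
  by (simp add: autocorr_def)

text \<open>
  An increment of the autocorrelation pairs \<open>f\<close> with a translation increment of \<open>f\<close>, which is small in \<open>L\<^sup>2\<close>.
\<close>

lemma autocorr_isCont: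
  assumes f: "f \<in> L2R"
  shows "isCont (autocorr f) r"
  unfolding continuous_at_sequentially
proof (intro allI impI)
  fix x :: "nat \<Rightarrow> real" assume x: "x \<longlonglongrightarrow> r"
  define n where "n = (\<integral>s. (f s)\<^sup>2 \<partial>lborel)"
  have "(\<lambda>k. x k - r) \<longlonglongrightarrow> 0" using x LIM_zero by blast
  note lim = L2R_translation_continuous[OF f this]
  have b: "\<bar>autocorr f (x k) - autocorr f r\<bar> \<le> sqrt n * sqrt (\<integral>s. (f (s + (x k - r)) - f s)\<^sup>2 \<partial>lborel)" for k
  proof -
    have "autocorr f (x k) - autocorr f r = (\<integral>s. f s * f (s + x k) - f s * f (s + r) \<partial>lborel)"
      unfolding autocorr_def
      by (intro Bochner_Integration.integral_diff[symmetric] L2R_mult_integrable f L2R_shift)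
    also have "\<dots> = (\<integral>s. f s * (f (s + x k) - f (s + r)) \<partial>lborel)" by (simp add: algebra_simps)
    finally have "\<bar>autocorr f (x k) - autocorr f r\<bar> \<le> sqrt n * sqrt (\<integral>s. (f (s + x k) - f (s + r))\<^sup>2 \<partial>lborel)"
      using L2R_Cauchy_Schwarz[OF f L2R_diff[OF L2R_shift[OF f] L2R_shift[OF f]], of "x k" r]
      by (simp add: n_def)
    also have "(\<integral>s. (f (s + x k) - f (s + r))\<^sup>2 \<partial>lborel) = (\<integral>s. (f (s + (x k - r)) - f s)\<^sup>2 \<partial>lborel)"
      using integral_shift[of "\<lambda>s. (f (s + (x k - r)) - f s)\<^sup>2" r] by (simp add: add.assoc)
    finally show ?thesis .
  qed
  have "(\<lambda>k. sqrt n * sqrt (\<integral>s. (f (s + (x k - r)) - f s)\<^sup>2 \<partial>lborel)) \<longlonglongrightarrow> sqrt n * sqrt 0"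
    by (intro tendsto_mult tendsto_const tendsto_real_sqrt lim)
  then have "(\<lambda>k. sqrt n * sqrt (\<integral>s. (f (s + (x k - r)) - f s)\<^sup>2 \<partial>lborel)) \<longlonglongrightarrow> 0" by simp
  then have "(\<lambda>k. \<bar>autocorr f (x k) - autocorr f r\<bar>) \<longlonglongrightarrow> 0"
    by (rule tendsto_sandwich[OF _ _ tendsto_const, rotated 2]) (auto intro!: always_eventually b)
  then show "(autocorr f \<circ> x) \<longlonglongrightarrow> autocorr f r"
    unfolding o_def by (rule LIM_zero_cancel[OF tendsto_rabs_zero_cancel])
qed

text \<open>
  If \<open>r > 2R\<close>, the points \<open>s\<close> and \<open>s + r\<close> cannot both lie in \<open>[-R, R]\<close>; hence every product
  \<open>f(s) f(s + r)\<close> has a factor from the part of \<open>f\<close> outside \<open>[-R, R]\<close>, whose norm is small for large \<open>R\<close>.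
\<close>

lemma autocorr_tendsto_0:
  assumes f: "f \<in> L2R"
  shows "(autocorr f \<longlongrightarrow> 0) at_top"
proof -
  note [measurable] = f[THEN L2R_measurable]
  define n where "n = (\<integral>s. (f s)\<^sup>2 \<partial>lborel)"
  define h where "h R x = (if \<bar>x\<bar> > real R then f x else 0)" for R :: nat and x
  have hm [measurable]: "h R \<in> borel_measurable borel" for R unfolding h_def by measurable
  have hL: "h R \<in> L2R" for R
    by (rule L2R_I[OF hm], rule Bochner_Integration.integrable_bound[OF L2R_square[OF f]]) (auto simp: h_def)
  have l: "(\<lambda>R. \<integral>x. (h R x)\<^sup>2 \<partial>lborel) \<longlonglongrightarrow> (\<integral>x. 0 \<partial>(lborel :: real measure))"
  proof (rule integral_dominated_convergence[where w = "\<lambda>x. (f x)\<^sup>2"])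
    show "AE x in lborel. (\<lambda>R. (h R x)\<^sup>2) \<longlonglongrightarrow> 0"
    proof (intro AE_I2)
      fix x :: real
      obtain M :: nat where "\<bar>x\<bar> \<le> M" using real_arch_simple by auto
      then have "\<forall>\<^sub>F N in sequentially. (h N x)\<^sup>2 = 0"
        by (intro eventually_sequentiallyI[of M]) (auto simp: h_def)
      then show "(\<lambda>N. (h N x)\<^sup>2) \<longlonglongrightarrow> 0" by (rule tendsto_eventually)
    qed
  qed (auto simp: h_def L2R_square[OF f])
  have b: "\<bar>autocorr f r\<bar> \<le> 2 * (sqrt (\<integral>x. (h R x)\<^sup>2 \<partial>lborel) * sqrt n)" if r: "r > 2 * real R" for r R
  proof -
    let ?a = "\<lambda>f. (\<lambda>x::real. \<bar>f x\<bar> :: real)"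
    have ab: "?a u \<in> L2R" if "u \<in> L2R" for u
      using that by (auto simp: L2R_def)
    have i1: "integrable lborel (\<lambda>s. \<bar>h R s\<bar> * \<bar>f (s + r)\<bar>)"
      using L2R_mult_integrable[OF ab[OF hL] L2R_shift[OF ab[OF f]]] .
    have i2: "integrable lborel (\<lambda>s. \<bar>f s\<bar> * \<bar>h R (s + r)\<bar>)"
      using L2R_mult_integrable[OF ab[OF f] L2R_shift[OF ab[OF hL]]] .
    have "\<bar>autocorr f r\<bar> \<le> (\<integral>s. \<bar>f s * f (s + r)\<bar> \<partial>lborel)"
      unfolding autocorr_def using integral_norm_bound[of lborel "\<lambda>s. f s * f (s + r)"] by simp
    also have "\<dots> \<le> (\<integral>s. \<bar>h R s\<bar> * \<bar>f (s + r)\<bar> + \<bar>f s\<bar> * \<bar>h R (s + r)\<bar> \<partial>lborel)"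
      by (rule integral_mono'[OF Bochner_Integration.integrable_add[OF i1 i2]]) (use r in \<open>auto simp: h_def abs_mult\<close>)
    also have "\<dots> = (\<integral>s. \<bar>h R s\<bar> * \<bar>f (s + r)\<bar> \<partial>lborel) + (\<integral>s. \<bar>f s\<bar> * \<bar>h R (s + r)\<bar> \<partial>lborel)"
      using i1 i2 by simp
    also have "\<dots> \<le> 2 * (sqrt (\<integral>x. (h R x)\<^sup>2 \<partial>lborel) * sqrt n)"
      using L2R_Cauchy_Schwarz[OF ab[OF hL] L2R_shift[OF ab[OF f]], of R r]
        L2R_Cauchy_Schwarz[OF ab[OF f] L2R_shift[OF ab[OF hL]], of R r]
        integral_shift[of "\<lambda>s. (f s)\<^sup>2" r] integral_shift[of "\<lambda>s. (h R s)\<^sup>2" r]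
      by (simp add: n_def mult.commute)
    finally show ?thesis .
  qed
  have "(\<lambda>R. 2 * (sqrt (\<integral>x. (h R x)\<^sup>2 \<partial>lborel) * sqrt n)) \<longlonglongrightarrow> 2 * (sqrt 0 * sqrt n)"
    using l by (intro tendsto_intros) simp
  then have l2: "(\<lambda>R. 2 * (sqrt (\<integral>x. (h R x)\<^sup>2 \<partial>lborel) * sqrt n)) \<longlonglongrightarrow> 0" by simp
  show ?thesis
  proof (rule tendstoI)
    fix e :: real assume "e > 0"
    with LIMSEQ_D[OF l2 this] obtain R where "\<bar>2 * (sqrt (\<integral>x. (h R x)\<^sup>2 \<partial>lborel) * sqrt n)\<bar> < e" by force
    then have R: "2 * (sqrt (\<integral>x. (h R x)\<^sup>2 \<partial>lborel) * sqrt n) < e" by linarith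
    show "\<forall>\<^sub>F x in at_top. dist (autocorr f x) 0 < e"
      using eventually_gt_at_top[of "2 * real R"]
    proof eventually_elim
      case (elim x)
      show ?case using b[OF elim] R by simp
    qed
  qed
qed

section \<open>The square function identity\<close>

text \<open>
  For \<open>h > 0\<close> this is the convolution of \<open>f\<close> with the dilate \<open>x \<mapsto> g(x/h)/h\<close>.  In this form the kernel
  stays fixed and only the argument of \<open>f\<close> depends on \<open>h\<close>.
\<close>

definition dconv :: "(real \<Rightarrow> real) \<Rightarrow> (real \<Rightarrow> real) \<Rightarrow> real \<Rightarrow> real \<Rightarrow> real" where
  "dconv g f h t = (\<integral>x. g x * f (t - h * x) \<partial>lborel)"

lemma dconv_measurable [measurable]:
  assumes [measurable]: "g \<in> borel_measurable borel" "f \<in> borel_measurable borel"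
  shows "(\<lambda>t. dconv g f h t) \<in> borel_measurable borel"
  unfolding dconv_def by measurable

lemma integrable_tensor:
  fixes p q :: "real \<Rightarrow> real"
  assumes p: "integrable lborel p" and q: "integrable lborel q"
  shows "integrable (lborel \<Otimes>\<^sub>M lborel) (\<lambda>z. p (fst z) * q (snd z))"
    and "(\<integral>z. p (fst z) * q (snd z) \<partial>(lborel \<Otimes>\<^sub>M lborel)) = (\<integral>x. p x \<partial>lborel) * (\<integral>x. q x \<partial>lborel)"
proof -
  show i: "integrable (lborel \<Otimes>\<^sub>M lborel) (\<lambda>z. p (fst z) * q (snd z))"
  proof (rule lborel_pair.Fubini_integrable)
    show "(\<lambda>z. p (fst z) * q (snd z)) \<in> borel_measurable (lborel \<Otimes>\<^sub>M lborel)"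
      using p q by measurable
  qed (use p q in \<open>auto simp: abs_mult\<close>)
  show "(\<integral>z. p (fst z) * q (snd z) \<partial>(lborel \<Otimes>\<^sub>M lborel)) = (\<integral>x. p x \<partial>lborel) * (\<integral>x. q x \<partial>lborel)"
    using lborel_pair.integral_fst'[OF i] by simp
qed

lemma dconv_AE_integrable:
  assumes g: "integrable lborel g" and f: "f \<in> L2R"
  shows "AE t in lborel. integrable lborel (\<lambda>x. g x * f (t - h * x))"
proof -
  note [measurable] = f[THEN L2R_measurable] borel_measurable_integrable[OF g]
  have [measurable]: "g \<in> borel_measurable borel" using borel_measurable_integrable[OF g] by simp
  have "integrable (lborel \<Otimes>\<^sub>M lborel) (\<lambda>z. \<bar>g (fst z)\<bar> * (f (snd z - h * fst z))\<^sup>2)"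
  proof (rule lborel_pair.Fubini_integrable)
    show "(\<lambda>z. \<bar>g (fst z)\<bar> * (f (snd z - h * fst z))\<^sup>2) \<in> borel_measurable (lborel \<Otimes>\<^sub>M lborel)"
      by measurable
    have sh: "integrable lborel (\<lambda>y. (f (y - h * x))\<^sup>2)" for x
      using L2R_square[OF L2R_shift[OF f, of "- h * x"]] by simp
    have "(\<integral>y. (f (y - h * x))\<^sup>2 \<partial>lborel) = (\<integral>y. (f y)\<^sup>2 \<partial>lborel)" for x
      using integral_shift[of "\<lambda>y. (f y)\<^sup>2" "- h * x"] by simp
    then show "integrable lborel (\<lambda>x. \<integral>y. norm (\<bar>g (fst (x, y))\<bar> * (f (snd (x, y) - h * fst (x, y)))\<^sup>2) \<partial>lborel)"
      using g by (simp add: abs_mult)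
    show "AE x in lborel. integrable lborel (\<lambda>y. \<bar>g (fst (x, y))\<bar> * (f (snd (x, y) - h * fst (x, y)))\<^sup>2)"
      using sh by auto
  qed
  from lborel_pair.AE_integrable_fst'[OF lborel_pair.integrable_product_swap[OF this]]
  have "AE t in lborel. integrable lborel (\<lambda>x. \<bar>g x\<bar> * (f (t - h * x))\<^sup>2)" by simp
  then show ?thesis
  proof eventually_elim
    case (elim t)
    show ?case
    proof (rule Bochner_Integration.integrable_bound)
      show "integrable lborel (\<lambda>x. \<bar>g x\<bar> + \<bar>g x\<bar> * (f (t - h * x))\<^sup>2)" using elim g by auto
      show "AE x in lborel. norm (g x * f (t - h * x)) \<le> norm (\<bar>g x\<bar> + \<bar>g x\<bar> * (f (t - h * x))\<^sup>2)"
      proof (intro AE_I2)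
        fix x
        have "0 \<le> (\<bar>f (t - h * x)\<bar> - 1/2)\<^sup>2" by simp
        then have "\<bar>f (t - h * x)\<bar> \<le> 1 + (f (t - h * x))\<^sup>2" by (simp add: power2_diff) (simp add: power2_eq_square)
        then have "\<bar>g x\<bar> * \<bar>f (t - h * x)\<bar> \<le> \<bar>g x\<bar> * (1 + (f (t - h * x))\<^sup>2)" by (rule mult_left_mono) simp
        then show "norm (g x * f (t - h * x)) \<le> norm (\<bar>g x\<bar> + \<bar>g x\<bar> * (f (t - h * x))\<^sup>2)"
          by (simp add: abs_mult algebra_simps)
      qed
    qed measurable
  qed
qed

text \<open>
  Expand the square into a double integral over \<open>(x, y)\<close> and integrate over \<open>t\<close> first: what remains of \<open>f\<close> is its
  autocorrelation at \<open>h(x - y)\<close>.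
\<close>

lemma dconv_L2:
  assumes g: "integrable lborel g" and f: "f \<in> L2R"
  shows "dconv g f h \<in> L2R"
    and "(\<integral>t. (dconv g f h t)\<^sup>2 \<partial>lborel) =
         (\<integral>z. g (fst z) * g (snd z) * autocorr f (h * (fst z - snd z)) \<partial>(lborel \<Otimes>\<^sub>M lborel))"
    and "integrable (lborel \<Otimes>\<^sub>M lborel) (\<lambda>z. g (fst z) * g (snd z) * autocorr f (h * (fst z - snd z)))"
proof -
  note [measurable] = f[THEN L2R_measurable]
  have [measurable]: "g \<in> borel_measurable borel" using borel_measurable_integrable[OF g] by simp
  interpret P: pair_sigma_finite "lborel \<Otimes>\<^sub>M lborel :: (real \<times> real) measure" "lborel :: real measure" ..
  let ?\<nu> = "lborel \<Otimes>\<^sub>M lborel :: (real \<times> real) measure"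
  define F where "F w = g (fst (fst w)) * g (snd (fst w)) * (f (snd w - h * fst (fst w)) * f (snd w - h * snd (fst w)))" for w
  have Fm [measurable]: "F \<in> borel_measurable (?\<nu> \<Otimes>\<^sub>M lborel)" unfolding F_def by measurable
  have L: "(\<lambda>t. f (t - h * x)) \<in> L2R" for x using L2R_shift[OF f, of "- h * x"] by simp
  have fa: "(\<lambda>x. \<bar>f x\<bar>) \<in> L2R" using f by (auto simp: L2R_def)
  have ac: "(\<integral>t. u (t - h * x) * u (t - h * y) \<partial>lborel) = autocorr u (h * (x - y))" for u x y
    unfolding autocorr_def using integral_shift[of "\<lambda>t. u t * u (t + h * (x - y))" "- h * x"]
    by (simp add: algebra_simps)
  have acm [measurable]: "autocorr u \<in> borel_measurable borel" if "u \<in> L2R" for u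
    using autocorr_isCont[OF that] by (intro borel_measurable_continuous_onI continuous_at_imp_continuous_on) auto
  note [measurable] = acm[OF f] acm[OF fa]
  have bd: "integrable ?\<nu> (\<lambda>z. g (fst z) * g (snd z) * autocorr u (h * (fst z - snd z)))"
    if u: "u \<in> L2R" for u
  proof (rule Bochner_Integration.integrable_bound)
    note [measurable] = acm[OF u]
    show "integrable ?\<nu> (\<lambda>z. (g (fst z) * g (snd z)) * (\<integral>s. (u s)\<^sup>2 \<partial>lborel))"
      using integrable_tensor(1)[OF g g] by (rule integrable_mult_left)
    show "(\<lambda>z. g (fst z) * g (snd z) * autocorr u (h * (fst z - snd z))) \<in> borel_measurable ?\<nu>" by measurable
    have "\<bar>g (fst z) * g (snd z)\<bar> * \<bar>autocorr u (h * (fst z - snd z))\<bar>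
       \<le> \<bar>g (fst z) * g (snd z)\<bar> * \<bar>\<integral>s. (u s)\<^sup>2 \<partial>lborel\<bar>" for z
      using autocorr_bound[OF u, of "h * (fst z - snd z)"] by (intro mult_left_mono) auto
    then show "AE z in ?\<nu>. norm (g (fst z) * g (snd z) * autocorr u (h * (fst z - snd z)))
       \<le> norm ((g (fst z) * g (snd z)) * (\<integral>s. (u s)\<^sup>2 \<partial>lborel))"
      by (intro AE_I2) (simp add: abs_mult)
  qed
  show "integrable ?\<nu> (\<lambda>z. g (fst z) * g (snd z) * autocorr f (h * (fst z - snd z)))" by (rule bd[OF f])
  have Fi: "integrable (?\<nu> \<Otimes>\<^sub>M lborel) F"
  proof (rule P.Fubini_integrable[OF Fm])
    have e: "(\<integral>t. norm (F (z, t)) \<partial>lborel) = \<bar>g (fst z) * g (snd z) * autocorr (\<lambda>x. \<bar>f x\<bar>) (h * (fst z - snd z))\<bar>" for z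
    proof -
      have "(\<integral>t. norm (F (z, t)) \<partial>lborel) = \<bar>g (fst z) * g (snd z)\<bar> * (\<integral>t. \<bar>f (t - h * fst z)\<bar> * \<bar>f (t - h * snd z)\<bar> \<partial>lborel)"
        unfolding F_def by (simp add: abs_mult mult.assoc)
      also have "\<dots> = \<bar>g (fst z) * g (snd z)\<bar> * autocorr (\<lambda>x. \<bar>f x\<bar>) (h * (fst z - snd z))"
        using ac[of "\<lambda>x. \<bar>f x\<bar>" "fst z" "snd z"] by simp
      moreover have "autocorr (\<lambda>x. \<bar>f x\<bar>) (h * (fst z - snd z)) \<ge> 0"
        unfolding autocorr_def by (intro integral_nonneg_AE) auto
      ultimately show ?thesis by (simp add: abs_mult)
    qed
    show "integrable ?\<nu> (\<lambda>z. \<integral>t. norm (F (z, t)) \<partial>lborel)"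
      unfolding e by (intro integrable_abs bd fa)
    show "AE z in ?\<nu>. integrable lborel (\<lambda>t. F (z, t))"
      unfolding F_def using L2R_mult_integrable[OF L L] by simp
  qed
  have sw: "integrable (lborel \<Otimes>\<^sub>M ?\<nu>) (\<lambda>(t, z). F (z, t))"
    using P.integrable_product_swap[OF Fi] .
  interpret Q: pair_sigma_finite "lborel :: real measure" "lborel \<Otimes>\<^sub>M lborel :: (real \<times> real) measure" ..
  have AEt: "AE t in lborel. (\<integral>z. F (z, t) \<partial>?\<nu>) = (dconv g f h t)\<^sup>2"
    using dconv_AE_integrable[OF g f, of h]
  proof eventually_elim
    case (elim t)
    have "(\<integral>z. F (z, t) \<partial>?\<nu>) = (\<integral>z. (g (fst z) * f (t - h * fst z)) * (g (snd z) * f (t - h * snd z)) \<partial>?\<nu>)"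
      unfolding F_def by (simp add: algebra_simps)
    then show ?case
      using integrable_tensor(2)[OF elim elim] by (simp add: dconv_def power2_eq_square)
  qed
  have i2: "integrable lborel (\<lambda>t. \<integral>z. F (z, t) \<partial>?\<nu>)"
    using Q.integrable_fst'[OF sw] by simp
  have i3: "integrable lborel (\<lambda>t. (dconv g f h t)\<^sup>2)"
    using i2 AEt by (subst integrable_cong_AE[symmetric]) (auto simp: borel_measurable_integrable)
  show "dconv g f h \<in> L2R" by (rule L2R_I[OF dconv_measurable i3]) measurable
  have "(\<integral>t. (dconv g f h t)\<^sup>2 \<partial>lborel) = (\<integral>t. (\<integral>z. F (z, t) \<partial>?\<nu>) \<partial>lborel)"
    using AEt i2 by (intro integral_cong_AE) (auto simp: borel_measurable_integrable elim!: eventually_mono)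
  also have "\<dots> = (\<integral>w. (case w of (t, z) \<Rightarrow> F (z, t)) \<partial>(lborel \<Otimes>\<^sub>M ?\<nu>))"
    using Q.integral_fst'[OF sw] by simp
  also have "\<dots> = (\<integral>w. F w \<partial>(?\<nu> \<Otimes>\<^sub>M lborel))"
    using P.integral_product_swap[OF Fm] .
  also have "\<dots> = (\<integral>z. (\<integral>t. F (z, t) \<partial>lborel) \<partial>?\<nu>)"
    using P.integral_fst'[OF Fi] by simp
  also have "\<dots> = (\<integral>z. g (fst z) * g (snd z) * autocorr f (h * (fst z - snd z)) \<partial>?\<nu>)"
    unfolding F_def by (simp add: ac)
  finally show "(\<integral>t. (dconv g f h t)\<^sup>2 \<partial>lborel) =
         (\<integral>z. g (fst z) * g (snd z) * autocorr f (h * (fst z - snd z)) \<partial>?\<nu>)" .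
qed

text \<open>
  With \<open>h = e\<^sup>\<tau>\<close> the dilation-invariant measure \<open>dh/h\<close> becomes \<open>d\<tau>\<close>, so that dilations turn into
  translations.
\<close>

lemma nn_integral_exp_substitution:
  fixes \<psi> :: "real \<Rightarrow> real"
  assumes [measurable]: "\<psi> \<in> borel_measurable borel"
  shows "(\<integral>\<^sup>+h. ennreal (\<psi> h) * indicator {0<..} h \<partial>lborel) = (\<integral>\<^sup>+\<tau>. ennreal (\<psi> (exp \<tau>) * exp \<tau>) \<partial>lborel)"
proof (rule LIMSEQ_unique)
  show "(\<lambda>n. \<integral>\<^sup>+h. ennreal (\<psi> h * indicator {exp (- real n)..exp (real n)} h) \<partial>lborel)
     \<longlonglongrightarrow> (\<integral>\<^sup>+h. ennreal (\<psi> h) * indicator {0<..} h \<partial>lborel)"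
  proof (rule nn_integral_LIMSEQ)
    show "incseq (\<lambda>n h. ennreal (\<psi> h * indicator {exp (- real n)..exp (real n)} h))"
    proof (intro incseq_SucI le_funI)
      fix n h
      show "ennreal (\<psi> h * indicator {exp (- real n)..exp (real n)} h)
         \<le> ennreal (\<psi> h * indicator {exp (- real (Suc n))..exp (real (Suc n))} h)"
      proof (cases "h \<in> {exp (- real n)..exp (real n)}")
        case True
        have "exp (- real (Suc n)) \<le> exp (- real n)" "exp (real n) \<le> exp (real (Suc n))"
          unfolding exp_le_cancel_iff by auto
        with True have "h \<in> {exp (- real (Suc n))..exp (real (Suc n))}"
          unfolding atLeastAtMost_iff by (meson order_trans)
        with True show ?thesis by (simp del: of_nat_Suc)
      qed simp
    qed
    fix h :: real
    show "(\<lambda>n. ennreal (\<psi> h * indicator {exp (- real n)..exp (real n)} h)) \<longlonglongrightarrow> ennreal (\<psi> h) * indicator {0<..} h"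
    proof (cases "h > 0")
      case True
      obtain M :: nat where M: "\<bar>ln h\<bar> \<le> M" using real_arch_simple by auto
      have "\<forall>\<^sub>F n in sequentially. ennreal (\<psi> h * indicator {exp (- real n)..exp (real n)} h) = ennreal (\<psi> h)"
      proof (intro eventually_sequentiallyI[of M])
        fix n assume "M \<le> n"
        then have "- real n \<le> ln h" "ln h \<le> real n" using M by linarith+
        then have "exp (- real n) \<le> exp (ln h)" "exp (ln h) \<le> exp (real n)" by (simp_all only: exp_le_cancel_iff)
        then show "ennreal (\<psi> h * indicator {exp (- real n)..exp (real n)} h) = ennreal (\<psi> h)"
          using True by simp
      qed
      then show ?thesis using True by (auto intro: tendsto_eventually)
    next
      case False
      then have "h \<notin> {exp (- real n)..exp (real n)}" for n
        using less_le_trans[OF exp_gt_zero, of "- real n" h] by auto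
      then show ?thesis using False by simp
    qed
  qed measurable
  have "(\<integral>\<^sup>+h. ennreal (\<psi> h * indicator {exp (- real n)..exp (real n)} h) \<partial>lborel)
     = (\<integral>\<^sup>+\<tau>. ennreal (\<psi> (exp \<tau>) * exp \<tau> * indicator {- real n..real n} \<tau>) \<partial>lborel)" for n
    by (rule nn_integral_substitution[where g = exp and g' = exp])
       (auto intro!: continuous_intros derivative_eq_intros simp: set_borel_measurable_def)
  moreover have "(\<lambda>n. \<integral>\<^sup>+\<tau>. ennreal (\<psi> (exp \<tau>) * exp \<tau> * indicator {- real n..real n} \<tau>) \<partial>lborel)
     \<longlonglongrightarrow> (\<integral>\<^sup>+\<tau>. ennreal (\<psi> (exp \<tau>) * exp \<tau>) \<partial>lborel)"
  proof (rule nn_integral_LIMSEQ)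
    show "incseq (\<lambda>n \<tau>. ennreal (\<psi> (exp \<tau>) * exp \<tau> * indicator {- real n..real n} \<tau>))"
      by (intro incseq_SucI le_funI) (auto simp: indicator_def)
    fix \<tau> :: real
    obtain M :: nat where M: "\<bar>\<tau>\<bar> \<le> M" using real_arch_simple by auto
    have "\<forall>\<^sub>F n in sequentially. ennreal (\<psi> (exp \<tau>) * exp \<tau> * indicator {- real n..real n} \<tau>) = ennreal (\<psi> (exp \<tau>) * exp \<tau>)" (is "eventually ?P _")
    proof (rule eventually_sequentiallyI)
      fix n assume "M \<le> n"
      then have "real M \<le> real n" by simp
      with M have "\<tau> \<in> {- real n..real n}" by auto
      then show "?P n" by simp
    qed
    then show "(\<lambda>n. ennreal (\<psi> (exp \<tau>) * exp \<tau> * indicator {- real n..real n} \<tau>)) \<longlonglongrightarrow> ennreal (\<psi> (exp \<tau>) * exp \<tau>)"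
      by (rule tendsto_eventually)
  qed measurable
  ultimately show "(\<lambda>n. \<integral>\<^sup>+h. ennreal (\<psi> h * indicator {exp (- real n)..exp (real n)} h) \<partial>lborel)
     \<longlonglongrightarrow> (\<integral>\<^sup>+\<tau>. ennreal (\<psi> (exp \<tau>) * exp \<tau>) \<partial>lborel)" by simp
qed

text \<open>
  The logarithmic energy of the signed density \<open>g\<close> in the sense of potential theory.
\<close>

definition log_energy :: "(real \<Rightarrow> real) \<Rightarrow> real" where
  "log_energy g = - (\<integral>z. g (fst z) * g (snd z) * ln \<bar>fst z - snd z\<bar> \<partial>(lborel \<Otimes>\<^sub>M lborel))"

lemma AE_off_diagonal: "AE z in lborel \<Otimes>\<^sub>M lborel. fst z \<noteq> (snd z :: real)"
proof (rule lborel_pair.AE_pair_measure)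
  have "Measurable.pred (lborel \<Otimes>\<^sub>M lborel) (\<lambda>z. fst z \<noteq> (snd z :: real))" by measurable
  then show "{z \<in> space (lborel \<Otimes>\<^sub>M lborel). fst z \<noteq> (snd z :: real)} \<in> sets (lborel \<Otimes>\<^sub>M lborel)"
    by (simp add: pred_def)
  show "AE x in lborel. AE y in lborel. fst (x, y) \<noteq> (snd (x, y) :: real)"
    using AE_lborel_singleton by (auto simp: eq_commute)
qed

text \<open>
  The Frullani integral in the variable \<open>\<tau> = ln h\<close>.  Let \<open>U(\<tau>)\<close> be the autocorrelation at \<open>e\<^sup>\<tau>\<close> and
  \<open>F' = U\<close>.  By the mean value theorem \<open>F(a + \<rho>) - F(a) = \<rho> U(\<xi>)\<close> with \<open>\<xi>\<close> between \<open>a\<close> and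
  \<open>a + \<rho>\<close>; \<open>U\<close> tends to \<open>0\<close> at \<open>+\<infinity>\<close> and to \<open>\<parallel>f\<parallel>\<^sup>2\<close> at \<open>-\<infinity>\<close>.
\<close>

lemma frullani_pointwise:
  fixes f :: "real \<Rightarrow> real"
  assumes f: "f \<in> L2R"
  obtains F where
    "\<And>N \<rho>. (\<integral>\<tau>. autocorr f (exp (\<tau> + \<rho>)) * indicator {- real N..real N} \<tau> \<partial>lborel) = F (real N + \<rho>) - F (- real N + \<rho>)"
    "\<And>a \<rho>. \<bar>F (a + \<rho>) - F a\<bar> \<le> (\<integral>x. (f x)\<^sup>2 \<partial>lborel) * \<bar>\<rho>\<bar>"
    "\<And>\<rho>. (\<lambda>N. F (real N + \<rho>) - F (real N)) \<longlonglongrightarrow> 0"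
    "\<And>\<rho>. (\<lambda>N. F (- real N + \<rho>) - F (- real N)) \<longlonglongrightarrow> (\<integral>x. (f x)\<^sup>2 \<partial>lborel) * \<rho>"
    "F \<in> borel_measurable borel"
proof -
  let ?n = "\<integral>x. (f x)\<^sup>2 \<partial>lborel"
  define U where "U \<tau> = autocorr f (exp \<tau>)" for \<tau>
  have Uc: "isCont U \<tau>" for \<tau>
    unfolding U_def by (rule isCont_o2[OF _ autocorr_isCont[OF f]]) (intro continuous_intros)
  obtain F where F: "\<And>x. (F has_real_derivative U x) (at x)"
    using einterval_antiderivative[of "-\<infinity>" "\<infinity>" U] Uc
    by (auto simp: has_real_derivative_iff_has_vector_derivative)
  have mvt: "\<exists>\<xi>. \<bar>\<xi> - a\<bar> \<le> \<bar>\<rho>\<bar> \<and> F (a + \<rho>) - F a = \<rho> * U \<xi>" for a \<rho>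
  proof (cases \<rho> "0::real" rule: linorder_cases)
    case greater
    then obtain z where "z > a" "z < a + \<rho>" "F (a + \<rho>) - F a = (a + \<rho> - a) * U z"
      using MVT2[of a "a + \<rho>" F U] F by auto
    then show ?thesis by (intro exI[of _ z]) auto
  next
    case less
    then obtain z where "z > a + \<rho>" "z < a" "F a - F (a + \<rho>) = (a - (a + \<rho>)) * U z"
      using MVT2[of "a + \<rho>" a F U] F by auto
    then show ?thesis by (intro exI[of _ z]) auto
  qed auto
  have top: "(U \<longlongrightarrow> 0) at_top"
    unfolding U_def by (rule filterlim_compose[OF autocorr_tendsto_0[OF f] exp_at_top])
  have "(autocorr f \<longlongrightarrow> ?n) (at 0)"
    using autocorr_isCont[OF f, of 0] by (simp add: isCont_def autocorr_0)
  then have bot: "(U \<longlongrightarrow> ?n) at_bot"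
    unfolding U_def
    by (rule filterlim_compose) (auto simp: filterlim_at exp_at_bot)
  show thesis
  proof
    show "\<bar>F (a + \<rho>) - F a\<bar> \<le> ?n * \<bar>\<rho>\<bar>" for a \<rho>
    proof -
      obtain \<xi> where "F (a + \<rho>) - F a = \<rho> * U \<xi>" using mvt by blast
      moreover have "\<bar>U \<xi>\<bar> \<le> ?n" unfolding U_def by (rule autocorr_bound[OF f])
      ultimately show ?thesis by (simp add: abs_mult mult.commute mult_left_mono)
    qed
    show "(\<lambda>N. F (real N + \<rho>) - F (real N)) \<longlonglongrightarrow> 0" for \<rho>
    proof -
      obtain \<xi> where \<xi>: "\<And>N::nat. \<bar>\<xi> N - real N\<bar> \<le> \<bar>\<rho>\<bar>" "\<And>N. F (real N + \<rho>) - F (real N) = \<rho> * U (\<xi> N)"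
        using mvt[of "real _" \<rho>] by metis
      have "filterlim \<xi> at_top sequentially"
      proof (rule filterlim_at_top_mono)
        show "filterlim (\<lambda>N. - \<bar>\<rho>\<bar> + real N) at_top sequentially"
          by (rule filterlim_tendsto_add_at_top[OF tendsto_const filterlim_real_sequentially])
        have "- \<bar>\<rho>\<bar> + real N \<le> \<xi> N" for N using \<xi>(1)[of N] by linarith
        then show "\<forall>\<^sub>F N in sequentially. - \<bar>\<rho>\<bar> + real N \<le> \<xi> N" by simp
      qed
      from tendsto_mult[OF tendsto_const filterlim_compose[OF top this], of \<rho>]
      show ?thesis by (simp add: \<xi>(2))
    qed
    show "(\<lambda>N. F (- real N + \<rho>) - F (- real N)) \<longlonglongrightarrow> ?n * \<rho>" for \<rho>
    proof -
      obtain \<xi> where \<xi>: "\<And>N::nat. \<bar>\<xi> N - - real N\<bar> \<le> \<bar>\<rho>\<bar>" "\<And>N. F (- real N + \<rho>) - F (- real N) = \<rho> * U (\<xi> N)"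
        using mvt[of "- real _" \<rho>] by metis
      have "filterlim (\<lambda>N. - \<xi> N) at_top sequentially"
      proof (rule filterlim_at_top_mono)
        show "filterlim (\<lambda>N. - \<bar>\<rho>\<bar> + real N) at_top sequentially"
          by (rule filterlim_tendsto_add_at_top[OF tendsto_const filterlim_real_sequentially])
        have "- \<bar>\<rho>\<bar> + real N \<le> - \<xi> N" for N using \<xi>(1)[of N] by linarith
        then show "\<forall>\<^sub>F N in sequentially. - \<bar>\<rho>\<bar> + real N \<le> - \<xi> N" by simp
      qed
      then have "filterlim \<xi> at_bot sequentially" by (simp add: filterlim_uminus_at_top)
      from tendsto_mult[OF tendsto_const filterlim_compose[OF bot this], of \<rho>]
      show ?thesis unfolding \<xi>(2) by (simp add: mult.commute)
    qed
    show "(\<integral>\<tau>. autocorr f (exp (\<tau> + \<rho>)) * indicator {- real N..real N} \<tau> \<partial>lborel) = F (real N + \<rho>) - F (- real N + \<rho>)" for N \<rho>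
    proof (rule integral_FTC_Icc_real)
      fix x :: real
      have "((\<lambda>x. F (x + \<rho>)) has_real_derivative U (x + \<rho>)) (at x)"
        using F[of "x + \<rho>"] by (simp add: DERIV_shift)
      then show "((\<lambda>x. F (x + \<rho>)) has_real_derivative autocorr f (exp (x + \<rho>))) (at x)" by (simp add: U_def)
      show "isCont (\<lambda>\<tau>. autocorr f (exp (\<tau> + \<rho>))) x"
        by (rule isCont_o2[OF _ autocorr_isCont[OF f]]) (intro continuous_intros)
    qed simp
    show "F \<in> borel_measurable borel"
      by (intro borel_measurable_continuous_onI continuous_at_imp_continuous_on ballI DERIV_isCont[OF F])
  qed
qed

text \<open>
  By \<open>dconv_L2\<close> and Fubini, the integral over \<open>|\<tau>| \<le> N\<close> is the integral of
  \<open>g(x) g(y) (F(N + \<rho>) - F(-N + \<rho>))\<close> with \<open>\<rho> = ln |x - y|\<close> and \<open>F\<close> from \<open>frullani_pointwise\<close>.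
  Because \<open>g\<close> has mean zero, the constant \<open>F(N) - F(-N)\<close> can be subtracted without changing the value, and the
  remaining increments are bounded by a multiple of \<open>|\<rho>|\<close> and converge to \<open>-\<rho> \<parallel>f\<parallel>\<^sup>2\<close>.
\<close>

theorem square_function_identity:
  assumes g: "integrable lborel g" "(\<integral>x. g x \<partial>lborel) = 0"
    and gl: "integrable (lborel \<Otimes>\<^sub>M lborel) (\<lambda>z. g (fst z) * g (snd z) * ln \<bar>fst z - snd z\<bar>)"
    and f: "f \<in> L2R"
  shows "(\<integral>\<^sup>+\<tau>. ennreal (\<integral>t. (dconv g f (exp \<tau>) t)\<^sup>2 \<partial>lborel) \<partial>lborel) = ennreal (log_energy g * (\<integral>x. (f x)\<^sup>2 \<partial>lborel))"
proof -
  let ?n = "\<integral>x. (f x)\<^sup>2 \<partial>lborel"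
  let ?\<nu> = "lborel \<Otimes>\<^sub>M lborel :: (real \<times> real) measure"
  define \<Psi> where "\<Psi> \<tau> = (\<integral>t. (dconv g f (exp \<tau>) t)\<^sup>2 \<partial>lborel)" for \<tau>
  note [measurable] = f[THEN L2R_measurable]
  have gm [measurable]: "g \<in> borel_measurable borel" using borel_measurable_integrable[OF g(1)] by simp
  have acm [measurable]: "autocorr f \<in> borel_measurable borel"
    using autocorr_isCont[OF f] by (intro borel_measurable_continuous_onI continuous_at_imp_continuous_on) auto
  obtain F where F:
    "\<And>N \<rho>. (\<integral>\<tau>. autocorr f (exp (\<tau> + \<rho>)) * indicator {- real N..real N} \<tau> \<partial>lborel) = F (real N + \<rho>) - F (- real N + \<rho>)"
    "\<And>a \<rho>. \<bar>F (a + \<rho>) - F a\<bar> \<le> ?n * \<bar>\<rho>\<bar>"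
    "\<And>\<rho>. (\<lambda>N. F (real N + \<rho>) - F (real N)) \<longlonglongrightarrow> 0"
    "\<And>\<rho>. (\<lambda>N. F (- real N + \<rho>) - F (- real N)) \<longlonglongrightarrow> ?n * \<rho>"
    and Fm [measurable]: "F \<in> borel_measurable borel"
    by (rule frullani_pointwise[OF f]) (rule that)
  have \<Psi>: "\<Psi> \<tau> = (\<integral>z. g (fst z) * g (snd z) * autocorr f (exp \<tau> * (fst z - snd z)) \<partial>?\<nu>)" for \<tau>
    unfolding \<Psi>_def by (rule dconv_L2(2)[OF g(1) f])
  have \<Psi>0: "\<Psi> \<tau> \<ge> 0" for \<tau> unfolding \<Psi>_def by (intro integral_nonneg_AE) auto
  have \<Psi>m [measurable]: "\<Psi> \<in> borel_measurable borel" unfolding \<Psi> by measurable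
  interpret P: pair_sigma_finite "lborel :: real measure" "lborel \<Otimes>\<^sub>M lborel :: (real \<times> real) measure" ..
  interpret P': pair_sigma_finite "lborel \<Otimes>\<^sub>M lborel :: (real \<times> real) measure" "lborel :: real measure" ..
  define D where "D N z = F (real N + ln \<bar>fst z - snd z\<bar>) - F (real N) - (F (- real N + ln \<bar>fst z - snd z\<bar>) - F (- real N))"
    for N :: nat and z :: "real \<times> real"
  have Dm [measurable]: "D N \<in> borel_measurable ?\<nu>" for N unfolding D_def by measurable
  have gg: "integrable ?\<nu> (\<lambda>z. g (fst z) * g (snd z))" by (rule integrable_tensor(1)[OF g(1) g(1)])
  have Db: "\<bar>D N z\<bar> \<le> 2 * ?n * \<bar>ln \<bar>fst z - snd z\<bar>\<bar>" for N z
    unfolding D_def using F(2)[of "real N" "ln \<bar>fst z - snd z\<bar>"] F(2)[of "- real N" "ln \<bar>fst z - snd z\<bar>"] by linarith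
  have Dbb: "norm (g (fst z) * g (snd z) * D N z) \<le> norm (2 * ?n * (g (fst z) * g (snd z) * ln \<bar>fst z - snd z\<bar>))" for N z
    using mult_left_mono[OF Db[of N z], of "\<bar>g (fst z) * g (snd z)\<bar>"] by (simp add: abs_mult mult_ac)
  have Di: "integrable ?\<nu> (\<lambda>z. g (fst z) * g (snd z) * D N z)" for N
    by (rule Bochner_Integration.integrable_bound[OF integrable_mult_right[OF gl, of "2 * ?n"]]) (measurable, rule AE_I2[OF Dbb])
  have trunc: "(\<integral>\<tau>. \<Psi> \<tau> * indicator {- real N..real N} \<tau> \<partial>lborel) = (\<integral>z. g (fst z) * g (snd z) * D N z \<partial>?\<nu>)"
    and trunci: "integrable lborel (\<lambda>\<tau>. \<Psi> \<tau> * indicator {- real N..real N} \<tau>)" for N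
  proof -
    define K where "K w = g (fst (snd w)) * g (snd (snd w)) * (autocorr f (exp (fst w) * (fst (snd w) - snd (snd w))) * indicator {- real N..real N} (fst w))" for w :: "real \<times> real \<times> real"
    have Km [measurable]: "K \<in> borel_measurable (lborel \<Otimes>\<^sub>M ?\<nu>)" unfolding K_def by measurable
    have Ki: "integrable (lborel \<Otimes>\<^sub>M ?\<nu>) K"
    proof (rule Bochner_Integration.integrable_bound)
      show "integrable (lborel \<Otimes>\<^sub>M ?\<nu>) (\<lambda>w. indicator {- real N..real N} (fst w) * (?n * (g (fst (snd w)) * g (snd (snd w)))))"
      proof (rule P.Fubini_integrable)
        show "(\<lambda>w. indicator {- real N..real N} (fst w) * (?n * (g (fst (snd w)) * g (snd (snd w))))) \<in> borel_measurable (lborel \<Otimes>\<^sub>M ?\<nu>)" by measurable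
        have "integrable lborel (\<lambda>x. indicator {- real N..real N} x * (\<integral>y. \<bar>?n * (g (fst y) * g (snd y))\<bar> \<partial>?\<nu>))"
          by (intro integrable_mult_left integrable_real_indicator) auto
        then show "integrable lborel (\<lambda>x. \<integral>y. norm (indicator {- real N..real N} (fst (x, y)) * (?n * (g (fst (snd (x, y))) * g (snd (snd (x, y)))))) \<partial>?\<nu>)"
          by (simp add: abs_mult)
        show "AE x in lborel. integrable ?\<nu> (\<lambda>y. indicator {- real N..real N} (fst (x, y)) * (?n * (g (fst (snd (x, y))) * g (snd (snd (x, y))))))"
          using gg by (intro AE_I2 integrable_mult_right) simp
      qed
      have "norm (K w) \<le> norm (indicator {- real N..real N} (fst w) * (?n * (g (fst (snd w)) * g (snd (snd w)))))" for w
        using mult_left_mono[OF autocorr_bound[OF f, of "exp (fst w) * (fst (snd w) - snd (snd w))"], of "\<bar>g (fst (snd w)) * g (snd (snd w))\<bar>"]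
        by (auto simp: K_def abs_mult indicator_def mult_ac)
      then show "AE w in lborel \<Otimes>\<^sub>M ?\<nu>. norm (K w) \<le> norm (indicator {- real N..real N} (fst w) * (?n * (g (fst (snd w)) * g (snd (snd w)))))"
        by (intro AE_I2)
    qed measurable
    have K1: "(\<integral>z. K (\<tau>, z) \<partial>?\<nu>) = \<Psi> \<tau> * indicator {- real N..real N} \<tau>" for \<tau>
      unfolding K_def \<Psi> by (simp flip: mult.assoc)
    show "integrable lborel (\<lambda>\<tau>. \<Psi> \<tau> * indicator {- real N..real N} \<tau>)"
      using P.integrable_fst'[OF Ki] unfolding K1 .
    have "(\<integral>\<tau>. \<Psi> \<tau> * indicator {- real N..real N} \<tau> \<partial>lborel) = (\<integral>w. K w \<partial>(lborel \<Otimes>\<^sub>M ?\<nu>))"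
      using P.integral_fst'[OF Ki] unfolding K1 .
    also have "\<dots> = (\<integral>w. (case w of (z, \<tau>) \<Rightarrow> K (\<tau>, z)) \<partial>(?\<nu> \<Otimes>\<^sub>M lborel))"
      using P.integral_product_swap[OF Km] by simp
    also have "\<dots> = (\<integral>z. (\<integral>\<tau>. K (\<tau>, z) \<partial>lborel) \<partial>?\<nu>)"
      using P'.integral_fst'[OF P.integrable_product_swap[OF Ki]] by simp
    also have "\<dots> = (\<integral>z. g (fst z) * g (snd z) * (D N z + (F (real N) - F (- real N))) \<partial>?\<nu>)"
    proof (rule integral_cong_AE)
      show "(\<lambda>z. \<integral>\<tau>. K (\<tau>, z) \<partial>lborel) \<in> borel_measurable ?\<nu>" by measurable
      show "(\<lambda>z. g (fst z) * g (snd z) * (D N z + (F (real N) - F (- real N)))) \<in> borel_measurable ?\<nu>" by measurable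
      show "AE z in ?\<nu>. (\<integral>\<tau>. K (\<tau>, z) \<partial>lborel) = g (fst z) * g (snd z) * (D N z + (F (real N) - F (- real N)))"
        using AE_off_diagonal
      proof eventually_elim
        case (elim z)
        define \<rho> where "\<rho> = ln \<bar>fst z - snd z\<bar>"
        have "autocorr f (exp \<tau> * (fst z - snd z)) = autocorr f (exp (\<tau> + \<rho>))" for \<tau>
        proof -
          have "exp (\<tau> + \<rho>) = \<bar>exp \<tau> * (fst z - snd z)\<bar>"
            using elim by (simp add: \<rho>_def exp_add abs_mult)
          then show ?thesis by (simp only: autocorr_abs)
        qed
        then have "(\<integral>\<tau>. K (\<tau>, z) \<partial>lborel) = g (fst z) * g (snd z) * (F (real N + \<rho>) - F (- real N + \<rho>))"
          unfolding K_def by (simp add: F(1))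
        then show ?case by (simp add: D_def \<rho>_def)
      qed
    qed
    also have "\<dots> = (\<integral>z. g (fst z) * g (snd z) * D N z + (F (real N) - F (- real N)) * (g (fst z) * g (snd z)) \<partial>?\<nu>)"
      by (simp add: algebra_simps)
    also have "\<dots> = (\<integral>z. g (fst z) * g (snd z) * D N z \<partial>?\<nu>) + (F (real N) - F (- real N)) * (\<integral>z. g (fst z) * g (snd z) \<partial>?\<nu>)"
      using Di[of N] gg by simp
    \<comment> \<open>the constant drops out because \<open>g\<close> has mean zero\<close>
    also have "\<dots> = (\<integral>z. g (fst z) * g (snd z) * D N z \<partial>?\<nu>)"
      using integrable_tensor(2)[OF g(1) g(1)] g(2) by simp
    finally show "(\<integral>\<tau>. \<Psi> \<tau> * indicator {- real N..real N} \<tau> \<partial>lborel) = (\<integral>z. g (fst z) * g (snd z) * D N z \<partial>?\<nu>)" .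
  qed
  have lim1: "(\<lambda>N. \<integral>z. g (fst z) * g (snd z) * D N z \<partial>?\<nu>) \<longlonglongrightarrow> (\<integral>z. g (fst z) * g (snd z) * (0 - ?n * ln \<bar>fst z - snd z\<bar>) \<partial>?\<nu>)"
  proof (rule integral_dominated_convergence[where w = "\<lambda>z. norm (2 * ?n * (g (fst z) * g (snd z) * ln \<bar>fst z - snd z\<bar>))"])
    show "integrable ?\<nu> (\<lambda>z. norm (2 * ?n * (g (fst z) * g (snd z) * ln \<bar>fst z - snd z\<bar>)))"
      by (intro integrable_norm integrable_mult_right gl)
    show "AE z in ?\<nu>. (\<lambda>N. g (fst z) * g (snd z) * D N z) \<longlonglongrightarrow> g (fst z) * g (snd z) * (0 - ?n * ln \<bar>fst z - snd z\<bar>)"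
      unfolding D_def by (intro AE_I2 tendsto_mult[OF tendsto_const] tendsto_diff[OF F(3) F(4)])
    show "AE z in ?\<nu>. norm (g (fst z) * g (snd z) * D N z) \<le> norm (2 * ?n * (g (fst z) * g (snd z) * ln \<bar>fst z - snd z\<bar>))" for N
      by (intro AE_I2 Dbb)
  qed measurable
  have "(\<integral>z. g (fst z) * g (snd z) * (0 - ?n * ln \<bar>fst z - snd z\<bar>) \<partial>?\<nu>) = (\<integral>z. (- ?n) * (g (fst z) * g (snd z) * ln \<bar>fst z - snd z\<bar>) \<partial>?\<nu>)"
    by (simp add: mult_ac)
  also have "\<dots> = log_energy g * ?n" by (simp add: log_energy_def)
  finally have lim2: "(\<lambda>N. \<integral>\<tau>. \<Psi> \<tau> * indicator {- real N..real N} \<tau> \<partial>lborel) \<longlonglongrightarrow> log_energy g * ?n"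
    using lim1 unfolding trunc by simp
  have "(\<lambda>N. ennreal (\<integral>\<tau>. \<Psi> \<tau> * indicator {- real N..real N} \<tau> \<partial>lborel)) \<longlonglongrightarrow> ennreal (log_energy g * ?n)"
    by (rule tendsto_ennrealI[OF lim2])
  moreover have "ennreal (\<integral>\<tau>. \<Psi> \<tau> * indicator {- real N..real N} \<tau> \<partial>lborel) = (\<integral>\<^sup>+\<tau>. ennreal (\<Psi> \<tau> * indicator {- real N..real N} \<tau>) \<partial>lborel)" for N
    using \<Psi>0 by (intro nn_integral_eq_integral[symmetric] trunci) auto
  ultimately have "(\<lambda>N. \<integral>\<^sup>+\<tau>. ennreal (\<Psi> \<tau> * indicator {- real N..real N} \<tau>) \<partial>lborel) \<longlonglongrightarrow> ennreal (log_energy g * ?n)" by simp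
  moreover have "(\<lambda>N. \<integral>\<^sup>+\<tau>. ennreal (\<Psi> \<tau> * indicator {- real N..real N} \<tau>) \<partial>lborel) \<longlonglongrightarrow> (\<integral>\<^sup>+\<tau>. ennreal (\<Psi> \<tau>) \<partial>lborel)"
  proof (rule nn_integral_LIMSEQ)
    show "incseq (\<lambda>N \<tau>. ennreal (\<Psi> \<tau> * indicator {- real N..real N} \<tau>))"
      by (intro incseq_SucI le_funI) (auto simp: indicator_def)
    fix \<tau> :: real
    obtain M :: nat where M: "\<bar>\<tau>\<bar> \<le> M" using real_arch_simple by auto
    have "\<forall>\<^sub>F n in sequentially. ennreal (\<Psi> \<tau> * indicator {- real n..real n} \<tau>) = ennreal (\<Psi> \<tau>)" (is "eventually ?P _")
    proof (rule eventually_sequentiallyI)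
      fix n assume "M \<le> n"
      then have "real M \<le> real n" by simp
      with M have "\<tau> \<in> {- real n..real n}" by auto
      then show "?P n" by simp
    qed
    then show "(\<lambda>n. ennreal (\<Psi> \<tau> * indicator {- real n..real n} \<tau>)) \<longlonglongrightarrow> ennreal (\<Psi> \<tau>)"
      by (rule tendsto_eventually)
  qed measurable
  ultimately show ?thesis
    unfolding \<Psi>_def[symmetric] using LIMSEQ_unique by blast
qed

section \<open>The Riemann--Liouville kernel\<close>

text \<open>
  The kernel of fractional integration of order \<open>\<sigma>\<close>; \<open>rl \<sigma>\<close> below is the convolution with it on the whole
  line.
\<close>

definition rlk :: "real \<Rightarrow> real \<Rightarrow> real" where
  "rlk \<sigma> x = (if x > 0 then x powr (\<sigma> - 1) / Gamma \<sigma> else 0)"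

definition rl :: "real \<Rightarrow> (real \<Rightarrow> real) \<Rightarrow> real \<Rightarrow> real" where
  "rl \<sigma> f t = (\<integral>s. rlk \<sigma> (t - s) * f s \<partial>lborel)"

lemma rlk_measurable [measurable]: "rlk \<sigma> \<in> borel_measurable borel"
  unfolding rlk_def by measurable

lemma rl_measurable [measurable]:
  assumes [measurable]: "f \<in> borel_measurable borel"
  shows "rl \<sigma> f \<in> borel_measurable borel"
  unfolding rl_def by measurable

lemma rlk_nonneg: "\<sigma> > 0 \<Longrightarrow> 0 \<le> rlk \<sigma> x"
  by (auto simp: rlk_def intro!: divide_nonneg_pos Gamma_real_pos)

lemma rlk_scale: "h > 0 \<Longrightarrow> rlk \<sigma> (h * x) = h powr (\<sigma> - 1) * rlk \<sigma> x"
  by (auto simp: rlk_def powr_mult zero_less_mult_iff)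

text \<open>
  Explicit power integrals are available as gauge integrals; for nonnegative integrands they carry over to the
  Lebesgue integral.
\<close>

lemma lborel_of_has_integral:
  fixes f :: "real \<Rightarrow> real"
  assumes m: "(\<lambda>x. f x * indicator S x) \<in> borel_measurable borel" and pos: "\<And>x. x \<in> S \<Longrightarrow> 0 \<le> f x"
    and I: "(f has_integral I) S"
  shows "integrable lborel (\<lambda>x. f x * indicator S x)" "(\<integral>x. f x * indicator S x \<partial>lborel) = I"
    "(\<integral>\<^sup>+x. ennreal (f x * indicator S x) \<partial>lborel) = ennreal I"
proof -
  have "((\<lambda>x. if x \<in> S then f x else 0) has_integral I) UNIV" using I by (simp only: has_integral_restrict_UNIV)
  then have J: "((\<lambda>x. f x * indicator S x) has_integral I) UNIV"
    by (rule has_integral_eq[rotated]) (auto simp: indicator_def)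
  have I0: "0 \<le> I" by (rule has_integral_nonneg[OF I pos])
  show n: "(\<integral>\<^sup>+x. ennreal (f x * indicator S x) \<partial>lborel) = ennreal I"
    by (rule nn_integral_has_integral_lborel[OF m _ J]) (auto simp: indicator_def pos)
  have "has_bochner_integral lborel (\<lambda>x. f x * indicator S x) I"
    by (rule has_bochner_integral_nn_integral[OF _ _ I0 n]) (use m in \<open>auto simp: indicator_def pos\<close>)
  then show "integrable lborel (\<lambda>x. f x * indicator S x)" "(\<integral>x. f x * indicator S x \<partial>lborel) = I"
    by (auto simp: has_bochner_integral_iff)
qed

lemma rlk_integral_upto:
  assumes "\<sigma> > 0" "R \<ge> 0"
  shows "integrable lborel (\<lambda>x. rlk \<sigma> x * indicator {..R} x)"
    and "(\<integral>x. rlk \<sigma> x * indicator {..R} x \<partial>lborel) = R powr \<sigma> / (\<sigma> * Gamma \<sigma>)"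
proof -
  have "((\<lambda>x. x powr (\<sigma> - 1)) has_integral (R powr (\<sigma> - 1 + 1) / (\<sigma> - 1 + 1))) {0..R}"
    by (rule has_integral_powr_from_0) (use assms in auto)
  then have I: "((\<lambda>x. x powr (\<sigma> - 1)) has_integral (R powr \<sigma> / \<sigma>)) {0..R}" by simp
  have e: "rlk \<sigma> x * indicator {..R} x = (x powr (\<sigma> - 1) * indicator {0..R} x) / Gamma \<sigma>" for x
    by (auto simp: rlk_def indicator_def)
  have i: "integrable lborel (\<lambda>x. x powr (\<sigma> - 1) * indicator {0..R} x)"
    "(\<integral>x. x powr (\<sigma> - 1) * indicator {0..R} x \<partial>lborel) = R powr \<sigma> / \<sigma>"
    by (rule lborel_of_has_integral[OF _ _ I]; auto)+
  show "integrable lborel (\<lambda>x. rlk \<sigma> x * indicator {..R} x)" unfolding e using i(1) by simp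
  show "(\<integral>x. rlk \<sigma> x * indicator {..R} x \<partial>lborel) = R powr \<sigma> / (\<sigma> * Gamma \<sigma>)"
    unfolding e using i(2) by simp
qed

text \<open>
  After scaling \<open>x = y u\<close> this is Euler's Beta integral.
\<close>

lemma rlk_convolution:
  assumes a: "\<alpha> > 0" and b: "\<beta> > 0"
  shows "(\<integral>\<^sup>+x. ennreal (rlk \<alpha> x * rlk \<beta> (y - x)) \<partial>lborel) = ennreal (rlk (\<alpha> + \<beta>) y)"
proof (cases "y > 0")
  case False
  then have "rlk \<alpha> x * rlk \<beta> (y - x) = 0" for x by (auto simp: rlk_def)
  then have "(\<integral>\<^sup>+x. ennreal (rlk \<alpha> x * rlk \<beta> (y - x)) \<partial>lborel) = 0"
    by (simp only: ennreal_0 nn_integral_const mult_zero_left)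
  then show ?thesis using False by (simp add: rlk_def)
next
  case True
  let ?b = "\<lambda>x. x powr (\<alpha> - 1) * (1 - x) powr (\<beta> - 1) * indicator {0..1} x :: real"
  define C where "C = y powr (\<alpha> - 1) * y powr (\<beta> - 1) / (Gamma \<alpha> * Gamma \<beta>)"
  have C0: "C \<ge> 0" unfolding C_def using a b by (intro divide_nonneg_pos mult_pos_pos Gamma_real_pos) auto
  have Gp: "Gamma \<alpha> > 0" "Gamma \<beta> > 0" "Gamma (\<alpha> + \<beta>) > 0" using a b by (auto intro!: Gamma_real_pos)
  have "(\<integral>\<^sup>+x. ennreal (rlk \<alpha> x * rlk \<beta> (y - x)) \<partial>lborel)
      = ennreal \<bar>y\<bar> * (\<integral>\<^sup>+x. ennreal (rlk \<alpha> (0 + y * x) * rlk \<beta> (y - (0 + y * x))) \<partial>lborel)"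
    by (rule nn_integral_real_affine) (use True in auto)
  also have "(\<integral>\<^sup>+x. ennreal (rlk \<alpha> (0 + y * x) * rlk \<beta> (y - (0 + y * x))) \<partial>lborel)
     = (\<integral>\<^sup>+x. ennreal C * ennreal (?b x) \<partial>lborel)"
  proof (rule nn_integral_cong_AE)
    have "AE x in lborel. x \<noteq> 0 \<and> x \<noteq> (1::real)"
      using AE_lborel_singleton[of 0] AE_lborel_singleton[of "1::real"] by eventually_elim auto
    then show "AE x in lborel. ennreal (rlk \<alpha> (0 + y * x) * rlk \<beta> (y - (0 + y * x))) = ennreal C * ennreal (?b x)"
    proof eventually_elim
      case (elim x)
      have "y - y * x = y * (1 - x)" by (simp add: algebra_simps)
      then have "rlk \<alpha> (0 + y * x) * rlk \<beta> (y - (0 + y * x)) = y powr (\<alpha> - 1) * rlk \<alpha> x * (y powr (\<beta> - 1) * rlk \<beta> (1 - x))"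
        using rlk_scale[OF True] by simp
      also have "\<dots> = C * ?b x"
        using elim by (auto simp: rlk_def C_def indicator_def)
      finally show ?case using C0 by (simp add: ennreal_mult')
    qed
  qed
  also have "\<dots> = ennreal C * ennreal (Beta \<alpha> \<beta>)"
    using lborel_of_has_integral(3)[OF _ _ has_integral_Beta_real[OF a b]] by (simp add: nn_integral_cmult)
  also have "ennreal \<bar>y\<bar> * (ennreal C * ennreal (Beta \<alpha> \<beta>)) = ennreal (y * (C * Beta \<alpha> \<beta>))"
  proof -
    have "Beta \<alpha> \<beta> \<ge> 0" using Gp by (simp add: Beta_def)
    then show ?thesis using True C0 by (simp add: ennreal_mult)
  qed
  also have "y * (C * Beta \<alpha> \<beta>) = rlk (\<alpha> + \<beta>) y"
  proof -
    have "y * (y powr (\<alpha> - 1) * y powr (\<beta> - 1)) = y powr (\<alpha> + \<beta> - 1)"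
      using True by (simp add: powr_mult_base powr_add[symmetric] mult.assoc[symmetric])
    then show ?thesis using True Gp by (simp add: C_def Beta_def rlk_def field_simps)
  qed
  finally show ?thesis .
qed

text \<open>
  Fubini's theorem at one fixed point \<open>t\<close>.  Integrability at \<open>t\<close> of the integrand of order \<open>\<alpha> + \<beta>\<close> suffices, so the law holds
  at every such point and not only almost everywhere.
\<close>

lemma rl_semigroup_at:
  assumes a: "\<alpha> > 0" and b: "\<beta> > 0" and [measurable]: "f \<in> borel_measurable borel"
    and i: "integrable lborel (\<lambda>r. rlk (\<alpha> + \<beta>) (t - r) * f r)"
  shows "rl \<alpha> (rl \<beta> f) t = rl (\<alpha> + \<beta>) f t"
    and "integrable lborel (\<lambda>s. rlk \<alpha> (t - s) * rl \<beta> f s)"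
proof -
  have cv: "(\<integral>\<^sup>+s. ennreal (rlk \<alpha> (t - s) * rlk \<beta> (s - r)) \<partial>lborel) = ennreal (rlk (\<alpha> + \<beta>) (t - r))" for r
  proof -
    have "(\<integral>\<^sup>+s. ennreal (rlk \<beta> s * rlk \<alpha> (t - r - s)) \<partial>lborel) = ennreal (rlk (\<beta> + \<alpha>) (t - r))"
      by (rule rlk_convolution[OF b a])
    then show ?thesis
      using nn_integral_shift[of "\<lambda>s. ennreal (rlk \<alpha> (t - s) * rlk \<beta> (s - r))" r]
      by (simp add: algebra_simps)
  qed
  have hb: "has_bochner_integral lborel (\<lambda>s. rlk \<alpha> (t - s) * rlk \<beta> (s - r)) (rlk (\<alpha> + \<beta>) (t - r))" for r
    by (rule has_bochner_integral_nn_integral[OF _ _ _ cv]) (use a b in \<open>auto intro!: mult_nonneg_nonneg rlk_nonneg\<close>)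
  define K where "K z = rlk \<alpha> (t - snd z) * rlk \<beta> (snd z - fst z) * f (fst z)" for z :: "real \<times> real"
  have [measurable]: "K \<in> borel_measurable (lborel \<Otimes>\<^sub>M lborel)" unfolding K_def by measurable
  have Ki: "integrable (lborel \<Otimes>\<^sub>M lborel) K"
  proof (rule lborel_pair.Fubini_integrable)
    have "(\<integral>y. norm (K (x, y)) \<partial>lborel) = norm (rlk (\<alpha> + \<beta>) (t - x) * f x)" for x
      using hb[of x] a b by (simp add: K_def abs_mult rlk_nonneg has_bochner_integral_iff)
    then show "integrable lborel (\<lambda>x. \<integral>y. norm (K (x, y)) \<partial>lborel)" using i by simp
    show "AE x in lborel. integrable lborel (\<lambda>y. K (x, y))"
      using hb by (auto simp: K_def has_bochner_integral_iff)
  qed measurable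
  have sw: "integrable (lborel \<Otimes>\<^sub>M lborel) (\<lambda>(s, r). K (r, s))" by (rule lborel_pair.integrable_product_swap[OF Ki])
  have e: "(\<integral>r. K (r, s) \<partial>lborel) = rlk \<alpha> (t - s) * rl \<beta> f s" for s
    by (simp add: K_def rl_def mult.assoc)
  show "integrable lborel (\<lambda>s. rlk \<alpha> (t - s) * rl \<beta> f s)"
    using lborel_pair.integrable_fst'[OF sw] by (simp add: e)
  have "rl \<alpha> (rl \<beta> f) t = (\<integral>z. (case z of (s, r) \<Rightarrow> K (r, s)) \<partial>(lborel \<Otimes>\<^sub>M lborel))"
    using lborel_pair.integral_fst'[OF sw] by (simp add: e rl_def[of \<alpha>])
  also have "\<dots> = (\<integral>z. K z \<partial>(lborel \<Otimes>\<^sub>M lborel))" by (rule lborel_pair.integral_product_swap) measurable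
  also have "\<dots> = (\<integral>r. rlk (\<alpha> + \<beta>) (t - r) * f r \<partial>lborel)"
  proof -
    have "(\<integral>s. K (r, s) \<partial>lborel) = rlk (\<alpha> + \<beta>) (t - r) * f r" for r
      using hb[of r] by (simp add: K_def has_bochner_integral_iff)
    then show ?thesis using lborel_pair.integral_fst'[OF Ki] by simp
  qed
  finally show "rl \<alpha> (rl \<beta> f) t = rl (\<alpha> + \<beta>) f t" by (simp add: rl_def)
qed

section \<open>The difference of the kernel over a unit step\<close>

text \<open>
  Since \<open>rlk \<sigma>\<close> is homogeneous, its difference over a step \<open>h\<close> is a multiple of the dilate of this one by \<open>h\<close>.
\<close>

definition rld :: "real \<Rightarrow> real \<Rightarrow> real" where
  "rld \<sigma> x = rlk \<sigma> (x + 1) - rlk \<sigma> x"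

lemma rld_measurable [measurable]: "rld \<sigma> \<in> borel_measurable borel"
  unfolding rld_def by measurable

text \<open>
  By the mean value theorem differencing improves the decay from \<open>x\<^sup>\<sigma>\<^sup>-\<^sup>1\<close>, which is not integrable at
  infinity, to \<open>x\<^sup>\<sigma>\<^sup>-\<^sup>2\<close>, which is.
\<close>

lemma rld_tail:
  assumes s: "0 < \<sigma>" "\<sigma> < 1" and x: "x > 0"
  shows "rld \<sigma> x \<le> 0" "\<bar>rld \<sigma> x\<bar> \<le> (1 - \<sigma>) * x powr (\<sigma> - 2) / Gamma \<sigma>"
proof -
  have G: "Gamma \<sigma> > 0" using s by simp
  have "((\<lambda>x. x powr (\<sigma> - 1)) has_real_derivative (\<sigma> - 1) * z powr (\<sigma> - 1 - 1)) (at z)" if "z > 0" for z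
    using has_real_derivative_powr[OF that] .
  then obtain z where z: "z > x" "z < x + 1" "(x + 1) powr (\<sigma> - 1) - x powr (\<sigma> - 1) = (x + 1 - x) * ((\<sigma> - 1) * z powr (\<sigma> - 1 - 1))"
    using MVT2[of x "x + 1" "\<lambda>x. x powr (\<sigma> - 1)" "\<lambda>z. (\<sigma> - 1) * z powr (\<sigma> - 1 - 1)"] x by fastforce
  have e: "rld \<sigma> x = - ((1 - \<sigma>) * z powr (\<sigma> - 2) / Gamma \<sigma>)"
  proof -
    have "rld \<sigma> x = ((x + 1) powr (\<sigma> - 1) - x powr (\<sigma> - 1)) / Gamma \<sigma>"
      using x by (simp add: rld_def rlk_def diff_divide_distrib)
    also have "(x + 1) powr (\<sigma> - 1) - x powr (\<sigma> - 1) = - ((1 - \<sigma>) * z powr (\<sigma> - 2))"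
      using z(3) by (simp add: algebra_simps)
    finally show ?thesis by simp
  qed
  have p: "0 \<le> (1 - \<sigma>) * z powr (\<sigma> - 2) / Gamma \<sigma>" using s G by simp
  show "rld \<sigma> x \<le> 0" using p e by simp
  have "z powr (\<sigma> - 2) \<le> x powr (\<sigma> - 2)" using z(1) x s by (intro powr_mono2') auto
  then have "(1 - \<sigma>) * z powr (\<sigma> - 2) / Gamma \<sigma> \<le> (1 - \<sigma>) * x powr (\<sigma> - 2) / Gamma \<sigma>"
    using s G by (intro divide_right_mono mult_left_mono) auto
  then show "\<bar>rld \<sigma> x\<bar> \<le> (1 - \<sigma>) * x powr (\<sigma> - 2) / Gamma \<sigma>" using p e by simp
qed

lemma rld_bound: "\<sigma> > 0 \<Longrightarrow> \<bar>rld \<sigma> x\<bar> \<le> rlk \<sigma> (x + 1) + rlk \<sigma> x"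
  unfolding rld_def using rlk_nonneg[of \<sigma> x] rlk_nonneg[of \<sigma> "x + 1"] by linarith

lemma powr_integrable_tail:
  assumes "e < -1"
  shows "integrable lborel (\<lambda>x::real. x powr e * indicator {1..} x)"
proof -
  have "((\<lambda>x. x powr e) has_integral -(1 powr (e + 1)) / (e + 1)) {1..}"
    by (rule has_integral_powr_to_inf) (use assms in auto)
  from lborel_of_has_integral(1)[OF _ _ this] show ?thesis by simp
qed

text \<open>
  The decay \<open>x\<^sup>\<sigma>\<^sup>-\<^sup>2\<close> leaves room for a weight of order \<open>\<delta> < 1 - \<sigma>\<close>.  Weight zero gives
  integrability of the kernel; a positive weight dominates logarithms of large distances.
\<close>

lemma rld_weighted_integrable:
  assumes s: "0 < \<sigma>" "\<sigma> < 1" and d: "0 \<le> \<delta>" "\<delta> < 1 - \<sigma>"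
  shows "integrable lborel (\<lambda>x. rld \<sigma> x * (1 + \<bar>x\<bar>) powr \<delta>)"
proof -
  define M where "M = (1 - \<sigma>) * 2 powr \<delta> / Gamma \<sigma>"
  have G: "Gamma \<sigma> > 0" using s by simp
  have M0: "M \<ge> 0" unfolding M_def using s G by simp
  define w where "w x = 2 powr \<delta> * (rlk \<sigma> (x + 1) * indicator {..2} (x + 1) + rlk \<sigma> x * indicator {..1} x)
      + M * (x powr (\<sigma> - 2 + \<delta>) * indicator {1..} x)" for x
  have wi: "integrable lborel w"
    unfolding w_def using s d rlk_integral_upto(1)[of \<sigma> 2] rlk_integral_upto(1)[of \<sigma> 1]
      lborel_integrable_real_affine[OF rlk_integral_upto(1)[of \<sigma> 2], of 1 1]
    by (intro Bochner_Integration.integrable_add integrable_mult_right powr_integrable_tail) (auto simp: add.commute)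
  have "norm (rld \<sigma> x * (1 + \<bar>x\<bar>) powr \<delta>) \<le> norm (w x)" for x
  proof -
    have p2: "0 \<le> M * (x powr (\<sigma> - 2 + \<delta>) * indicator {1..} x)" using M0 by simp
    have p1: "0 \<le> 2 powr \<delta> * (rlk \<sigma> (x + 1) * indicator {..2} (x + 1) + rlk \<sigma> x * indicator {..1} x)"
      using s by (intro mult_nonneg_nonneg add_nonneg_nonneg rlk_nonneg) auto
    consider "x \<le> -1" | "-1 < x" "x \<le> 1" | "x > 1" by linarith
    then have "\<bar>rld \<sigma> x\<bar> * (1 + \<bar>x\<bar>) powr \<delta> \<le> w x"
    proof cases
      case 1
      then show ?thesis using p1 p2 by (simp add: rld_def rlk_def w_def)
    next
      case 2
      have "\<bar>rld \<sigma> x\<bar> * (1 + \<bar>x\<bar>) powr \<delta> \<le> (rlk \<sigma> (x + 1) + rlk \<sigma> x) * 2 powr \<delta>"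
        using s d 2 by (intro mult_mono rld_bound powr_mono2) (auto intro!: add_nonneg_nonneg rlk_nonneg)
      also have "\<dots> = 2 powr \<delta> * (rlk \<sigma> (x + 1) * indicator {..2} (x + 1) + rlk \<sigma> x * indicator {..1} x)"
        using 2 by simp
      finally show ?thesis unfolding w_def using p2 by linarith
    next
      case 3
      have "\<bar>rld \<sigma> x\<bar> * (1 + \<bar>x\<bar>) powr \<delta> \<le> ((1 - \<sigma>) * x powr (\<sigma> - 2) / Gamma \<sigma>) * (2 * x) powr \<delta>"
        using s d 3 G by (intro mult_mono rld_tail powr_mono2) auto
      also have "\<dots> = M * (x powr (\<sigma> - 2 + \<delta>) * indicator {1..} x)"
        using 3 by (simp add: M_def powr_mult powr_add)
      finally show ?thesis unfolding w_def using p1 by linarith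
    qed
    then show ?thesis by (simp add: abs_mult)
  qed
  then show ?thesis by (intro Bochner_Integration.integrable_bound[OF wi]) auto
qed

lemma rld_integrable:
  assumes "0 < \<sigma>" "\<sigma> < 1"
  shows "integrable lborel (rld \<sigma>)"
proof -
  have "1 + \<bar>x\<bar> \<noteq> 0" for x :: real by linarith
  then show ?thesis using rld_weighted_integrable[OF assms, of 0] assms by simp
qed

text \<open>
  The integral up to \<open>n\<close> telescopes to a multiple of \<open>(n + 1)\<^sup>\<sigma> - n\<^sup>\<sigma>\<close>, which tends to \<open>0\<close> as \<open>\<sigma> < 1\<close>.
\<close>

lemma rld_integral:
  assumes s: "0 < \<sigma>" "\<sigma> < 1"
  shows "(\<integral>x. rld \<sigma> x \<partial>lborel) = 0"
proof (rule LIMSEQ_unique)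
  show "(\<lambda>n. \<integral>x. rld \<sigma> x * indicator {..real n} x \<partial>lborel) \<longlonglongrightarrow> (\<integral>x. rld \<sigma> x \<partial>lborel)"
  proof (rule integral_dominated_convergence[where w = "\<lambda>x. norm (rld \<sigma> x)"])
    show "AE x in lborel. (\<lambda>n. rld \<sigma> x * indicator {..real n} x) \<longlonglongrightarrow> rld \<sigma> x"
    proof (intro AE_I2)
      fix x :: real
      obtain M :: nat where M: "x \<le> M" using real_arch_simple by auto
      show "(\<lambda>n. rld \<sigma> x * indicator {..real n} x) \<longlonglongrightarrow> rld \<sigma> x"
      proof (rule tendsto_eventually, rule eventually_sequentiallyI)
        fix n assume "M \<le> n"
        then have "real M \<le> real n" by simp
        with M show "rld \<sigma> x * indicator {..real n} x = rld \<sigma> x" by simp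
      qed
    qed
    show "AE x in lborel. norm (rld \<sigma> x * indicator {..real n} x) \<le> norm (rld \<sigma> x)" for n
      by (intro AE_I2) (simp add: indicator_def)
  qed (use rld_integrable[OF s] in auto)
  have e: "(\<integral>x. rld \<sigma> x * indicator {..real n} x \<partial>lborel) = ((real n + 1) powr \<sigma> - (real n) powr \<sigma>) / (\<sigma> * Gamma \<sigma>)" for n
  proof -
    have i1: "integrable lborel (\<lambda>x. rlk \<sigma> x * indicator {..real n} x)" using rlk_integral_upto(1)[of \<sigma> n] s by simp
    have i2: "integrable lborel (\<lambda>x. rlk \<sigma> x * indicator {..real n + 1} x)" using rlk_integral_upto(1)[of \<sigma> "real n + 1"] s by simp
    have i3: "integrable lborel (\<lambda>x. rlk \<sigma> (x + 1) * indicator {..real n + 1} (x + 1))"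
      using lborel_integrable_real_affine[OF i2, of 1 1] by (simp add: add.commute)
    have "(\<integral>x. rld \<sigma> x * indicator {..real n} x \<partial>lborel)
       = (\<integral>x. rlk \<sigma> (x + 1) * indicator {..real n + 1} (x + 1) - rlk \<sigma> x * indicator {..real n} x \<partial>lborel)"
      by (intro Bochner_Integration.integral_cong) (auto simp: rld_def indicator_def)
    also have "\<dots> = (real n + 1) powr \<sigma> / (\<sigma> * Gamma \<sigma>) - (real n) powr \<sigma> / (\<sigma> * Gamma \<sigma>)"
      using i1 i3 rlk_integral_upto(2)[of \<sigma> n] rlk_integral_upto(2)[of \<sigma> "real n + 1"] s
        integral_shift[of "\<lambda>x. rlk \<sigma> x * indicator {..real n + 1} x" 1] by simp
    finally show ?thesis by (simp add: diff_divide_distrib)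
  qed
  have "(\<lambda>n. (real n + 1) powr \<sigma> - (real n) powr \<sigma>) \<longlonglongrightarrow> 0"
  proof (rule tendsto_sandwich[OF _ _ tendsto_const])
    show "(\<lambda>n. \<sigma> * real n powr (\<sigma> - 1)) \<longlonglongrightarrow> 0"
    proof -
      have "(\<lambda>n. real n powr (\<sigma> - 1)) \<longlonglongrightarrow> 0"
        using s by (intro tendsto_neg_powr filterlim_real_sequentially) auto
      from tendsto_mult[OF tendsto_const this, of \<sigma>] show ?thesis by simp
    qed
    show "\<forall>\<^sub>F n in sequentially. 0 \<le> (real n + 1) powr \<sigma> - (real n) powr \<sigma>"
      using s by (intro always_eventually allI) (auto intro!: powr_mono2)
    show "\<forall>\<^sub>F n in sequentially. (real n + 1) powr \<sigma> - (real n) powr \<sigma> \<le> \<sigma> * real n powr (\<sigma> - 1)"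
    proof (rule eventually_sequentiallyI[of 1])
      fix n :: nat assume n: "1 \<le> n"
      obtain z where z: "z > real n" "z < real n + 1" "(real n + 1) powr \<sigma> - real n powr \<sigma> = (real n + 1 - real n) * (\<sigma> * z powr (\<sigma> - 1))"
        using MVT2[of "real n" "real n + 1" "\<lambda>x. x powr \<sigma>" "\<lambda>z. \<sigma> * z powr (\<sigma> - 1)"] n has_real_derivative_powr[where r = \<sigma>] by fastforce
      have "z powr (\<sigma> - 1) \<le> real n powr (\<sigma> - 1)" using z(1) n s by (intro powr_mono2') auto
      then show "(real n + 1) powr \<sigma> - (real n) powr \<sigma> \<le> \<sigma> * real n powr (\<sigma> - 1)"
        using z(3) s by simp
    qed
  qed
  then show "(\<lambda>n. \<integral>x. rld \<sigma> x * indicator {..real n} x \<partial>lborel) \<longlonglongrightarrow> 0"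
    unfolding e by (rule tendsto_divide_zero)
qed


lemma dist_powr_integrable:
  assumes "0 < \<rho>" "\<rho> < 1"
  shows "integrable lborel (\<lambda>u::real. \<bar>u\<bar> powr (-\<rho>) * indicator {-1<..<1} u)"
proof -
  have "((\<lambda>x. x powr (-\<rho>)) has_integral (1 powr (-\<rho> + 1) / (-\<rho> + 1))) {0..1::real}"
    by (rule has_integral_powr_from_0) (use assms in auto)
  from lborel_of_has_integral(1)[OF _ _ this]
  have i: "integrable lborel (\<lambda>x::real. x powr (-\<rho>) * indicator {0..1} x)" by simp
  have i': "integrable lborel (\<lambda>x::real. (-x) powr (-\<rho>) * indicator {0..1} (-x))"
    using lborel_integrable_real_affine[OF i, of "-1" 0] by simp
  show ?thesis
    by (rule Bochner_Integration.integrable_bound[OF Bochner_Integration.integrable_add[OF i i']])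
       (auto simp: indicator_def abs_if)
qed

text \<open>
  A product \<open>x\<^sup>-\<^sup>p d\<^sup>-\<^sup>q\<close> is at most the power \<open>-(p + q)\<close> of the smaller of \<open>x\<close> and \<open>d\<close>.  Here
  \<open>p = 1 - \<sigma>\<close> and \<open>q = \<sigma>/2\<close>, so the total exponent \<open>1 - \<sigma>/2\<close> is still integrable at \<open>0\<close>.
\<close>

lemma rlk_dist_bound:
  assumes s: "0 < \<sigma>" "\<sigma> < 1"
  defines "Q \<equiv> \<lambda>u::real. \<bar>u\<bar> powr (-(1 - \<sigma>/2)) * indicator {-1<..<1} u"
  shows "rlk \<sigma> x * (\<bar>x - y\<bar> powr (-(\<sigma>/2)) * indicator {-1<..<1} (x - y)) \<le> (Q x + Q (x - y)) / Gamma \<sigma>"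
proof -
  have G: "Gamma \<sigma> > 0" using s by simp
  define d where "d = \<bar>x - y\<bar>"
  have Q0: "Q u \<ge> 0" for u by (simp add: Q_def)
  show ?thesis
  proof (cases "x > 0 \<and> 0 < d \<and> d < 1")
    case False
    then have "rlk \<sigma> x * (\<bar>x - y\<bar> powr (-(\<sigma>/2)) * indicator {-1<..<1} (x - y)) = 0"
      by (auto simp: rlk_def d_def indicator_def abs_less_iff)
    moreover have "0 \<le> (Q x + Q (x - y)) / Gamma \<sigma>" using Q0[of x] Q0[of "x - y"] G by simp
    ultimately show ?thesis by linarith
  next
    case True
    then have x: "x > 0" and d: "0 < d" "d < 1" by auto
    have Qd: "Q (x - y) = d powr (\<sigma> - 1) * d powr (-(\<sigma>/2))"
      using d by (auto simp: Q_def d_def indicator_def abs_less_iff powr_add[symmetric] algebra_simps)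
    have "x powr (\<sigma> - 1) * d powr (-(\<sigma>/2)) \<le> Q x + Q (x - y)"
    proof (cases "x \<le> d")
      case True
      have "Q x = x powr (\<sigma> - 1) * x powr (-(\<sigma>/2))"
        using d True x by (auto simp: Q_def powr_add[symmetric] algebra_simps)
      moreover have "d powr (-(\<sigma>/2)) \<le> x powr (-(\<sigma>/2))" using True x s by (intro powr_mono2') auto
      ultimately have "x powr (\<sigma> - 1) * d powr (-(\<sigma>/2)) \<le> Q x" by (simp add: mult_left_mono)
      then show ?thesis using Q0[of "x - y"] by linarith
    next
      case False
      then have "x powr (\<sigma> - 1) \<le> d powr (\<sigma> - 1)" using d s by (intro powr_mono2') auto
      then have "x powr (\<sigma> - 1) * d powr (-(\<sigma>/2)) \<le> Q (x - y)" unfolding Qd by (rule mult_right_mono) simp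
      then show ?thesis using Q0[of x] by linarith
    qed
    moreover have "indicator {-1<..<1} (x - y) = (1::real)"
      using d by (auto simp: d_def indicator_def abs_less_iff)
    ultimately show ?thesis using G x by (simp add: rlk_def d_def[symmetric] divide_right_mono)
  qed
qed

text \<open>
  The previous bound makes the integral over \<open>x\<close> bounded uniformly in \<open>y\<close>; the second factor is integrable.
\<close>

lemma rld_dist_integrable:
  assumes s: "0 < \<sigma>" "\<sigma> < 1"
  shows "integrable (lborel \<Otimes>\<^sub>M lborel)
    (\<lambda>z. rld \<sigma> (fst z) * rld \<sigma> (snd z) * (\<bar>fst z - snd z\<bar> powr (-(\<sigma>/2)) * indicator {-1<..<1} (fst z - snd z)))"
proof -
  have G: "Gamma \<sigma> > 0" using s by simp
  define Q where "Q = (\<lambda>u::real. \<bar>u\<bar> powr (-(1 - \<sigma>/2)) * indicator {-1<..<1} u)"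
  have Qi: "integrable lborel Q" unfolding Q_def by (rule dist_powr_integrable) (use s in auto)
  have Qm [measurable]: "Q \<in> borel_measurable borel" unfolding Q_def by measurable
  have Q0: "Q u \<ge> 0" for u by (simp add: Q_def)
  define B where "B = (\<lambda>u::real. \<bar>u\<bar> powr (-(\<sigma>/2)) * indicator {-1<..<1} u)"
  have [measurable]: "B \<in> borel_measurable borel" unfolding B_def by measurable
  have B0: "B u \<ge> 0" for u by (simp add: B_def)
  have key: "\<bar>rld \<sigma> x * B (x - y)\<bar> \<le> (Q x + Q (x + 1) + 2 * Q (x - y)) / Gamma \<sigma>" for x y
  proof -
    have "\<bar>rld \<sigma> x * B (x - y)\<bar> \<le> (rlk \<sigma> (x + 1) + rlk \<sigma> x) * B (x - y)"
      unfolding abs_mult using rld_bound[of \<sigma> x] s B0[of "x - y"] by (simp add: mult_right_mono)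
    also have "\<dots> = rlk \<sigma> (x + 1) * B ((x + 1) - (y + 1)) + rlk \<sigma> x * B (x - y)" by (simp add: algebra_simps)
    also have "\<dots> \<le> (Q (x + 1) + Q ((x + 1) - (y + 1))) / Gamma \<sigma> + (Q x + Q (x - y)) / Gamma \<sigma>"
      unfolding B_def Q_def by (intro add_mono rlk_dist_bound s)
    also have "\<dots> = (Q x + Q (x + 1) + 2 * Q (x - y)) / Gamma \<sigma>" by (simp add: add_divide_distrib algebra_simps)
    finally show ?thesis .
  qed
  have Qs: "integrable lborel (\<lambda>x. Q (x + r))" for r
    using lborel_integrable_real_affine[OF Qi, of 1 r] by (simp add: add.commute)
  have bi: "integrable lborel (\<lambda>x. (Q x + Q (x + 1) + 2 * Q (x - y)) / Gamma \<sigma>)" for y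
    using Qi Qs[of 1] Qs[of "-y"] by auto
  have bv: "(\<integral>x. (Q x + Q (x + 1) + 2 * Q (x - y)) / Gamma \<sigma> \<partial>lborel) = 4 * (\<integral>x. Q x \<partial>lborel) / Gamma \<sigma>" for y
    using Qi Qs[of 1] Qs[of "-y"] integral_shift[of Q 1] integral_shift[of Q "-y"] by simp
  have ri: "integrable lborel (\<lambda>x. rld \<sigma> x * B (x - y))" for y
    by (rule Bochner_Integration.integrable_bound[OF bi[of y]])
       (use G Q0 key[of _ y] in \<open>auto intro!: AE_I2 simp: abs_of_nonneg\<close>)
  have rb: "(\<integral>x. \<bar>rld \<sigma> x * B (x - y)\<bar> \<partial>lborel) \<le> 4 * (\<integral>x. Q x \<partial>lborel) / Gamma \<sigma>" for y
    unfolding bv[of y, symmetric] by (rule integral_mono[OF _ bi key]) (use ri[of y] in simp)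
  have "integrable (lborel \<Otimes>\<^sub>M lborel) (\<lambda>z. rld \<sigma> (fst z) * (rld \<sigma> (snd z) * B (snd z - fst z)))"
  proof (rule lborel_pair.Fubini_integrable)
    show "(\<lambda>z. rld \<sigma> (fst z) * (rld \<sigma> (snd z) * B (snd z - fst z))) \<in> borel_measurable (lborel \<Otimes>\<^sub>M lborel)" by measurable
    have "integrable lborel (\<lambda>x. \<bar>rld \<sigma> x\<bar> * (\<integral>y. \<bar>rld \<sigma> y * B (y - x)\<bar> \<partial>lborel))"
    proof (rule Bochner_Integration.integrable_bound)
      show "integrable lborel (\<lambda>x. \<bar>rld \<sigma> x\<bar> * (4 * (\<integral>x. Q x \<partial>lborel) / Gamma \<sigma>))"
        using rld_integrable[OF s] by (intro integrable_mult_left integrable_abs)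
      have "norm (\<bar>rld \<sigma> x\<bar> * (\<integral>y. \<bar>rld \<sigma> y * B (y - x)\<bar> \<partial>lborel)) \<le> norm (\<bar>rld \<sigma> x\<bar> * (4 * (\<integral>x. Q x \<partial>lborel) / Gamma \<sigma>))" for x
      proof -
        have "0 \<le> (\<integral>y. \<bar>rld \<sigma> y * B (y - x)\<bar> \<partial>lborel)" by (intro integral_nonneg_AE) auto
        moreover have "0 \<le> (\<integral>x. Q x \<partial>lborel)" using Q0 by (intro integral_nonneg_AE) auto
        ultimately show ?thesis
          using G mult_left_mono[OF rb[of x], of "\<bar>rld \<sigma> x\<bar>"] by (simp add: abs_of_nonneg)
      qed
      then show "AE x in lborel. norm (\<bar>rld \<sigma> x\<bar> * (\<integral>y. \<bar>rld \<sigma> y * B (y - x)\<bar> \<partial>lborel)) \<le> norm (\<bar>rld \<sigma> x\<bar> * (4 * (\<integral>x. Q x \<partial>lborel) / Gamma \<sigma>))"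
        by simp
    qed measurable
    then show "integrable lborel (\<lambda>x. \<integral>y. norm (rld \<sigma> (fst (x, y)) * (rld \<sigma> (snd (x, y)) * B (snd (x, y) - fst (x, y)))) \<partial>lborel)"
      by (simp add: abs_mult)
    show "AE x in lborel. integrable lborel (\<lambda>y. rld \<sigma> (fst (x, y)) * (rld \<sigma> (snd (x, y)) * B (snd (x, y) - fst (x, y))))"
      using ri by simp
  qed
  moreover have "B (snd z - fst z) = B (fst z - snd z)" for z
    unfolding B_def by (auto simp: indicator_def abs_minus_commute)
  ultimately show ?thesis unfolding B_def by (simp add: mult.assoc)
qed

text \<open>
  A logarithm is dominated by small powers: for distances at least \<open>1\<close> by
  \<open>(1 + |x|)\<^sup>\<delta>\<close> and \<open>(1 + |y|)\<^sup>\<delta>\<close>, and for distances below \<open>1\<close> by \<open>|x - y|\<close> to the power \<open>-\<sigma>/2\<close>.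
\<close>

lemma rld_log_integrable:
  assumes s: "0 < \<sigma>" "\<sigma> < 1"
  shows "integrable (lborel \<Otimes>\<^sub>M lborel) (\<lambda>z. rld \<sigma> (fst z) * rld \<sigma> (snd z) * ln \<bar>fst z - snd z\<bar>)"
proof -
  \<comment> \<open>any exponent strictly between \<open>0\<close> and \<open>1 - \<sigma>\<close> would do\<close>
  define \<delta> where "\<delta> = (1 - \<sigma>) / 2"
  have d: "0 < \<delta>" "\<delta> < 1 - \<sigma>" using s by (auto simp: \<delta>_def)
  define A where "A x = (1 + \<bar>x\<bar>) powr \<delta> / \<delta>" for x :: real
  define B where "B = (\<lambda>u::real. \<bar>u\<bar> powr (-(\<sigma>/2)) * indicator {-1<..<1} u)"
  have A0: "A x \<ge> 0" for x using d by (simp add: A_def)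
  have B0: "B u \<ge> 0" for u by (simp add: B_def)
  have lnA: "ln (1 + \<bar>x\<bar>) \<le> A x" for x unfolding A_def using d by (intro ln_powr_bound) auto
  have key: "\<bar>ln \<bar>x - y\<bar>\<bar> \<le> A x + A y + 2 / \<sigma> * B (x - y)" for x y
  proof -
    consider "x = y" | "x \<noteq> y" "\<bar>x - y\<bar> < 1" | "1 \<le> \<bar>x - y\<bar>" by linarith
    then show ?thesis
    proof cases
      case 1
      then show ?thesis using A0[of y] B0[of 0] s by simp
    next
      case 2
      define r where "r = 1 / \<bar>x - y\<bar>"
      have r: "1 \<le> r" using 2 by (simp add: r_def field_simps)
      have "\<bar>ln \<bar>x - y\<bar>\<bar> = ln r" using 2 by (simp add: r_def ln_div)
      also have "\<dots> \<le> r powr (\<sigma>/2) / (\<sigma>/2)" using r s by (intro ln_powr_bound) auto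
      also have "r powr (\<sigma>/2) = B (x - y)" using 2 by (auto simp: r_def B_def powr_minus_divide powr_divide indicator_def abs_less_iff)
      finally show ?thesis using A0[of x] A0[of y] by (simp add: mult.commute)
    next
      case 3
      have "\<bar>x - y\<bar> \<le> (1 + \<bar>x\<bar>) * (1 + \<bar>y\<bar>)" 
      proof -
        have "(1 + \<bar>x\<bar>) * (1 + \<bar>y\<bar>) = 1 + \<bar>x\<bar> + \<bar>y\<bar> + \<bar>x * y\<bar>" by (simp add: algebra_simps abs_mult)
        then show ?thesis using abs_triangle_ineq4[of x y] abs_ge_zero[of "x * y"] by linarith
      qed
      then have "ln \<bar>x - y\<bar> \<le> ln ((1 + \<bar>x\<bar>) * (1 + \<bar>y\<bar>))" using 3 by (intro ln_mono) auto
      also have "\<dots> = ln (1 + \<bar>x\<bar>) + ln (1 + \<bar>y\<bar>)" by (rule ln_mult_pos) auto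
      also have "\<dots> \<le> A x + A y" by (intro add_mono lnA)
      moreover have "0 \<le> 2 / \<sigma> * B (x - y)" using s B0[of "x - y"] by simp
      ultimately show ?thesis using 3 by (simp add: abs_of_nonneg)
    qed
  qed
  have gi: "integrable lborel (rld \<sigma>)" by (rule rld_integrable[OF s])
  have gAi: "integrable lborel (\<lambda>x. rld \<sigma> x * A x)"
    using rld_weighted_integrable[OF s _ d(2)] d(1) by (simp add: A_def)
  show ?thesis
  proof (rule Bochner_Integration.integrable_bound)
    let ?w = "\<lambda>z. \<bar>(rld \<sigma> (fst z) * A (fst z)) * rld \<sigma> (snd z)\<bar> + \<bar>rld \<sigma> (fst z) * (rld \<sigma> (snd z) * A (snd z))\<bar>
       + 2 / \<sigma> * \<bar>rld \<sigma> (fst z) * rld \<sigma> (snd z) * B (fst z - snd z)\<bar>"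
    show "integrable (lborel \<Otimes>\<^sub>M lborel) ?w"
      by (intro Bochner_Integration.integrable_add integrable_mult_right integrable_abs integrable_tensor(1) gi gAi)
         (unfold B_def, rule rld_dist_integrable[OF s])
    have "norm (rld \<sigma> (fst z) * rld \<sigma> (snd z) * ln \<bar>fst z - snd z\<bar>) \<le> norm (?w z)" for z
    proof -
      have "norm (rld \<sigma> (fst z) * rld \<sigma> (snd z) * ln \<bar>fst z - snd z\<bar>)
        \<le> \<bar>rld \<sigma> (fst z) * rld \<sigma> (snd z)\<bar> * (A (fst z) + A (snd z) + 2 / \<sigma> * B (fst z - snd z))"
        using mult_left_mono[OF key[of "fst z" "snd z"], of "\<bar>rld \<sigma> (fst z) * rld \<sigma> (snd z)\<bar>"] by (simp add: abs_mult)
      also have "\<dots> = ?w z" using A0 B0 s by (simp add: abs_mult algebra_simps)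
      also have "\<dots> \<le> norm (?w z)" by simp
      finally show ?thesis .
    qed
    then show "AE z in lborel \<Otimes>\<^sub>M lborel. norm (rld \<sigma> (fst z) * rld \<sigma> (snd z) * ln \<bar>fst z - snd z\<bar>) \<le> norm (?w z)"
      by simp
  qed measurable
qed

section \<open>The Slobodeckij energy of a fractional integral\<close>

text \<open>
  Half of the squared Slobodeckij seminorm on the line: every unordered pair of points is counted once, as
  \<open>t\<close> and \<open>t + h\<close> with \<open>h > 0\<close>.
\<close>

definition slob_energy :: "real \<Rightarrow> (real \<Rightarrow> real) \<Rightarrow> ennreal" where
  "slob_energy \<sigma> u = (\<integral>\<^sup>+h. ennreal (h powr (-1 - 2 * \<sigma>)) * indicator {0<..} h *
      (\<integral>\<^sup>+t. ennreal ((u (t + h) - u t)\<^sup>2) \<partial>lborel) \<partial>lborel)"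

text \<open>
  The kernel is integrable on \<open>x \<le> 1\<close> and bounded on \<open>x > 1\<close>; the first part is controlled by \<open>f \<in> L\<^sup>2\<close>, the
  second by \<open>f \<in> L\<^sup>1\<close>.
\<close>

lemma rl_AE_integrable:
  assumes s: "0 < \<sigma>" "\<sigma> < 1" and f: "integrable lborel f" "f \<in> L2R"
  shows "AE t in lborel. integrable lborel (\<lambda>s. rlk \<sigma> (t - s) * f s)"
proof -
  have G: "Gamma \<sigma> > 0" using s by simp
  note [measurable] = f(2)[THEN L2R_measurable]
  have a: "integrable lborel (\<lambda>x. rlk \<sigma> x * indicator {..1} x)"
    using rlk_integral_upto(1)[of \<sigma> 1] s by simp
  show ?thesis
    using dconv_AE_integrable[OF a f(2), of 1]
  proof eventually_elim
    case (elim t)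
    have ft: "integrable lborel (\<lambda>x. f (t - x))"
      using lborel_integrable_real_affine[OF f(1), of "-1" t] by simp
    have "integrable lborel (\<lambda>x. rlk \<sigma> x * indicator {1<..} x * f (t - x))"
    proof (rule Bochner_Integration.integrable_bound)
      show "integrable lborel (\<lambda>x. 1 / Gamma \<sigma> * f (t - x))" using ft by (rule integrable_mult_right)
      have "norm (rlk \<sigma> x * indicator {1<..} x * f (t - x)) \<le> norm (1 / Gamma \<sigma> * f (t - x))" for x
      proof (cases "x > 1")
        case True
        then have "x powr (\<sigma> - 1) \<le> 1" using s powr_mono2'[of "\<sigma> - 1" 1 x] by simp
        then have "x powr (\<sigma> - 1) * \<bar>f (t - x)\<bar> \<le> 1 * \<bar>f (t - x)\<bar>" by (intro mult_right_mono) auto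
        then show ?thesis using True G by (simp add: rlk_def abs_mult divide_right_mono)
      qed simp
      then show "AE x in lborel. norm (rlk \<sigma> x * indicator {1<..} x * f (t - x)) \<le> norm (1 / Gamma \<sigma> * f (t - x))"
        by simp
    qed measurable
    from Bochner_Integration.integrable_add[OF elim this]
    have "integrable lborel (\<lambda>x. rlk \<sigma> x * f (t - x))"
      by (rule back_subst[where P = "integrable lborel"]) (auto simp: indicator_def)
    from lborel_integrable_real_affine[OF this, of "-1" t]
    show ?case by simp
  qed
qed

lemma rl_difference:
  assumes s: "0 < \<sigma>" "\<sigma> < 1" and f: "integrable lborel f" "f \<in> L2R" and h: "h > 0"
  shows "AE t in lborel. rl \<sigma> f (t + h) - rl \<sigma> f t = h powr \<sigma> * dconv (rld \<sigma>) f h t"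
proof -
  have "AE t in lborel. integrable lborel (\<lambda>s. rlk \<sigma> (t - s) * f (s + h))"
    by (rule rl_AE_integrable[OF s integrable_shift[OF f(1)] L2R_shift[OF f(2)]])
  then show ?thesis using rl_AE_integrable[OF s f]
  proof eventually_elim
    case (elim t)
    have i: "integrable lborel (\<lambda>s. rlk \<sigma> (t + h - s) * f s)"
      using integrable_shift[OF elim(1), of "- h"] by (simp add: algebra_simps)
    have "rl \<sigma> f (t + h) - rl \<sigma> f t = (\<integral>s. rlk \<sigma> (t + h - s) * f s - rlk \<sigma> (t - s) * f s \<partial>lborel)"
      unfolding rl_def using i elim(2) by simp
    also have "\<dots> = \<bar>- h\<bar> *\<^sub>R (\<integral>x. rlk \<sigma> (t + h - (t + - h * x)) * f (t + - h * x) - rlk \<sigma> (t - (t + - h * x)) * f (t + - h * x) \<partial>lborel)"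
      by (rule lborel_integral_real_affine) (use h in auto)
    also have "\<dots> = h * (\<integral>x. h powr (\<sigma> - 1) * (rld \<sigma> x * f (t - h * x)) \<partial>lborel)"
    proof -
      have "rlk \<sigma> (t + h - (t + - h * x)) = h powr (\<sigma> - 1) * rlk \<sigma> (x + 1)"
        "rlk \<sigma> (t - (t + - h * x)) = h powr (\<sigma> - 1) * rlk \<sigma> x" for x
        using rlk_scale[OF h, of \<sigma> "x + 1"] rlk_scale[OF h, of \<sigma> x] by (simp_all add: algebra_simps)
      then show ?thesis using h by (simp add: rld_def algebra_simps)
    qed
    also have "\<dots> = h powr \<sigma> * dconv (rld \<sigma>) f h t"
    proof -
      have "h * h powr (\<sigma> - 1) = h powr \<sigma>" using h by (simp add: powr_mult_base)
      then show ?thesis unfolding dconv_def integral_mult_right_zero by (simp add: mult.assoc[symmetric])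
    qed
    finally show ?case .
  qed
qed

text \<open>
  By \<open>rl_difference\<close> the difference of \<open>J\<^sup>\<sigma> f\<close> over a step \<open>h\<close> is \<open>h\<^sup>\<sigma>\<close> times a dilated convolution, so
  the weight \<open>h\<^sup>-\<^sup>1\<^sup>-\<^sup>2\<^sup>\<sigma>\<close> reduces to \<open>1/h\<close> and the square function identity applies.
\<close>

theorem rl_energy:
  assumes s: "0 < \<sigma>" "\<sigma> < 1" and f: "integrable lborel f" "f \<in> L2R"
  shows "slob_energy \<sigma> (rl \<sigma> f) = ennreal (log_energy (rld \<sigma>) * (\<integral>x. (f x)\<^sup>2 \<partial>lborel))"
proof -
  note [measurable] = f(2)[THEN L2R_measurable]
  define \<psi> where "\<psi> h = (\<integral>t. (dconv (rld \<sigma>) f h t)\<^sup>2 \<partial>lborel)" for h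
  have m [measurable]: "\<psi> \<in> borel_measurable borel" unfolding \<psi>_def dconv_def by measurable
  have p0: "\<psi> h \<ge> 0" for h unfolding \<psi>_def by (intro integral_nonneg_AE) auto
  have inner: "ennreal (h powr (-1 - 2 * \<sigma>)) * indicator {0<..} h * (\<integral>\<^sup>+t. ennreal ((rl \<sigma> f (t + h) - rl \<sigma> f t)\<^sup>2) \<partial>lborel)
     = ennreal (\<psi> h / h) * indicator {0<..} h" for h
  proof (cases "h > 0")
    case True
    have "(\<integral>\<^sup>+t. ennreal ((rl \<sigma> f (t + h) - rl \<sigma> f t)\<^sup>2) \<partial>lborel) = (\<integral>\<^sup>+t. ennreal ((h powr \<sigma>)\<^sup>2) * ennreal ((dconv (rld \<sigma>) f h t)\<^sup>2) \<partial>lborel)"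
      using rl_difference[OF s f True] by (intro nn_integral_cong_AE) (auto simp: power_mult_distrib ennreal_mult)
    also have "\<dots> = ennreal ((h powr \<sigma>)\<^sup>2) * ennreal (\<psi> h)"
      using L2R_nn[OF dconv_L2(1)[OF rld_integrable[OF s] f(2)]] by (simp add: nn_integral_cmult \<psi>_def)
    also have "ennreal (h powr (-1 - 2 * \<sigma>)) * \<dots> = ennreal (\<psi> h / h)"
    proof -
      have "h powr (-1 - 2 * \<sigma>) * ((h powr \<sigma>)\<^sup>2) = h powr (-1)"
        using True by (simp add: power2_eq_square powr_add[symmetric])
      then have "h powr (-1 - 2 * \<sigma>) * ((h powr \<sigma>)\<^sup>2 * \<psi> h) = \<psi> h / h"
        using True by (simp add: mult.assoc[symmetric] powr_minus_divide)
      then show ?thesis using p0[of h] by (simp add: ennreal_mult[symmetric])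
    qed
    finally show ?thesis using True by simp
  qed simp
  have "slob_energy \<sigma> (rl \<sigma> f) = (\<integral>\<^sup>+h. ennreal (\<psi> h / h) * indicator {0<..} h \<partial>lborel)"
    unfolding slob_energy_def inner ..
  also have "\<dots> = (\<integral>\<^sup>+\<tau>. ennreal (\<psi> (exp \<tau>) / exp \<tau> * exp \<tau>) \<partial>lborel)"
    by (rule nn_integral_exp_substitution) measurable
  also have "\<dots> = (\<integral>\<^sup>+\<tau>. ennreal (\<psi> (exp \<tau>)) \<partial>lborel)" by simp
  also have "\<dots> = ennreal (log_energy (rld \<sigma>) * (\<integral>x. (f x)\<^sup>2 \<partial>lborel))"
    unfolding \<psi>_def by (rule square_function_identity[OF rld_integrable[OF s] rld_integral[OF s] rld_log_integrable[OF s] f(2)])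
  finally show ?thesis .
qed

lemma powr_tail_nn:
  assumes "\<sigma> > 0" "s > 0"
  shows "(\<integral>\<^sup>+h. ennreal (h powr (-1 - 2 * \<sigma>) * indicator {s..} h) \<partial>lborel) = ennreal (s powr (- 2 * \<sigma>) / (2 * \<sigma>))"
proof -
  have "((\<lambda>x. x powr (-1 - 2 * \<sigma>)) has_integral -(s powr (-1 - 2 * \<sigma> + 1)) / (-1 - 2 * \<sigma> + 1)) {s..}"
    by (rule has_integral_powr_to_inf) (use assms in auto)
  then have "((\<lambda>x. x powr (-1 - 2 * \<sigma>)) has_integral s powr (- 2 * \<sigma>) / (2 * \<sigma>)) {s..}"
    by simp
  from lborel_of_has_integral(3)[OF _ _ this] show ?thesis by simp
qed

text \<open>
  Keep only the pairs \<open>t \<le> 0 < t + h\<close>.  There \<open>u(t) = 0\<close>, and for a fixed value \<open>s = t + h\<close> the steps \<open>h \<ge> s\<close>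
  contribute the integral of \<open>h\<^sup>-\<^sup>1\<^sup>-\<^sup>2\<^sup>\<sigma>\<close>.
\<close>

lemma energy_ge_hardy:
  assumes s: "\<sigma> > 0" and [measurable]: "u \<in> borel_measurable borel" and u0: "\<And>t. t \<le> 0 \<Longrightarrow> u t = 0"
  shows "(\<integral>\<^sup>+t. ennreal ((u t)\<^sup>2 * (t powr (- 2 * \<sigma>) / (2 * \<sigma>))) * indicator {0<..} t \<partial>lborel) \<le> slob_energy \<sigma> u"
proof -
  have "(\<integral>\<^sup>+t. ennreal ((u t)\<^sup>2 * (t powr (- 2 * \<sigma>) / (2 * \<sigma>))) * indicator {0<..} t \<partial>lborel)
     = (\<integral>\<^sup>+t. (\<integral>\<^sup>+h. ennreal ((u t)\<^sup>2) * (ennreal (h powr (-1 - 2 * \<sigma>)) * indicator {0<..} h * indicator {0..} (h - t)) \<partial>lborel) \<partial>lborel)"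
  proof (rule nn_integral_cong)
    fix t :: real
    show "ennreal ((u t)\<^sup>2 * (t powr (- 2 * \<sigma>) / (2 * \<sigma>))) * indicator {0<..} t
       = (\<integral>\<^sup>+h. ennreal ((u t)\<^sup>2) * (ennreal (h powr (-1 - 2 * \<sigma>)) * indicator {0<..} h * indicator {0..} (h - t)) \<partial>lborel)"
    proof (cases "t > 0")
      case True
      have e: "ennreal (h powr (-1 - 2 * \<sigma>)) * indicator {0<..} h * indicator {0..} (h - t) = ennreal (h powr (-1 - 2 * \<sigma>) * indicator {t..} h)" for h
        using True by (auto simp: indicator_def)
      have "(\<integral>\<^sup>+h. ennreal ((u t)\<^sup>2) * ennreal (h powr (-1 - 2 * \<sigma>) * indicator {t..} h) \<partial>lborel)
          = ennreal ((u t)\<^sup>2) * ennreal (t powr (- 2 * \<sigma>) / (2 * \<sigma>))"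
        unfolding powr_tail_nn[OF s True, symmetric] by (rule nn_integral_cmult) measurable
      also have "\<dots> = ennreal ((u t)\<^sup>2 * (t powr (- 2 * \<sigma>) / (2 * \<sigma>)))"
        using s by (intro ennreal_mult[symmetric]) auto
      finally show ?thesis using True unfolding e by simp
    qed (simp add: u0)
  qed
  also have "\<dots> = (\<integral>\<^sup>+h. (\<integral>\<^sup>+t. ennreal ((u t)\<^sup>2) * (ennreal (h powr (-1 - 2 * \<sigma>)) * indicator {0<..} h * indicator {0..} (h - t)) \<partial>lborel) \<partial>lborel)"
    by (rule lborel_pair.Fubini') measurable
  also have "\<dots> \<le> slob_energy \<sigma> u"
    unfolding slob_energy_def
  proof (rule nn_integral_mono)
    fix h :: real
    have "(\<integral>\<^sup>+t. ennreal ((u t)\<^sup>2) * (ennreal (h powr (-1 - 2 * \<sigma>)) * indicator {0<..} h * indicator {0..} (h - t)) \<partial>lborel)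
      = ennreal (h powr (-1 - 2 * \<sigma>)) * indicator {0<..} h * (\<integral>\<^sup>+t. ennreal ((u t)\<^sup>2) * indicator {0..} (h - t) \<partial>lborel)"
      by (subst nn_integral_cmult[symmetric]) (auto simp: mult_ac)
    also have "(\<integral>\<^sup>+t. ennreal ((u t)\<^sup>2) * indicator {0..} (h - t) \<partial>lborel) = (\<integral>\<^sup>+t. ennreal ((u (t + h))\<^sup>2) * indicator {0..} (h - (t + h)) \<partial>lborel)"
      by (rule nn_integral_shift[symmetric]) measurable
    also have "\<dots> \<le> (\<integral>\<^sup>+t. ennreal ((u (t + h) - u t)\<^sup>2) \<partial>lborel)"
      by (rule nn_integral_mono) (auto simp: indicator_def u0)
    finally show "(\<integral>\<^sup>+t. ennreal ((u t)\<^sup>2) * (ennreal (h powr (-1 - 2 * \<sigma>)) * indicator {0<..} h * indicator {0..} (h - t)) \<partial>lborel)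
      \<le> ennreal (h powr (-1 - 2 * \<sigma>)) * indicator {0<..} h * (\<integral>\<^sup>+t. ennreal ((u (t + h) - u t)\<^sup>2) \<partial>lborel)"
      by (simp add: mult_left_mono)
  qed
  finally show ?thesis .
qed

lemma rl_zero_left:
  assumes "\<And>s. s \<le> 0 \<Longrightarrow> f s = 0" and "t \<le> 0"
  shows "rl \<sigma> f t = 0"
proof -
  have "rlk \<sigma> (t - s) * f s = 0" for s using assms by (cases "s \<le> 0") (auto simp: rlk_def)
  then show ?thesis by (simp only: rl_def) simp
qed

text \<open>
  Otherwise the energy of the fractional integral of the indicator of \<open>(0, 1]\<close> would vanish by \<open>rl_energy\<close>, whereas
  \<open>energy_ge_hardy\<close> bounds it below by a positive number.
\<close>

lemma log_energy_rld_pos: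
  assumes s: "0 < \<sigma>" "\<sigma> < 1"
  shows "log_energy (rld \<sigma>) > 0"
proof (rule ccontr)
  assume n: "\<not> log_energy (rld \<sigma>) > 0"
  have G: "Gamma \<sigma> > 0" using s by simp
  define f where "f = (indicator {0<..1} :: real \<Rightarrow> real)"
  have f1: "integrable lborel f" unfolding f_def by (intro integrable_real_indicator) auto
  have "(\<lambda>x. (f x)\<^sup>2) = f" by (auto simp: f_def indicator_def)
  then have f2: "f \<in> L2R" using f1 by (intro L2R_I) (auto simp: f_def)
  define u where "u = rl \<sigma> f"
  have um [measurable]: "u \<in> borel_measurable borel" unfolding u_def using f2 by measurable
  have "log_energy (rld \<sigma>) * (\<integral>x. (f x)\<^sup>2 \<partial>lborel) \<le> 0"
    using n by (intro mult_nonpos_nonneg integral_nonneg_AE) auto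
  then have z: "slob_energy \<sigma> u = 0" unfolding u_def rl_energy[OF s f1 f2] by (rule ennreal_neg)
  have u0: "u t = 0" if "t \<le> 0" for t unfolding u_def by (rule rl_zero_left) (use that in \<open>auto simp: f_def\<close>)
  have uv: "u t = t powr \<sigma> / (\<sigma> * Gamma \<sigma>)" if t: "0 < t" "t < 1" for t
  proof -
    have "u t = \<bar>- 1\<bar> *\<^sub>R (\<integral>x. rlk \<sigma> (t - (t + - 1 * x)) * f (t + - 1 * x) \<partial>lborel)"
      unfolding u_def rl_def by (rule lborel_integral_real_affine) auto
    also have "\<dots> = (\<integral>x. rlk \<sigma> x * f (t - x) \<partial>lborel)" by simp
    also have "\<dots> = (\<integral>x. rlk \<sigma> x * indicator {..t} x \<partial>lborel)"
    proof (rule integral_cong_AE)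
      show "AE x in lborel. rlk \<sigma> x * f (t - x) = rlk \<sigma> x * indicator {..t} x"
        using AE_lborel_singleton[of t] by eventually_elim (use t in \<open>auto simp: f_def indicator_def rlk_def\<close>)
    qed (auto simp: f_def)
    finally show ?thesis using rlk_integral_upto(2)[of \<sigma> t] s t by simp
  qed
  define K where "K = ((1/2) powr \<sigma> / (\<sigma> * Gamma \<sigma>))\<^sup>2 / (2 * \<sigma>)"
  have K: "K > 0" unfolding K_def using s G by (intro divide_pos_pos zero_less_power mult_pos_pos) auto
  have "ennreal (K / 4) = (\<integral>\<^sup>+t. ennreal K * indicator {1/2..3/4} t \<partial>(lborel :: real measure))"
    using K by (simp add: nn_integral_cmult ennreal_mult[symmetric])
  also have "\<dots> \<le> (\<integral>\<^sup>+t. ennreal ((u t)\<^sup>2 * (t powr (- 2 * \<sigma>) / (2 * \<sigma>))) * indicator {0<..} t \<partial>lborel)"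
  proof (rule nn_integral_mono)
    fix t :: real
    show "ennreal K * indicator {1/2..3/4} t \<le> ennreal ((u t)\<^sup>2 * (t powr (- 2 * \<sigma>) / (2 * \<sigma>))) * indicator {0<..} t"
    proof (cases "t \<in> {1/2..3/4}")
      case True
      then have t: "0 < t" "t < 1" "1/2 \<le> t" by auto
      have "(1/2) powr \<sigma> \<le> t powr \<sigma>" using t s by (intro powr_mono2) auto
      then have "(1/2) powr \<sigma> / (\<sigma> * Gamma \<sigma>) \<le> u t" unfolding uv[OF t(1,2)] using s G by (intro divide_right_mono) auto
      then have a: "((1/2) powr \<sigma> / (\<sigma> * Gamma \<sigma>))\<^sup>2 \<le> (u t)\<^sup>2" using s G by (intro power_mono) auto
      have "1 \<le> t powr (- 2 * \<sigma>)" using t s powr_mono2'[of "-2 * \<sigma>" t 1] by simp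
      then have b: "1 / (2 * \<sigma>) \<le> t powr (- 2 * \<sigma>) / (2 * \<sigma>)" using s by (intro divide_right_mono) auto
      have "K \<le> (u t)\<^sup>2 * (t powr (- 2 * \<sigma>) / (2 * \<sigma>))"
        using mult_mono[OF a b] s by (simp add: K_def)
      then show ?thesis using True by (simp add: ennreal_leI)
    qed simp
  qed
  also have "\<dots> \<le> 0" using energy_ge_hardy[OF s(1) um u0] z by simp
  finally show False using K by simp
qed

section \<open>One-sided averages\<close>

text \<open>
  \<open>box_avg V \<delta> t\<close> is the average of \<open>V\<close> over \<open>[t - \<delta>, t]\<close>.  Averaging to the left only keeps the
  property of vanishing on the negative half-line.
\<close>

abbreviation box_avg :: "(real \<Rightarrow> real) \<Rightarrow> real \<Rightarrow> real \<Rightarrow> real" where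
  "box_avg V \<equiv> dconv (indicator {0..1}) V"

lemma box_L2R: "(indicator {0..1} :: real \<Rightarrow> real) \<in> L2R"
proof -
  have "(\<lambda>x. (indicator {0..1} x :: real)\<^sup>2) = indicator {0..1::real}" by (auto simp: indicator_def)
  then show ?thesis by (intro L2R_I) auto
qed

lemma box_integrable: "integrable lborel (indicator {0..1} :: real \<Rightarrow> real)"
  by (intro integrable_real_indicator) auto

lemma L2R_box_mult_integrable:
  assumes "V \<in> L2R" "\<delta> \<noteq> 0"
  shows "integrable lborel (\<lambda>x. indicator {0..1} x * V (t - \<delta> * x))"
  using L2R_mult_integrable[OF box_L2R L2R_affine[OF assms(1), of "- \<delta>" t]] assms(2) by simp

lemma box_avg_diff:
  assumes V: "V \<in> L2R" and d: "\<delta> \<noteq> 0"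
  shows "box_avg V \<delta> t - V t = (\<integral>x. indicator {0..1} x * (V (t - \<delta> * x) - V t) \<partial>lborel)"
proof -
  have "(\<integral>x. indicator {0..1} x * (V (t - \<delta> * x) - V t) \<partial>lborel)
      = (\<integral>x. indicator {0..1} x * V (t - \<delta> * x) - indicator {0..1} x * V t \<partial>lborel)"
    by (simp add: algebra_simps)
  also have "\<dots> = box_avg V \<delta> t - (\<integral>x. indicator {0..1::real} x * V t \<partial>lborel)"
    unfolding dconv_def
    using L2R_box_mult_integrable[OF V d, of t] integrable_mult_left[OF box_integrable, of "V t"]
    by (subst Bochner_Integration.integral_diff) auto
  finally show ?thesis by simp
qed

lemma translation_error_bound:
  assumes V: "V \<in> L2R"
  shows "(\<integral>t. (V (t + r) - V t)\<^sup>2 \<partial>lborel) \<le> 4 * (\<integral>t. (V t)\<^sup>2 \<partial>lborel)"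
proof -
  have i: "integrable lborel (\<lambda>t. 2 * (V (t + r))\<^sup>2 + 2 * (V t)\<^sup>2)"
    using L2R_square[OF V] L2R_square[OF L2R_shift[OF V]] by auto
  have "(\<integral>t. (V (t + r) - V t)\<^sup>2 \<partial>lborel) \<le> (\<integral>t. 2 * (V (t + r))\<^sup>2 + 2 * (V t)\<^sup>2 \<partial>lborel)"
  proof (rule integral_mono[OF _ i])
    show "integrable lborel (\<lambda>t. (V (t + r) - V t)\<^sup>2)" by (intro L2R_square L2R_diff L2R_shift V)
    fix t :: real
    have "0 \<le> (V (t + r) + V t)\<^sup>2" by simp
    then show "(V (t + r) - V t)\<^sup>2 \<le> 2 * (V (t + r))\<^sup>2 + 2 * (V t)\<^sup>2"
      by (simp add: power2_sum power2_diff)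
  qed
  also have "\<dots> = 4 * (\<integral>t. (V t)\<^sup>2 \<partial>lborel)"
    using L2R_square[OF V] L2R_square[OF L2R_shift[OF V, of r]] integral_shift[of "\<lambda>t. (V t)\<^sup>2" r] by simp
  finally show ?thesis .
qed

text \<open>
  The error is an average of translation differences, so Jensen's inequality (here Cauchy-Schwarz on the unit interval)
  and Tonelli's theorem bound it by the average of their norms.
\<close>

lemma box_avg_error:
  assumes V: "V \<in> L2R" and d: "\<delta> \<noteq> 0"
  shows "(\<integral>\<^sup>+t. ennreal ((box_avg V \<delta> t - V t)\<^sup>2) \<partial>lborel)
     \<le> (\<integral>\<^sup>+x. ennreal (indicator {0..1} x * (\<integral>t. (V (t + (- \<delta> * x)) - V t)\<^sup>2 \<partial>lborel)) \<partial>lborel)"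
proof -
  note [measurable] = V[THEN L2R_measurable]
  have "(\<integral>\<^sup>+t. ennreal ((box_avg V \<delta> t - V t)\<^sup>2) \<partial>lborel)
     \<le> (\<integral>\<^sup>+t. (\<integral>\<^sup>+x. ennreal (indicator {0..1} x * (V (t - \<delta> * x) - V t)\<^sup>2) \<partial>lborel) \<partial>lborel)"
  proof (rule nn_integral_mono)
    fix t :: real
    define D where "D x = indicator {0..1} x * (V (t - \<delta> * x) - V t)" for x
    have D: "D \<in> L2R"
    proof (rule L2R_I)
      show "D \<in> borel_measurable borel" unfolding D_def by measurable
      have i: "integrable lborel (\<lambda>x. 2 * (V (t + (- \<delta>) * x))\<^sup>2 + 2 * (V t)\<^sup>2 * indicator {0..1} x)"
        using L2R_square[OF L2R_affine[OF V, of "- \<delta>" t]] d by auto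
      show "integrable lborel (\<lambda>x. (D x)\<^sup>2)"
      proof (rule Bochner_Integration.integrable_bound[OF i])
        have "(D x)\<^sup>2 \<le> 2 * (V (t + (- \<delta>) * x))\<^sup>2 + 2 * (V t)\<^sup>2 * indicator {0..1} x" for x
        proof -
          have "0 \<le> (V (t - \<delta> * x) + V t)\<^sup>2" by simp
          then show ?thesis by (simp add: D_def indicator_def power2_sum power2_diff)
        qed
        then show "AE x in lborel. norm ((D x)\<^sup>2) \<le> norm (2 * (V (t + (- \<delta>) * x))\<^sup>2 + 2 * (V t)\<^sup>2 * indicator {0..1} x)"
          by (intro AE_I2) (metis abs_ge_self order_trans power2_abs real_norm_def abs_power2)
      qed (simp add: D_def)
    qed
    have b1: "(\<integral>x. (indicator {0..1} x)\<^sup>2 \<partial>(lborel :: real measure)) = (1::real)"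
    proof -
      have "(\<lambda>x. (indicator {0..1} x :: real)\<^sup>2) = indicator {0..1::real}" by (auto simp: indicator_def)
      then show ?thesis by simp
    qed
    have e: "box_avg V \<delta> t - V t = (\<integral>x. indicator {0..1} x * D x \<partial>lborel)"
      unfolding box_avg_diff[OF V d] by (intro Bochner_Integration.integral_cong) (auto simp: D_def indicator_def)
    have "\<bar>box_avg V \<delta> t - V t\<bar> \<le> sqrt (\<integral>x. (D x)\<^sup>2 \<partial>lborel)"
      using L2R_Cauchy_Schwarz[OF box_L2R D] unfolding e b1 by simp
    then have "(box_avg V \<delta> t - V t)\<^sup>2 \<le> (\<integral>x. (D x)\<^sup>2 \<partial>lborel)"
      by (rule sqrt_ge_absD)
    then have "ennreal ((box_avg V \<delta> t - V t)\<^sup>2) \<le> (\<integral>\<^sup>+x. ennreal ((D x)\<^sup>2) \<partial>lborel)"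
      unfolding L2R_nn[OF D] by (rule ennreal_leI)
    also have "(\<lambda>x. (D x)\<^sup>2) = (\<lambda>x. indicator {0..1} x * (V (t - \<delta> * x) - V t)\<^sup>2)"
      by (auto simp: D_def indicator_def)
    finally show "ennreal ((box_avg V \<delta> t - V t)\<^sup>2) \<le> (\<integral>\<^sup>+x. ennreal (indicator {0..1} x * (V (t - \<delta> * x) - V t)\<^sup>2) \<partial>lborel)" .
  qed
  also have "\<dots> = (\<integral>\<^sup>+x. (\<integral>\<^sup>+t. ennreal (indicator {0..1} x * (V (t - \<delta> * x) - V t)\<^sup>2) \<partial>lborel) \<partial>lborel)"
    by (rule lborel_pair.Fubini') measurable
  also have "\<dots> = (\<integral>\<^sup>+x. ennreal (indicator {0..1} x * (\<integral>t. (V (t + (- \<delta> * x)) - V t)\<^sup>2 \<partial>lborel)) \<partial>lborel)"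
  proof (rule nn_integral_cong)
    fix x :: real
    have "(\<integral>\<^sup>+t. ennreal ((V (t + (- \<delta> * x)) - V t)\<^sup>2) \<partial>lborel) = ennreal (\<integral>t. (V (t + (- \<delta> * x)) - V t)\<^sup>2 \<partial>lborel)"
      by (rule L2R_nn[OF L2R_diff[OF L2R_shift[OF V] V]])
    then show "(\<integral>\<^sup>+t. ennreal (indicator {0..1} x * (V (t - \<delta> * x) - V t)\<^sup>2) \<partial>lborel)
       = ennreal (indicator {0..1} x * (\<integral>t. (V (t + (- \<delta> * x)) - V t)\<^sup>2 \<partial>lborel))"
      by (auto simp: indicator_def)
  qed
  finally show ?thesis .
qed

lemma box_avg_error_bound:
  assumes V: "V \<in> L2R" and d: "\<delta> \<noteq> 0"
  shows "(\<integral>\<^sup>+t. ennreal ((box_avg V \<delta> t - V t)\<^sup>2) \<partial>lborel) \<le> 4 * (\<integral>\<^sup>+t. ennreal ((V t)\<^sup>2) \<partial>lborel)"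
proof -
  let ?n = "\<integral>t. (V t)\<^sup>2 \<partial>lborel"
  have "(\<integral>\<^sup>+x. ennreal (indicator {0..1} x * (\<integral>t. (V (t + (- \<delta> * x)) - V t)\<^sup>2 \<partial>lborel)) \<partial>lborel)
     \<le> (\<integral>\<^sup>+x. ennreal (4 * ?n) * indicator {0..1} x \<partial>(lborel :: real measure))"
  proof (rule nn_integral_mono)
    fix x :: real
    show "ennreal (indicator {0..1} x * (\<integral>t. (V (t + (- \<delta> * x)) - V t)\<^sup>2 \<partial>lborel)) \<le> ennreal (4 * ?n) * indicator {0..1} x"
      using translation_error_bound[OF V, of "- \<delta> * x"] by (auto simp: indicator_def intro!: ennreal_leI)
  qed
  also have "\<dots> = ennreal (4 * ?n)" by (simp add: nn_integral_cmult)
  also have "\<dots> = 4 * (\<integral>\<^sup>+t. ennreal ((V t)\<^sup>2) \<partial>lborel)"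
    unfolding L2R_nn[OF V] by (simp add: ennreal_mult')
  finally show ?thesis using box_avg_error[OF V d] by (rule order_trans[rotated])
qed

lemma box_avg_tendsto:
  assumes V: "V \<in> L2R" and d: "\<And>n. \<delta> n \<noteq> 0" "\<delta> \<longlonglongrightarrow> 0"
  shows "(\<lambda>n. \<integral>\<^sup>+t. ennreal ((box_avg V (\<delta> n) t - V t)\<^sup>2) \<partial>lborel) \<longlonglongrightarrow> 0"
proof -
  note [measurable] = V[THEN L2R_measurable]
  let ?n = "\<integral>t. (V t)\<^sup>2 \<partial>lborel"
  let ?w = "\<lambda>n x. ennreal (indicator {0..1} x * (\<integral>t. (V (t + (- \<delta> n * x)) - V t)\<^sup>2 \<partial>lborel))"
  have "(\<lambda>n. \<integral>\<^sup>+x. ?w n x \<partial>lborel) \<longlonglongrightarrow> (\<integral>\<^sup>+x. 0 \<partial>(lborel :: real measure))"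
  proof (rule nn_integral_dominated_convergence[where w = "\<lambda>x. ennreal (4 * ?n) * indicator {0..1} x"])
    show "AE x in lborel. ?w n x \<le> ennreal (4 * ?n) * indicator {0..1} x" for n
    proof (intro AE_I2)
      fix x :: real
      show "?w n x \<le> ennreal (4 * ?n) * indicator {0..1} x"
        using translation_error_bound[OF V, of "- \<delta> n * x"] by (auto simp: indicator_def intro!: ennreal_leI)
    qed
    show "(\<integral>\<^sup>+x. ennreal (4 * ?n) * indicator {0..1} x \<partial>(lborel :: real measure)) < \<infinity>"
      by (simp add: nn_integral_cmult)
    show "AE x in lborel. (\<lambda>n. ?w n x) \<longlonglongrightarrow> 0"
    proof (intro AE_I2)
      fix x :: real
      have "(\<lambda>n. - \<delta> n * x) \<longlonglongrightarrow> 0" using tendsto_mult[OF tendsto_minus[OF d(2)] tendsto_const[of x]] by simp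
      from tendsto_mult[OF tendsto_const L2R_translation_continuous[OF V this], of "indicator {0..1} x"]
      have "(\<lambda>n. indicator {0..1} x * (\<integral>t. (V (t + (- \<delta> n * x)) - V t)\<^sup>2 \<partial>lborel)) \<longlonglongrightarrow> 0" by simp
      from tendsto_ennrealI[OF this] show "(\<lambda>n. ?w n x) \<longlonglongrightarrow> 0" by simp
    qed
  qed measurable
  then have "(\<lambda>n. \<integral>\<^sup>+x. ?w n x \<partial>lborel) \<longlonglongrightarrow> 0" by simp
  then show ?thesis
    by (rule tendsto_sandwich[OF _ _ tendsto_const, rotated 2])
       (auto intro!: always_eventually order_trans[OF box_avg_error[OF V d(1)]])
qed

text \<open>
  Averaging commutes with taking differences.  For each step \<open>h\<close> the averages of the difference converge in \<open>L\<^sup>2\<close>,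
  and four times the energy density of \<open>V\<close> dominates.
\<close>

lemma energy_box_avg_tendsto:
  assumes V: "V \<in> L2R" and E: "slob_energy \<sigma> V < \<infinity>" and d: "\<And>n. \<delta> n \<noteq> 0" "\<delta> \<longlonglongrightarrow> 0"
  shows "(\<lambda>n. slob_energy \<sigma> (\<lambda>t. box_avg V (\<delta> n) t - V t)) \<longlonglongrightarrow> 0"
proof -
  note [measurable] = V[THEN L2R_measurable]
  define \<Delta> where "\<Delta> h t = V (t + h) - V t" for h t
  have D: "\<Delta> h \<in> L2R" for h unfolding \<Delta>_def by (rule L2R_diff[OF L2R_shift[OF V] V])
  have e: "box_avg V (\<delta> n) (t + h) - V (t + h) - (box_avg V (\<delta> n) t - V t) = box_avg (\<Delta> h) (\<delta> n) t - \<Delta> h t" for n t h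
  proof -
    have "box_avg (\<Delta> h) (\<delta> n) t = (\<integral>x. indicator {0..1} x * V (t + h - \<delta> n * x) - indicator {0..1} x * V (t - \<delta> n * x) \<partial>lborel)"
      unfolding dconv_def \<Delta>_def by (simp add: algebra_simps)
    also have "\<dots> = box_avg V (\<delta> n) (t + h) - box_avg V (\<delta> n) t"
      unfolding dconv_def by (intro Bochner_Integration.integral_diff L2R_box_mult_integrable V d(1))
    finally show ?thesis by (simp add: \<Delta>_def)
  qed
  let ?k = "\<lambda>h. ennreal (h powr (-1 - 2 * \<sigma>)) * indicator {0<..} h"
  have m: "(\<lambda>h. \<integral>\<^sup>+t. ennreal ((box_avg (\<Delta> h) (\<delta> n) t - \<Delta> h t)\<^sup>2) \<partial>lborel) \<in> borel_measurable borel" for n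
    unfolding dconv_def \<Delta>_def by measurable
  note [measurable] = m
  have m2 [measurable]: "(\<lambda>h. \<integral>\<^sup>+t. ennreal ((\<Delta> h t)\<^sup>2) \<partial>lborel) \<in> borel_measurable borel"
    unfolding \<Delta>_def by measurable
  have "(\<lambda>n. \<integral>\<^sup>+h. ?k h * (\<integral>\<^sup>+t. ennreal ((box_avg (\<Delta> h) (\<delta> n) t - \<Delta> h t)\<^sup>2) \<partial>lborel) \<partial>lborel)
     \<longlonglongrightarrow> (\<integral>\<^sup>+h. 0 \<partial>(lborel :: real measure))"
  proof (rule nn_integral_dominated_convergence[where w = "\<lambda>h. 4 * (?k h * (\<integral>\<^sup>+t. ennreal ((\<Delta> h t)\<^sup>2) \<partial>lborel))"])
    show "AE h in lborel. ?k h * (\<integral>\<^sup>+t. ennreal ((box_avg (\<Delta> h) (\<delta> n) t - \<Delta> h t)\<^sup>2) \<partial>lborel)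
       \<le> 4 * (?k h * (\<integral>\<^sup>+t. ennreal ((\<Delta> h t)\<^sup>2) \<partial>lborel))" for n
    proof (intro AE_I2)
      fix h :: real
      have "?k h * (\<integral>\<^sup>+t. ennreal ((box_avg (\<Delta> h) (\<delta> n) t - \<Delta> h t)\<^sup>2) \<partial>lborel)
         \<le> ?k h * (4 * (\<integral>\<^sup>+t. ennreal ((\<Delta> h t)\<^sup>2) \<partial>lborel))"
        by (rule mult_left_mono[OF box_avg_error_bound[OF D d(1)]]) simp
      then show "?k h * (\<integral>\<^sup>+t. ennreal ((box_avg (\<Delta> h) (\<delta> n) t - \<Delta> h t)\<^sup>2) \<partial>lborel)
         \<le> 4 * (?k h * (\<integral>\<^sup>+t. ennreal ((\<Delta> h t)\<^sup>2) \<partial>lborel))"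
        by (simp only: mult_ac)
    qed
    show "(\<integral>\<^sup>+h. 4 * (?k h * (\<integral>\<^sup>+t. ennreal ((\<Delta> h t)\<^sup>2) \<partial>lborel)) \<partial>lborel) < \<infinity>"
      using E by (subst nn_integral_cmult) (auto simp: slob_energy_def \<Delta>_def ennreal_mult_less_top)
    show "AE h in lborel. (\<lambda>n. ?k h * (\<integral>\<^sup>+t. ennreal ((box_avg (\<Delta> h) (\<delta> n) t - \<Delta> h t)\<^sup>2) \<partial>lborel)) \<longlonglongrightarrow> 0"
    proof (intro AE_I2)
      fix h :: real
      have "(\<lambda>n. ?k h * (\<integral>\<^sup>+t. ennreal ((box_avg (\<Delta> h) (\<delta> n) t - \<Delta> h t)\<^sup>2) \<partial>lborel)) \<longlonglongrightarrow> ?k h * 0"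
        by (rule ennreal_tendsto_cmult[OF _ box_avg_tendsto[OF D d]]) (auto simp: indicator_def)
      then show "(\<lambda>n. ?k h * (\<integral>\<^sup>+t. ennreal ((box_avg (\<Delta> h) (\<delta> n) t - \<Delta> h t)\<^sup>2) \<partial>lborel)) \<longlonglongrightarrow> 0" by simp
    qed
  qed measurable
  then show ?thesis unfolding slob_energy_def e by simp
qed

lemma energy_diff_le:
  assumes [measurable]: "u \<in> borel_measurable borel" "v \<in> borel_measurable borel"
  shows "slob_energy \<sigma> (\<lambda>t. u t - v t) \<le> 2 * slob_energy \<sigma> u + 2 * slob_energy \<sigma> v"
proof -
  let ?k = "\<lambda>h. ennreal (h powr (-1 - 2 * \<sigma>)) * indicator {0<..} h"
  let ?q = "\<lambda>u h. \<integral>\<^sup>+t. ennreal ((u (t + h) - u t)\<^sup>2) \<partial>lborel"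
  have "?q (\<lambda>t. u t - v t) h \<le> 2 * ?q u h + 2 * ?q v h" for h
  proof -
    have "?q (\<lambda>t. u t - v t) h \<le> (\<integral>\<^sup>+t. 2 * ennreal ((u (t + h) - u t)\<^sup>2) + 2 * ennreal ((v (t + h) - v t)\<^sup>2) \<partial>lborel)"
    proof (rule nn_integral_mono)
      fix t :: real
      have "0 \<le> ((u (t + h) - u t) + (v (t + h) - v t))\<^sup>2" by simp
      also have "\<dots> = 2 * (u (t + h) - u t)\<^sup>2 + 2 * (v (t + h) - v t)\<^sup>2 - (u (t + h) - v (t + h) - (u t - v t))\<^sup>2"
        by (simp add: power2_eq_square algebra_simps)
      finally have "(u (t + h) - v (t + h) - (u t - v t))\<^sup>2 \<le> 2 * (u (t + h) - u t)\<^sup>2 + 2 * (v (t + h) - v t)\<^sup>2" by simp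
      then have "ennreal ((u (t + h) - v (t + h) - (u t - v t))\<^sup>2) \<le> ennreal (2 * (u (t + h) - u t)\<^sup>2 + 2 * (v (t + h) - v t)\<^sup>2)"
        by (rule ennreal_leI)
      then show "ennreal ((u (t + h) - v (t + h) - (u t - v t))\<^sup>2) \<le> 2 * ennreal ((u (t + h) - u t)\<^sup>2) + 2 * ennreal ((v (t + h) - v t)\<^sup>2)"
        by (simp add: ennreal_mult')
    qed
    also have "\<dots> = 2 * ?q u h + 2 * ?q v h"
      by (simp add: nn_integral_add nn_integral_cmult)
    finally show ?thesis .
  qed
  then have "slob_energy \<sigma> (\<lambda>t. u t - v t) \<le> (\<integral>\<^sup>+h. 2 * (?k h * ?q u h) + 2 * (?k h * ?q v h) \<partial>lborel)"
    unfolding slob_energy_def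
  proof (intro nn_integral_mono)
    fix h :: real
    assume a: "\<And>h. ?q (\<lambda>t. u t - v t) h \<le> 2 * ?q u h + 2 * ?q v h"
    have "?k h * ?q (\<lambda>t. u t - v t) h \<le> ?k h * (2 * ?q u h + 2 * ?q v h)" by (rule mult_left_mono[OF a]) simp
    then show "?k h * ?q (\<lambda>t. u t - v t) h \<le> 2 * (?k h * ?q u h) + 2 * (?k h * ?q v h)"
      by (simp add: distrib_left mult.left_commute)
  qed
  also have "\<dots> = 2 * slob_energy \<sigma> u + 2 * slob_energy \<sigma> v"
    unfolding slob_energy_def by (subst nn_integral_add) (auto simp: nn_integral_cmult)
  finally show ?thesis .
qed

section \<open>Convolution bounds\<close>

lemma dconv_L1:
  assumes g: "integrable lborel g" and f: "integrable lborel f"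
  shows "integrable lborel (dconv g f h)"
proof -
  have [measurable]: "g \<in> borel_measurable borel" "f \<in> borel_measurable borel"
    using g f by (auto dest: borel_measurable_integrable)
  have sh: "integrable lborel (\<lambda>t. f (t - h * x))" for x
    using integrable_shift[OF f, of "- h * x"] by simp
  have "integrable (lborel \<Otimes>\<^sub>M lborel) (\<lambda>z. g (fst z) * f (snd z - h * fst z))"
  proof (rule lborel_pair.Fubini_integrable)
    show "(\<lambda>z. g (fst z) * f (snd z - h * fst z)) \<in> borel_measurable (lborel \<Otimes>\<^sub>M lborel)" by measurable
    have "(\<integral>t. \<bar>f (t - h * x)\<bar> \<partial>lborel) = (\<integral>t. \<bar>f t\<bar> \<partial>lborel)" for x
      using integral_shift[of "\<lambda>t. \<bar>f t\<bar>" "- h * x"] by simp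
    then show "integrable lborel (\<lambda>x. \<integral>y. norm (g (fst (x, y)) * f (snd (x, y) - h * fst (x, y))) \<partial>lborel)"
      using g by (simp add: abs_mult)
    show "AE x in lborel. integrable lborel (\<lambda>y. g (fst (x, y)) * f (snd (x, y) - h * fst (x, y)))"
      using sh by simp
  qed
  from lborel_pair.integrable_fst'[OF lborel_pair.integrable_product_swap[OF this]]
  show ?thesis by (simp add: dconv_def[abs_def])
qed

lemma dconv_L2_bound:
  assumes g: "integrable lborel g" and f: "f \<in> L2R"
  shows "(\<integral>t. (dconv g f h t)\<^sup>2 \<partial>lborel) \<le> (\<integral>x. \<bar>g x\<bar> \<partial>lborel)\<^sup>2 * (\<integral>x. (f x)\<^sup>2 \<partial>lborel)"
proof -
  let ?n = "\<integral>x. (f x)\<^sup>2 \<partial>lborel"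
  have ga: "integrable lborel (\<lambda>x. \<bar>g x\<bar>)" using g by simp
  have "(\<integral>t. (dconv g f h t)\<^sup>2 \<partial>lborel)
     \<le> (\<integral>z. \<bar>g (fst z)\<bar> * \<bar>g (snd z)\<bar> * ?n \<partial>(lborel \<Otimes>\<^sub>M lborel))"
    unfolding dconv_L2(2)[OF g f]
  proof (rule integral_mono[OF dconv_L2(3)[OF g f]])
    show "integrable (lborel \<Otimes>\<^sub>M lborel) (\<lambda>z. \<bar>g (fst z)\<bar> * \<bar>g (snd z)\<bar> * ?n)"
      by (rule integrable_mult_left[OF integrable_tensor(1)[OF ga ga]])
    fix z :: "real \<times> real"
    have "g (fst z) * g (snd z) * autocorr f (h * (fst z - snd z)) \<le> \<bar>g (fst z) * g (snd z)\<bar> * \<bar>autocorr f (h * (fst z - snd z))\<bar>"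
      by (metis abs_ge_self abs_mult)
    also have "\<dots> \<le> \<bar>g (fst z) * g (snd z)\<bar> * ?n" by (intro mult_left_mono autocorr_bound[OF f]) auto
    finally show "g (fst z) * g (snd z) * autocorr f (h * (fst z - snd z)) \<le> \<bar>g (fst z)\<bar> * \<bar>g (snd z)\<bar> * ?n"
      by (simp add: abs_mult)
  qed
  also have "\<dots> = (\<integral>x. \<bar>g x\<bar> \<partial>lborel)\<^sup>2 * ?n"
    using integrable_tensor(2)[OF ga ga] by (simp add: power2_eq_square)
  finally show ?thesis .
qed

section \<open>Functions of finite energy are fractional integrals\<close>

lemma L2R_cong_AE:
  assumes f: "f \<in> L2R" and g: "g \<in> borel_measurable borel" and e: "AE x in lborel. f x = g x"
  shows "g \<in> L2R"
proof (rule L2R_I[OF g])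
  note [measurable] = g f[THEN L2R_measurable]
  show "integrable lborel (\<lambda>x. (g x)\<^sup>2)"
    using L2R_square[OF f] e by (subst integrable_cong_AE[where g = "\<lambda>x. (f x)\<^sup>2"]) (auto elim!: eventually_mono)
qed

lemma rl_eq_dconv: "rl \<sigma> f t = dconv (rlk \<sigma>) f 1 t"
proof -
  have "rl \<sigma> f t = \<bar>- 1\<bar> *\<^sub>R (\<integral>x. rlk \<sigma> (t - (t + - 1 * x)) * f (t + - 1 * x) \<partial>lborel)"
    unfolding rl_def by (rule lborel_integral_real_affine) auto
  then show ?thesis by (simp add: dconv_def)
qed

lemma rl_shift: "rl \<sigma> (\<lambda>s. f (s + r)) t = rl \<sigma> f (t + r)"
  by (simp add: rl_eq_dconv dconv_def algebra_simps)

text \<open>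
  The derivative of order \<open>\<sigma>\<close> of the average of \<open>V\<close>: differentiating the average of \<open>V\<close> gives a difference quotient
  of \<open>V\<close>, to which \<open>J\<^sup>1\<^sup>-\<^sup>\<sigma>\<close> is applied.
\<close>

definition avg_deriv :: "real \<Rightarrow> (real \<Rightarrow> real) \<Rightarrow> real \<Rightarrow> real \<Rightarrow> real" where
  "avg_deriv \<sigma> V \<delta> t = (rl (1 - \<sigma>) V t - rl (1 - \<sigma>) V (t - \<delta>)) / \<delta>"

text \<open>
  The difference of \<open>J\<^sup>1\<^sup>-\<^sup>\<sigma> V\<close> is a convolution of \<open>V\<close> with the integrable kernel \<open>rld (1 - \<sigma>)\<close>, so it inherits
  integrability and square-integrability from \<open>V\<close>.  Applying \<open>J\<^sup>\<sigma>\<close> turns \<open>J\<^sup>1\<^sup>-\<^sup>\<sigma>\<close> into \<open>J\<^sup>1\<close> by the semigroup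
  law, and a difference quotient of \<open>J\<^sup>1 V\<close> is an average of \<open>V\<close>.
\<close>

lemma rl_avg_deriv:
  assumes s: "0 < \<sigma>" "\<sigma> < 1" and V: "integrable lborel V" "V \<in> L2R" and d: "\<delta> > 0"
  shows "integrable lborel (avg_deriv \<sigma> V \<delta>)" "avg_deriv \<sigma> V \<delta> \<in> L2R"
    and "rl \<sigma> (avg_deriv \<sigma> V \<delta>) t = box_avg V \<delta> t"
    and "integrable lborel (\<lambda>s. rlk \<sigma> (t - s) * avg_deriv \<sigma> V \<delta> s)"
proof -
  note [measurable] = V(2)[THEN L2R_measurable]
  have s': "0 < 1 - \<sigma>" "1 - \<sigma> < 1" using s by auto
  let ?y = "rl (1 - \<sigma>) V"
  have m [measurable]: "avg_deriv \<sigma> V \<delta> \<in> borel_measurable borel" unfolding avg_deriv_def by measurable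
  define D where "D t = \<delta> powr (1 - \<sigma>) / \<delta> * dconv (rld (1 - \<sigma>)) V \<delta> (t - \<delta>)" for t
  have Dm [measurable]: "D \<in> borel_measurable borel" unfolding D_def dconv_def by measurable
  have "AE t in lborel. rl (1 - \<sigma>) (\<lambda>s. V (s + - \<delta>)) (t + \<delta>) - rl (1 - \<sigma>) (\<lambda>s. V (s + - \<delta>)) t
      = \<delta> powr (1 - \<sigma>) * dconv (rld (1 - \<sigma>)) (\<lambda>s. V (s + - \<delta>)) \<delta> t"
    by (rule rl_difference[OF s' integrable_shift[OF V(1)] L2R_shift[OF V(2)] d])
  then have e: "AE t in lborel. D t = avg_deriv \<sigma> V \<delta> t"
  proof eventually_elim
    case (elim t)
    have "dconv (rld (1 - \<sigma>)) (\<lambda>s. V (s + - \<delta>)) \<delta> t = dconv (rld (1 - \<sigma>)) V \<delta> (t - \<delta>)"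
      by (simp add: dconv_def algebra_simps)
    with elim have "?y t - ?y (t - \<delta>) = \<delta> powr (1 - \<sigma>) * dconv (rld (1 - \<sigma>)) V \<delta> (t - \<delta>)"
      unfolding rl_shift by simp
    then show ?case by (simp add: D_def avg_deriv_def)
  qed
  have D1: "integrable lborel D"
    unfolding D_def
    using integrable_shift[OF dconv_L1[OF rld_integrable[OF s'] V(1)], of \<delta> "- \<delta>"]
    by (intro integrable_mult_right) simp
  have D2: "D \<in> L2R"
    unfolding D_def
    using L2R_shift[OF dconv_L2(1)[OF rld_integrable[OF s'] V(2)], of \<delta> "- \<delta>"]
    by (intro L2R_scale) simp
  show "integrable lborel (avg_deriv \<sigma> V \<delta>)"
    using D1 e by (subst integrable_cong_AE[where g = D]) (auto elim!: eventually_mono)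
  show "avg_deriv \<sigma> V \<delta> \<in> L2R" by (rule L2R_cong_AE[OF D2 m e])
  have k1: "rlk 1 x = indicator {0<..} x" for x by (simp add: rlk_def indicator_def)
  have i1: "integrable lborel (\<lambda>r. rlk (\<sigma> + (1 - \<sigma>)) (t - r) * V r)" for t
    by (rule Bochner_Integration.integrable_bound[OF V(1)]) (auto simp: k1 indicator_def)
  have sg: "rl \<sigma> ?y t = rl 1 V t" "integrable lborel (\<lambda>s. rlk \<sigma> (t - s) * ?y s)" for t
    using rl_semigroup_at[OF s(1) s'(1) _ i1[of t]] by auto
  have i2: "integrable lborel (\<lambda>s. rlk \<sigma> (t - s) * ?y (s - \<delta>))"
    using integrable_shift[OF sg(2)[of "t - \<delta>"], of "- \<delta>"] by simp
  have eq: "rlk \<sigma> (t - s) * avg_deriv \<sigma> V \<delta> s = (rlk \<sigma> (t - s) * ?y s - rlk \<sigma> (t - s) * ?y (s - \<delta>)) / \<delta>" for s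
    by (simp add: avg_deriv_def right_diff_distrib)
  show "integrable lborel (\<lambda>s. rlk \<sigma> (t - s) * avg_deriv \<sigma> V \<delta> s)"
    unfolding eq using sg(2) i2 by simp
  have "rl \<sigma> (avg_deriv \<sigma> V \<delta>) t = (rl \<sigma> ?y t - rl \<sigma> (\<lambda>s. ?y (s + - \<delta>)) t) / \<delta>"
    unfolding rl_def[of \<sigma>] eq using sg(2)[of t] i2 by simp
  also have "\<dots> = (rl 1 V t - rl 1 V (t - \<delta>)) / \<delta>"
    unfolding rl_shift sg(1) by simp
  also have "\<dots> = (\<integral>r. indicator {0<..} (t - r) * V r - indicator {0<..} (t - \<delta> - r) * V r \<partial>lborel) / \<delta>"
  proof -
    have "integrable lborel (\<lambda>r. indicator {0<..} (a - r) * V r)" for a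
      by (rule Bochner_Integration.integrable_bound[OF V(1)]) (auto simp: indicator_def)
    then show ?thesis unfolding rl_def k1 by simp
  qed
  also have "\<dots> = \<bar>- \<delta>\<bar> *\<^sub>R (\<integral>x. indicator {0<..} (t - (t + - \<delta> * x)) * V (t + - \<delta> * x) - indicator {0<..} (t - \<delta> - (t + - \<delta> * x)) * V (t + - \<delta> * x) \<partial>lborel) / \<delta>"
    by (subst lborel_integral_real_affine[where c = "- \<delta>" and t = t]) (use d in auto)
  also have "\<dots> = (\<integral>x. indicator {0<..} (\<delta> * x) * V (t - \<delta> * x) - indicator {0<..} (\<delta> * x - \<delta>) * V (t - \<delta> * x) \<partial>lborel)"
    using d by simp
  also have "\<dots> = box_avg V \<delta> t"
    unfolding dconv_def
  proof (rule integral_cong_AE)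
    show "AE x in lborel. indicator {0<..} (\<delta> * x) * V (t - \<delta> * x) - indicator {0<..} (\<delta> * x - \<delta>) * V (t - \<delta> * x) = indicator {0..1} x * V (t - \<delta> * x)"
      using AE_lborel_singleton[of 0]
    proof eventually_elim
      case (elim x)
      have "indicator {0<..} (\<delta> * x) - indicator {0<..} (\<delta> * x - \<delta>) = (indicator {0..1} x :: real)"
        using d elim by (auto simp: indicator_def zero_less_mult_iff)
      then show ?case by (metis left_diff_distrib)
    qed
  qed measurable
  finally show "rl \<sigma> (avg_deriv \<sigma> V \<delta>) t = box_avg V \<delta> t" .
qed

lemma rl_trunc:
  assumes f: "\<And>s. s \<notin> {0<..<T} \<Longrightarrow> f s = 0" and t: "t < T"
  shows "rl \<sigma> f t = dconv (\<lambda>x. rlk \<sigma> x * indicator {..T} x) f 1 t"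
  unfolding rl_eq_dconv dconv_def
proof (rule Bochner_Integration.integral_cong[OF refl])
  fix x :: real
  show "rlk \<sigma> x * f (t - 1 * x) = rlk \<sigma> x * indicator {..T} x * f (t - 1 * x)"
    using f[of "t - x"] t by (auto simp: indicator_def)
qed

lemma rl_restrict:
  assumes f: "\<And>s. s \<le> 0 \<Longrightarrow> f s = 0" and t: "t < T"
  shows "rl \<sigma> (\<lambda>s. indicator {0<..<T} s * f s) t = rl \<sigma> f t"
  unfolding rl_def
proof (rule Bochner_Integration.integral_cong[OF refl])
  fix s :: real
  show "rlk \<sigma> (t - s) * (indicator {0<..<T} s * f s) = rlk \<sigma> (t - s) * f s"
    using f[of s] t by (auto simp: indicator_def rlk_def)
qed

text \<open>
  Completeness of \<open>L\<^sup>2(0,T)\<close>.  On a bounded interval the sequence is Cauchy in \<open>L\<^sup>1\<close> as well, hence a subsequence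
  converges almost everywhere, and Fatou's lemma turns the Cauchy estimate into an estimate for the limit.
\<close>

lemma L2R_complete_interval:
  fixes z :: "nat \<Rightarrow> real \<Rightarrow> real"
  assumes z: "\<And>n. z n \<in> L2R" and supp: "\<And>n s. s \<notin> {0<..<T} \<Longrightarrow> z n s = 0" and T: "T > 0"
    and C: "\<And>e. e > 0 \<Longrightarrow> \<exists>N. \<forall>m\<ge>N. \<forall>n\<ge>N. (\<integral>x. (z m x - z n x)\<^sup>2 \<partial>lborel) < e"
  obtains w where "w \<in> L2R" "\<And>s. s \<notin> {0<..<T} \<Longrightarrow> w s = 0"
    "(\<lambda>n. \<integral>x. (w x - z n x)\<^sup>2 \<partial>lborel) \<longlonglongrightarrow> 0"
proof -
  note [measurable] = z[THEN L2R_measurable]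
  have b: "(indicator {0<..<T} :: real \<Rightarrow> real) \<in> L2R"
  proof -
    have "(\<lambda>x. (indicator {0<..<T} x :: real)\<^sup>2) = indicator {0<..<T}" by (auto simp: indicator_def)
    then show ?thesis using T by (intro L2R_I) auto
  qed
  have bsq: "(\<integral>x. (indicator {0<..<T} x :: real)\<^sup>2 \<partial>(lborel :: real measure)) = T"
  proof -
    have "(\<lambda>x. (indicator {0<..<T} x :: real)\<^sup>2) = indicator {0<..<T}" by (auto simp: indicator_def)
    then show ?thesis using T by simp
  qed
  have ab: "(\<lambda>x. \<bar>u x\<bar>) \<in> L2R" if "u \<in> L2R" for u using that by (auto simp: L2R_def)
  have zi: "integrable lborel (z n)" for n
  proof -
    have "integrable lborel (\<lambda>x. indicator {0<..<T} x * z n x)" by (rule L2R_mult_integrable[OF b z])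
    moreover have "indicator {0<..<T} x * z n x = z n x" for x using supp by (auto simp: indicator_def)
    ultimately show ?thesis by simp
  qed
  have l1: "(\<integral>x. norm (z m x - z n x) \<partial>lborel) \<le> sqrt T * sqrt (\<integral>x. (z m x - z n x)\<^sup>2 \<partial>lborel)" for m n
  proof -
    have "(\<integral>x. norm (z m x - z n x) \<partial>lborel) = (\<integral>x. indicator {0<..<T} x * \<bar>z m x - z n x\<bar> \<partial>lborel)"
    proof (rule Bochner_Integration.integral_cong[OF refl])
      fix x :: real
      show "norm (z m x - z n x) = indicator {0<..<T} x * \<bar>z m x - z n x\<bar>"
        using supp[of x] by (cases "x \<in> {0<..<T}") simp_all
    qed
    also have "\<dots> \<le> sqrt T * sqrt (\<integral>x. (z m x - z n x)\<^sup>2 \<partial>lborel)"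
      using L2R_Cauchy_Schwarz[OF b ab[OF L2R_diff[OF z z]], of m n] bsq by simp
    finally show ?thesis .
  qed
  have "\<exists>N. \<forall>i\<ge>N. \<forall>j\<ge>N. (LINT x|lborel. norm (z i x - z j x)) < e" if e: "e > 0" for e
  proof -
    obtain N where N: "\<And>m n. m \<ge> N \<Longrightarrow> n \<ge> N \<Longrightarrow> (\<integral>x. (z m x - z n x)\<^sup>2 \<partial>lborel) < e\<^sup>2 / T"
      using C[of "e\<^sup>2 / T"] e T by auto
    have "(LINT x|lborel. norm (z i x - z j x)) < e" if "i \<ge> N" "j \<ge> N" for i j
    proof -
      have "sqrt T * sqrt (\<integral>x. (z i x - z j x)\<^sup>2 \<partial>lborel) < sqrt T * sqrt (e\<^sup>2 / T)"
        using N[OF that] T by (intro mult_strict_left_mono) auto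
      also have "\<dots> = e" using T e by (simp add: real_sqrt_divide)
      finally show ?thesis using l1[of i j] by linarith
    qed
    then show ?thesis by blast
  qed
  then obtain r where r: "strict_mono r" and cau: "AE x in lborel. Cauchy (\<lambda>i. z (r i) x)"
    using cauchy_L1_AE_cauchy_subseq[of lborel z] zi by blast
  define w where "w x = (if x \<in> {0<..<T} then lim (\<lambda>i. z (r i) x) else 0)" for x
  have wm [measurable]: "w \<in> borel_measurable borel" unfolding w_def by measurable
  have w0: "w s = 0" if "s \<notin> {0<..<T}" for s using that unfolding w_def by (simp only: if_False)
  have wl: "AE x in lborel. (\<lambda>i. z (r i) x) \<longlonglongrightarrow> w x"
    using cau
  proof eventually_elim
    case (elim x)
    then have "convergent (\<lambda>i. z (r i) x)" by (simp add: Cauchy_convergent_iff)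
    then have l: "(\<lambda>i. z (r i) x) \<longlonglongrightarrow> lim (\<lambda>i. z (r i) x)" by (simp add: convergent_LIMSEQ_iff)
    show ?case
    proof (cases "x \<in> {0<..<T}")
      case True then show ?thesis using l by (simp add: w_def)
    next
      case False then show ?thesis using supp[OF False] by (simp add: w_def)
    qed
  qed
  have fatou: "(\<integral>\<^sup>+x. ennreal ((w x - z n x)\<^sup>2) \<partial>lborel) \<le> ennreal e"
    if N: "\<And>i. i \<ge> N \<Longrightarrow> (\<integral>x. (z i x - z n x)\<^sup>2 \<partial>lborel) < e" for n N e
  proof -
    have "(\<integral>\<^sup>+x. ennreal ((w x - z n x)\<^sup>2) \<partial>lborel) = (\<integral>\<^sup>+x. liminf (\<lambda>i. ennreal ((z (r i) x - z n x)\<^sup>2)) \<partial>lborel)"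
    proof (rule nn_integral_cong_AE)
      show "AE x in lborel. ennreal ((w x - z n x)\<^sup>2) = liminf (\<lambda>i. ennreal ((z (r i) x - z n x)\<^sup>2))"
        using wl
      proof eventually_elim
        case (elim x)
        have "(\<lambda>i. ennreal ((z (r i) x - z n x)\<^sup>2)) \<longlonglongrightarrow> ennreal ((w x - z n x)\<^sup>2)"
          by (intro tendsto_ennrealI tendsto_power tendsto_diff elim tendsto_const)
        from lim_imp_Liminf[OF _ this] show ?case by simp
      qed
    qed
    also have "\<dots> \<le> liminf (\<lambda>i. \<integral>\<^sup>+x. ennreal ((z (r i) x - z n x)\<^sup>2) \<partial>lborel)"
      by (rule nn_integral_liminf) measurable
    also have "\<dots> \<le> ennreal e"
    proof (rule Liminf_le)
      show "\<forall>\<^sub>F i in sequentially. (\<integral>\<^sup>+x. ennreal ((z (r i) x - z n x)\<^sup>2) \<partial>lborel) \<le> ennreal e"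
      proof (rule eventually_sequentiallyI[of N])
        fix i assume "N \<le> i"
        then have "N \<le> r i" using seq_suble[OF r, of i] by linarith
        from N[OF this] show "(\<integral>\<^sup>+x. ennreal ((z (r i) x - z n x)\<^sup>2) \<partial>lborel) \<le> ennreal e"
          unfolding L2R_nn[OF L2R_diff[OF z z]] by (intro ennreal_leI) simp
      qed
    qed simp
    finally show ?thesis .
  qed
  have wz: "(\<lambda>x. w x - z n x) \<in> L2R" if "\<And>i. i \<ge> N \<Longrightarrow> (\<integral>x. (z i x - z n x)\<^sup>2 \<partial>lborel) < e" for n N e
  proof (rule L2R_I_nn)
    have "(\<integral>\<^sup>+x. ennreal ((w x - z n x)\<^sup>2) \<partial>lborel) \<le> ennreal e" by (rule fatou[of N]) (rule that)
    then show "(\<integral>\<^sup>+x. ennreal ((w x - z n x)\<^sup>2) \<partial>lborel) < \<infinity>" by (simp add: le_less_trans[OF _ ennreal_less_top])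
  qed measurable
  obtain N1 where "\<And>m n. m \<ge> N1 \<Longrightarrow> n \<ge> N1 \<Longrightarrow> (\<integral>x. (z m x - z n x)\<^sup>2 \<partial>lborel) < 1" using C[of 1] by auto
  then have "(\<lambda>x. w x - z N1 x) \<in> L2R" by (intro wz[of N1 N1 1]) auto
  from L2R_add[OF this z[of N1]] have wL: "w \<in> L2R" by simp
  have "(\<lambda>n. \<integral>x. (w x - z n x)\<^sup>2 \<partial>lborel) \<longlonglongrightarrow> 0"
  proof (rule LIMSEQ_I)
    fix e :: real assume e: "e > 0"
    obtain N where N: "\<And>m n. m \<ge> N \<Longrightarrow> n \<ge> N \<Longrightarrow> (\<integral>x. (z m x - z n x)\<^sup>2 \<partial>lborel) < e/2" using C[of "e/2"] e by auto
    have "norm ((\<integral>x. (w x - z n x)\<^sup>2 \<partial>lborel) - 0) < e" if n: "n \<ge> N" for n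
    proof -
      have "ennreal (\<integral>x. (w x - z n x)\<^sup>2 \<partial>lborel) \<le> ennreal (e/2)"
        using fatou[of N n "e/2"] N n unfolding L2R_nn[OF L2R_diff[OF wL z]] by blast
      then have "(\<integral>x. (w x - z n x)\<^sup>2 \<partial>lborel) \<le> e/2" using e by (subst (asm) ennreal_le_iff) auto
      moreover have "(\<integral>x. (w x - z n x)\<^sup>2 \<partial>lborel) \<ge> 0" by (intro integral_nonneg_AE) auto
      ultimately show ?thesis using e by simp
    qed
    then show "\<exists>no. \<forall>n\<ge>no. norm ((\<integral>x. (w x - z n x)\<^sup>2 \<partial>lborel) - 0) < e" by blast
  qed
  with wL w0 show thesis by (rule that)
qed

text \<open>
  The averages of \<open>V\<close> are fractional integrals of functions \<open>w n\<close>.  The identity \<open>rl_energy\<close>, with positive constant,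
  bounds the norm of \<open>w m - w n\<close> by the energies of the averaging errors, which tend to \<open>0\<close>.  The limit of the
  \<open>w n\<close> on \<open>(0,T)\<close> is the required function; truncation to \<open>(0,T)\<close> is harmless as \<open>J\<^sup>\<sigma>\<close> at \<open>t < T\<close> uses only
  earlier values.
\<close>

theorem finite_energy_imp_rl:
  assumes s: "0 < \<sigma>" "\<sigma> < 1" and V: "integrable lborel V" "V \<in> L2R" and V0: "\<And>t. t \<le> 0 \<Longrightarrow> V t = 0"
    and E: "slob_energy \<sigma> V < \<infinity>" and T: "T > 0"
  obtains w where "w \<in> L2R" "\<And>s. s \<notin> {0<..<T} \<Longrightarrow> w s = 0"
    "AE t in lborel. t \<in> {0<..<T} \<longrightarrow> rl \<sigma> w t = V t"
proof -
  note [measurable] = V(2)[THEN L2R_measurable]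
  let ?c = "log_energy (rld \<sigma>)"
  have c: "?c > 0" by (rule log_energy_rld_pos[OF s])
  define \<delta> :: "nat \<Rightarrow> real" where "\<delta> n = inverse (real (Suc n))" for n
  have d: "\<delta> n > 0" "\<delta> n \<noteq> 0" for n by (auto simp: \<delta>_def)
  have dl: "\<delta> \<longlonglongrightarrow> 0" unfolding \<delta>_def by (rule LIMSEQ_inverse_real_of_nat)
  define w where "w n = avg_deriv \<sigma> V (\<delta> n)" for n
  note wp = rl_avg_deriv[OF s V d(1), folded w_def]
  have wm [measurable]: "w n \<in> borel_measurable borel" for n using wp(2)[of n] by (rule L2R_measurable)
  define ee where "ee n = slob_energy \<sigma> (\<lambda>t. box_avg V (\<delta> n) t - V t)" for n
  have el: "ee \<longlonglongrightarrow> 0" unfolding ee_def by (rule energy_box_avg_tendsto[OF V(2) E d(2) dl])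
  have key: "ennreal (?c * (\<integral>x. (w m x - w n x)\<^sup>2 \<partial>lborel)) \<le> 2 * ee m + 2 * ee n" for m n
  proof -
    have "rl \<sigma> (\<lambda>x. w m x - w n x) = (\<lambda>t. (box_avg V (\<delta> m) t - V t) - (box_avg V (\<delta> n) t - V t))"
    proof
      fix t
      have "rl \<sigma> (\<lambda>x. w m x - w n x) t = rl \<sigma> (w m) t - rl \<sigma> (w n) t"
        unfolding rl_def using wp(4)[of t m] wp(4)[of t n] by (simp add: right_diff_distrib)
      then show "rl \<sigma> (\<lambda>x. w m x - w n x) t = (box_avg V (\<delta> m) t - V t) - (box_avg V (\<delta> n) t - V t)"
        unfolding wp(3) by simp
    qed
    then have "ennreal (?c * (\<integral>x. (w m x - w n x)\<^sup>2 \<partial>lborel)) = slob_energy \<sigma> (\<lambda>t. (box_avg V (\<delta> m) t - V t) - (box_avg V (\<delta> n) t - V t))"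
      using rl_energy[OF s Bochner_Integration.integrable_diff[OF wp(1)[of m] wp(1)[of n]] L2R_diff[OF wp(2)[of m] wp(2)[of n]]] by simp
    also have "\<dots> \<le> 2 * ee m + 2 * ee n"
      unfolding ee_def by (rule energy_diff_le) measurable
    finally show ?thesis .
  qed
  \<comment> \<open>the \<open>w n\<close> do not have bounded support on the right\<close>
  define z where "z n x = indicator {0<..<T} x * w n x" for n x
  have zm [measurable]: "z n \<in> borel_measurable borel" for n unfolding z_def by measurable
  have zL: "z n \<in> L2R" for n
    by (rule L2R_I[OF zm], rule Bochner_Integration.integrable_bound[OF L2R_square[OF wp(2)[of n]]]) (auto simp: z_def indicator_def)
  have zle: "(\<integral>x. (z m x - z n x)\<^sup>2 \<partial>lborel) \<le> (\<integral>x. (w m x - w n x)\<^sup>2 \<partial>lborel)" for m n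
    by (rule integral_mono'[OF L2R_square[OF L2R_diff[OF wp(2) wp(2)]]]) (auto simp: z_def indicator_def)
  have C: "\<exists>N. \<forall>m\<ge>N. \<forall>n\<ge>N. (\<integral>x. (z m x - z n x)\<^sup>2 \<partial>lborel) < e" if e: "e > 0" for e
  proof -
    have "\<forall>\<^sub>F n in sequentially. ee n < ennreal (?c * e / 4)"
      using el by (rule order_tendstoD) (use e c in simp)
    then obtain N where N: "\<And>n. n \<ge> N \<Longrightarrow> ee n < ennreal (?c * e / 4)" by (auto simp: eventually_sequentially)
    have "(\<integral>x. (z m x - z n x)\<^sup>2 \<partial>lborel) < e" if mn: "m \<ge> N" "n \<ge> N" for m n
    proof -
      obtain a where a: "ee m = ennreal a" "0 \<le> a" using N[OF mn(1)] by (cases "ee m") auto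
      obtain b where b: "ee n = ennreal b" "0 \<le> b" using N[OF mn(2)] by (cases "ee n") auto
      have ab: "a < ?c * e / 4" "b < ?c * e / 4"
        using N[OF mn(1)] N[OF mn(2)] a b by (auto simp: ennreal_less_iff)
      have "2 * ee m + 2 * ee n = ennreal (2 * a + 2 * b)" using a b by (simp add: ennreal_mult')
      then have "?c * (\<integral>x. (w m x - w n x)\<^sup>2 \<partial>lborel) \<le> 2 * a + 2 * b"
        using key[of m n] a(2) b(2) by (simp only: ennreal_le_iff)
      then have "?c * (\<integral>x. (w m x - w n x)\<^sup>2 \<partial>lborel) < ?c * e" using ab by linarith
      then show ?thesis using c zle[of m n] by simp
    qed
    then show ?thesis by blast
  qed
  have z0: "z n s = 0" if "s \<notin> {0<..<T}" for n s using that by (simp add: z_def)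
  obtain u where u: "u \<in> L2R" "\<And>s. s \<notin> {0<..<T} \<Longrightarrow> u s = 0" and ul: "(\<lambda>n. \<integral>x. (u x - z n x)\<^sup>2 \<partial>lborel) \<longlonglongrightarrow> 0"
    by (rule L2R_complete_interval[OF zL z0 T C]) (auto intro: that)
  note [measurable] = u(1)[THEN L2R_measurable]
  define k where "k x = rlk \<sigma> x * indicator {..T} x" for x
  have ki: "integrable lborel k" unfolding k_def using rlk_integral_upto(1)[OF s(1), of T] T by simp
  let ?K = "(\<integral>x. \<bar>k x\<bar> \<partial>lborel)\<^sup>2"
  have V0': "w n t = 0" if "t \<le> 0" for n t
    unfolding w_def avg_deriv_def using that d(1)[of n] rl_zero_left[of V, OF V0] by simp
  have zV: "dconv k (z n) 1 t = box_avg V (\<delta> n) t" if "t \<in> {0<..<T}" for n t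
  proof -
    have "dconv k (z n) 1 t = rl \<sigma> (z n) t" unfolding k_def using that z0 by (intro rl_trunc[symmetric]) auto
    also have "\<dots> = rl \<sigma> (w n) t" unfolding z_def using that V0' by (intro rl_restrict) auto
    finally show ?thesis by (simp add: wp(3))
  qed
  have uV: "dconv k u 1 t = rl \<sigma> u t" if "t \<in> {0<..<T}" for t
    unfolding k_def using that u(2) by (intro rl_trunc[symmetric]) auto
  let ?I = "\<integral>\<^sup>+t. ennreal (indicator {0<..<T} t * (rl \<sigma> u t - V t)\<^sup>2) \<partial>lborel"
  define bb where "bb n = (\<integral>\<^sup>+t. ennreal ((box_avg V (\<delta> n) t - V t)\<^sup>2) \<partial>lborel)" for n
  have bl: "bb \<longlonglongrightarrow> 0" unfolding bb_def by (rule box_avg_tendsto[OF V(2) d(2) dl])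
  have bound: "?I \<le> 2 * ennreal (?K * (\<integral>x. (u x - z n x)\<^sup>2 \<partial>lborel)) + 2 * bb n" for n
  proof -
    have uz: "(\<lambda>x. u x - z n x) \<in> L2R" by (rule L2R_diff[OF u(1) zL])
    have lin: "AE t in lborel. dconv k (\<lambda>x. u x - z n x) 1 t = dconv k u 1 t - dconv k (z n) 1 t"
      using dconv_AE_integrable[OF ki u(1), of 1] dconv_AE_integrable[OF ki zL[of n], of 1]
      by eventually_elim (simp add: dconv_def right_diff_distrib)
    have "?I \<le> (\<integral>\<^sup>+t. 2 * ennreal ((dconv k (\<lambda>x. u x - z n x) 1 t)\<^sup>2) + 2 * ennreal ((box_avg V (\<delta> n) t - V t)\<^sup>2) \<partial>lborel)"
    proof (rule nn_integral_mono_AE)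
      show "AE t in lborel. ennreal (indicator {0<..<T} t * (rl \<sigma> u t - V t)\<^sup>2)
         \<le> 2 * ennreal ((dconv k (\<lambda>x. u x - z n x) 1 t)\<^sup>2) + 2 * ennreal ((box_avg V (\<delta> n) t - V t)\<^sup>2)"
        using lin
      proof eventually_elim
        case (elim t)
        show ?case
        proof (cases "t \<in> {0<..<T}")
          case True
          let ?p = "dconv k (\<lambda>x. u x - z n x) 1 t" and ?q = "box_avg V (\<delta> n) t - V t"
          have e: "rl \<sigma> u t - V t = ?p + ?q" using elim zV[OF True, of n] uV[OF True] by simp
          have "(a + b)\<^sup>2 \<le> 2 * a\<^sup>2 + 2 * b\<^sup>2" for a b :: real
            using zero_le_power2[of "a - b"] by (simp add: power2_sum power2_diff)
          then have "(?p + ?q)\<^sup>2 \<le> 2 * ?p\<^sup>2 + 2 * ?q\<^sup>2" .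
          then have "ennreal ((?p + ?q)\<^sup>2) \<le> ennreal (2 * ?p\<^sup>2 + 2 * ?q\<^sup>2)" by (rule ennreal_leI)
          then show ?thesis using True unfolding e by (simp add: ennreal_mult')
        qed simp
      qed
    qed
    also have "\<dots> = 2 * (\<integral>\<^sup>+t. ennreal ((dconv k (\<lambda>x. u x - z n x) 1 t)\<^sup>2) \<partial>lborel) + 2 * bb n"
      unfolding bb_def using ki by (subst nn_integral_add) (auto simp: nn_integral_cmult dest: borel_measurable_integrable)
    also have "(\<integral>\<^sup>+t. ennreal ((dconv k (\<lambda>x. u x - z n x) 1 t)\<^sup>2) \<partial>lborel) \<le> ennreal (?K * (\<integral>x. (u x - z n x)\<^sup>2 \<partial>lborel))"
      unfolding L2R_nn[OF dconv_L2(1)[OF ki uz]] by (rule ennreal_leI[OF dconv_L2_bound[OF ki uz]])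
    finally show ?thesis by (simp add: add_right_mono mult_left_mono)
  qed
  have "(\<lambda>n. 2 * ennreal (?K * (\<integral>x. (u x - z n x)\<^sup>2 \<partial>lborel)) + 2 * bb n) \<longlonglongrightarrow> 2 * ennreal (?K * 0) + 2 * 0"
    by (intro tendsto_add ennreal_tendsto_cmult tendsto_ennrealI tendsto_mult[OF tendsto_const ul] bl) auto
  then have "(\<lambda>n. 2 * ennreal (?K * (\<integral>x. (u x - z n x)\<^sup>2 \<partial>lborel)) + 2 * bb n) \<longlonglongrightarrow> 0" by simp
  then have "?I \<le> 0" by (rule LIMSEQ_le_const) (use bound in auto)
  then have "AE t in lborel. ennreal (indicator {0<..<T} t * (rl \<sigma> u t - V t)\<^sup>2) = 0"
    by (subst (asm) le_zero_eq, subst (asm) nn_integral_0_iff_AE) auto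
  then have "AE t in lborel. t \<in> {0<..<T} \<longrightarrow> rl \<sigma> u t = V t"
    by eventually_elim (auto simp: indicator_def split: if_splits)
  with u show thesis by (rule that)
qed

section \<open>The energy as a double integral\<close>

text \<open>
  The integrand of the squared Slobodeckij seminorm.  Division by zero makes it \<open>0\<close> on the diagonal.
\<close>

definition gagliardo :: "real \<Rightarrow> (real \<Rightarrow> real) \<Rightarrow> real \<Rightarrow> real \<Rightarrow> ennreal" where
  "gagliardo \<sigma> v t s = ennreal ((v t - v s)\<^sup>2 / \<bar>t - s\<bar> powr (1 + 2 * \<sigma>))"

lemma gagliardo_measurable [measurable]:
  assumes [measurable]: "v \<in> borel_measurable borel" "f \<in> borel_measurable M" "g \<in> borel_measurable M"
  shows "(\<lambda>x. gagliardo \<sigma> v (f x) (g x)) \<in> borel_measurable M"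
  unfolding gagliardo_def by measurable

lemma gagliardo_commute: "gagliardo \<sigma> v t s = gagliardo \<sigma> v s t"
  by (simp add: gagliardo_def power2_commute abs_minus_commute)

lemma slob_energy_eq_gagliardo:
  assumes [measurable]: "u \<in> borel_measurable borel"
  shows "slob_energy \<sigma> u = (\<integral>\<^sup>+t. (\<integral>\<^sup>+s. gagliardo \<sigma> u t s * indicator {0<..} (s - t) \<partial>lborel) \<partial>lborel)"
proof -
  have "slob_energy \<sigma> u = (\<integral>\<^sup>+h. (\<integral>\<^sup>+t. gagliardo \<sigma> u t (t + h) * indicator {0<..} h \<partial>lborel) \<partial>lborel)"
    unfolding slob_energy_def
  proof (rule nn_integral_cong)
    fix h :: real
    have "gagliardo \<sigma> u t (t + h) * indicator {0<..} h = ennreal (h powr (-1 - 2 * \<sigma>)) * indicator {0<..} h * ennreal ((u (t + h) - u t)\<^sup>2)" for t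
    proof (cases "h > 0")
      case True
      have "(u t - u (t + h))\<^sup>2 / \<bar>t - (t + h)\<bar> powr (1 + 2 * \<sigma>) = h powr (-1 - 2 * \<sigma>) * (u (t + h) - u t)\<^sup>2"
        using True powr_minus_divide[of h "1 + 2 * \<sigma>"] by (simp add: power2_commute)
      then show ?thesis using True by (simp add: gagliardo_def ennreal_mult)
    qed simp
    then show "ennreal (h powr (-1 - 2 * \<sigma>)) * indicator {0<..} h * (\<integral>\<^sup>+t. ennreal ((u (t + h) - u t)\<^sup>2) \<partial>lborel)
      = (\<integral>\<^sup>+t. gagliardo \<sigma> u t (t + h) * indicator {0<..} h \<partial>lborel)"
      by (simp add: nn_integral_cmult)
  qed
  also have "\<dots> = (\<integral>\<^sup>+t. (\<integral>\<^sup>+h. gagliardo \<sigma> u t (t + h) * indicator {0<..} h \<partial>lborel) \<partial>lborel)"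
    by (rule lborel_pair.Fubini') measurable
  also have "\<dots> = (\<integral>\<^sup>+t. (\<integral>\<^sup>+s. gagliardo \<sigma> u t s * indicator {0<..} (s - t) \<partial>lborel) \<partial>lborel)"
  proof (rule nn_integral_cong)
    fix t :: real
    show "(\<integral>\<^sup>+h. gagliardo \<sigma> u t (t + h) * indicator {0<..} h \<partial>lborel) = (\<integral>\<^sup>+s. gagliardo \<sigma> u t s * indicator {0<..} (s - t) \<partial>lborel)"
      using nn_integral_shift[of "\<lambda>s. gagliardo \<sigma> u t s * indicator {0<..} (s - t)" t] by (simp add: add.commute)
  qed
  finally show ?thesis .
qed

lemma slob_energy_le_gagliardo:
  assumes [measurable]: "u \<in> borel_measurable borel"
  shows "slob_energy \<sigma> u \<le> (\<integral>\<^sup>+t. (\<integral>\<^sup>+s. gagliardo \<sigma> u t s \<partial>lborel) \<partial>lborel)"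
  unfolding slob_energy_eq_gagliardo[OF assms]
  by (intro nn_integral_mono) (auto simp: indicator_def)

lemma gagliardo_le_slob_energy:
  assumes [measurable]: "u \<in> borel_measurable borel"
  shows "(\<integral>\<^sup>+t. (\<integral>\<^sup>+s. gagliardo \<sigma> u t s \<partial>lborel) \<partial>lborel) \<le> 2 * slob_energy \<sigma> u"
proof -
  have "(\<integral>\<^sup>+t. (\<integral>\<^sup>+s. gagliardo \<sigma> u t s \<partial>lborel) \<partial>lborel)
     = (\<integral>\<^sup>+t. (\<integral>\<^sup>+s. gagliardo \<sigma> u t s * indicator {0<..} (s - t) + gagliardo \<sigma> u t s * indicator {0<..} (t - s) \<partial>lborel) \<partial>lborel)"
    by (intro nn_integral_cong) (auto simp: indicator_def gagliardo_def)
  also have "\<dots> = (\<integral>\<^sup>+t. (\<integral>\<^sup>+s. gagliardo \<sigma> u t s * indicator {0<..} (s - t) \<partial>lborel) \<partial>lborel)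
      + (\<integral>\<^sup>+t. (\<integral>\<^sup>+s. gagliardo \<sigma> u t s * indicator {0<..} (t - s) \<partial>lborel) \<partial>lborel)"
    by (simp add: nn_integral_add)
  also have "(\<integral>\<^sup>+t. (\<integral>\<^sup>+s. gagliardo \<sigma> u t s * indicator {0<..} (t - s) \<partial>lborel) \<partial>lborel)
      = (\<integral>\<^sup>+s. (\<integral>\<^sup>+t. gagliardo \<sigma> u t s * indicator {0<..} (t - s) \<partial>lborel) \<partial>lborel)"
    by (rule lborel_pair.Fubini') measurable
  also have "\<dots> = slob_energy \<sigma> u"
    unfolding slob_energy_eq_gagliardo[OF assms] by (simp add: gagliardo_commute)
  finally show ?thesis unfolding slob_energy_eq_gagliardo[OF assms] by (simp only: mult_2)
qed

section \<open>Fractional Hardy inequality\<close>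

lemma ennreal_recursion_bound:
  fixes x :: "nat \<Rightarrow> ennreal"
  assumes "x 0 = 0" "\<And>n. x (Suc n) \<le> ennreal A + ennreal q * x n" "0 \<le> A" "0 \<le> q" "q < 1"
  shows "x n \<le> ennreal (A / (1 - q))"
proof (induction n)
  case (Suc n)
  have "x (Suc n) \<le> ennreal A + ennreal q * ennreal (A / (1 - q))"
    using assms(2)[of n] Suc by (meson add_left_mono mult_left_mono order_trans zero_le)
  also have "\<dots> = ennreal (A + q * (A / (1 - q)))"
  proof -
    have "0 \<le> A / (1 - q)" using assms by simp
    then show ?thesis using assms by (simp add: ennreal_mult[symmetric] del: times_divide_eq_right)
  qed
  also have "A + q * (A / (1 - q)) = A / (1 - q)" using assms(5) by (simp add: field_simps)
  finally show ?case .
qed (use assms in simp)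

lemma nn_integral_fatou_bound:
  assumes [measurable]: "\<And>n. g n \<in> borel_measurable M"
    and l: "\<And>x. x \<in> space M \<Longrightarrow> (\<lambda>n. g n x) \<longlonglongrightarrow> (f x :: ennreal)" and b: "\<And>n. (\<integral>\<^sup>+x. g n x \<partial>M) \<le> K"
  shows "(\<integral>\<^sup>+x. f x \<partial>M) \<le> K"
proof -
  have "(\<integral>\<^sup>+x. f x \<partial>M) = (\<integral>\<^sup>+x. liminf (\<lambda>n. g n x) \<partial>M)"
    by (intro nn_integral_cong lim_imp_Liminf[OF sequentially_bot, symmetric] l)
  also have "\<dots> \<le> liminf (\<lambda>n. \<integral>\<^sup>+x. g n x \<partial>M)" by (rule nn_integral_liminf) measurable
  also have "\<dots> \<le> K" by (rule Liminf_le) (auto intro: always_eventually b)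
  finally show ?thesis .
qed

text \<open>
  Restrict the double integral to \<open>t/4 < s < t/2\<close> and substitute \<open>s = l t\<close>, \<open>ds = t dl\<close>; there \<open>|t - s|\<close> is at most
  \<open>t\<close>.  Since the resulting integral over \<open>l\<close> is finite, so is the integrand for some \<open>l\<close>.
\<close>

lemma exists_good_dilation:
  assumes vm [measurable]: "v \<in> borel_measurable borel"
    and I: "(\<integral>\<^sup>+t. (\<integral>\<^sup>+s. gagliardo \<sigma> v t s * indicator {0<..<T} s * indicator {0<..<T} t \<partial>lborel) \<partial>lborel) < \<infinity>"
    and s0: "\<sigma> > 0"
  obtains l where "1/4 < l" "l < 1/2"
    "(\<integral>\<^sup>+t. ennreal ((v t - v (l * t))\<^sup>2 * t powr (- 2 * \<sigma>)) * indicator {0<..<T} t \<partial>lborel) < \<infinity>"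
proof -
  define \<Phi> where "\<Phi> l = (\<integral>\<^sup>+t. ennreal ((v t - v (l * t))\<^sup>2 * t powr (- 2 * \<sigma>)) * indicator {0<..<T} t \<partial>lborel)" for l
  have [measurable]: "\<Phi> \<in> borel_measurable borel" unfolding \<Phi>_def by measurable
  have "(\<integral>\<^sup>+l. \<Phi> l * indicator {1/4<..<1/2} l \<partial>lborel)
     = (\<integral>\<^sup>+l. (\<integral>\<^sup>+t. ennreal ((v t - v (l * t))\<^sup>2 * t powr (- 2 * \<sigma>)) * indicator {0<..<T} t * indicator {1/4<..<1/2} l \<partial>lborel) \<partial>lborel)"
    unfolding \<Phi>_def by (intro nn_integral_cong nn_integral_multc[symmetric]) measurable
  also have "\<dots> = (\<integral>\<^sup>+t. (\<integral>\<^sup>+l. ennreal ((v t - v (l * t))\<^sup>2 * t powr (- 2 * \<sigma>)) * indicator {0<..<T} t * indicator {1/4<..<1/2} l \<partial>lborel) \<partial>lborel)"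
    by (rule lborel_pair.Fubini') measurable
  also have "\<dots> \<le> (\<integral>\<^sup>+t. (\<integral>\<^sup>+s. gagliardo \<sigma> v t s * indicator {0<..<T} s * indicator {0<..<T} t \<partial>lborel) \<partial>lborel)"
  proof (rule nn_integral_mono)
    fix t :: real
    show "(\<integral>\<^sup>+l. ennreal ((v t - v (l * t))\<^sup>2 * t powr (- 2 * \<sigma>)) * indicator {0<..<T} t * indicator {1/4<..<1/2} l \<partial>lborel)
      \<le> (\<integral>\<^sup>+s. gagliardo \<sigma> v t s * indicator {0<..<T} s * indicator {0<..<T} t \<partial>lborel)"
    proof (cases "t \<in> {0<..<T}")
      case True
      then have t: "0 < t" "t < T" by auto
      have "(\<integral>\<^sup>+l. ennreal ((v t - v (l * t))\<^sup>2 * t powr (- 2 * \<sigma>)) * indicator {0<..<T} t * indicator {1/4<..<1/2} l \<partial>lborel)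
         \<le> (\<integral>\<^sup>+l. ennreal \<bar>t\<bar> * (gagliardo \<sigma> v t (0 + t * l) * indicator {0<..<T} (0 + t * l) * indicator {0<..<T} t) \<partial>lborel)"
      proof (rule nn_integral_mono)
        fix l :: real
        show "ennreal ((v t - v (l * t))\<^sup>2 * t powr (- 2 * \<sigma>)) * indicator {0<..<T} t * indicator {1/4<..<1/2} l
           \<le> ennreal \<bar>t\<bar> * (gagliardo \<sigma> v t (0 + t * l) * indicator {0<..<T} (0 + t * l) * indicator {0<..<T} t)"
        proof (cases "l \<in> {1/4<..<1/2}")
          case l: True
          have a: "0 < t * l" "t * l < t" using t l by auto
          then have b: "0 < \<bar>t - t * l\<bar>" "\<bar>t - t * l\<bar> \<le> t" by auto
          have "\<bar>t - t * l\<bar> powr (1 + 2 * \<sigma>) \<le> t powr (1 + 2 * \<sigma>)" using b s0 by (intro powr_mono2) auto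
          then have "(v t - v (t * l))\<^sup>2 / t powr (1 + 2 * \<sigma>) \<le> (v t - v (t * l))\<^sup>2 / \<bar>t - t * l\<bar> powr (1 + 2 * \<sigma>)"
            using b t by (intro divide_left_mono) auto
          then have "t * ((v t - v (t * l))\<^sup>2 / t powr (1 + 2 * \<sigma>)) \<le> t * ((v t - v (t * l))\<^sup>2 / \<bar>t - t * l\<bar> powr (1 + 2 * \<sigma>))"
            using t by (intro mult_left_mono) auto
          moreover have "t * ((v t - v (t * l))\<^sup>2 / t powr (1 + 2 * \<sigma>)) = (v t - v (l * t))\<^sup>2 * t powr (- 2 * \<sigma>)"
            using t by (simp add: powr_add powr_minus_divide mult.commute)
          ultimately have "ennreal ((v t - v (l * t))\<^sup>2 * t powr (- 2 * \<sigma>)) \<le> ennreal (t * ((v t - v (t * l))\<^sup>2 / \<bar>t - t * l\<bar> powr (1 + 2 * \<sigma>)))"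
            by (intro ennreal_leI) simp
          also have "\<dots> = ennreal \<bar>t\<bar> * gagliardo \<sigma> v t (t * l)" using t by (simp add: gagliardo_def ennreal_mult[symmetric])
          finally show ?thesis using True l a(1) order.strict_trans[OF a(2) t(2)] by simp
        qed simp
      qed
      also have "\<dots> = ennreal \<bar>t\<bar> * (\<integral>\<^sup>+l. gagliardo \<sigma> v t (0 + t * l) * indicator {0<..<T} (0 + t * l) * indicator {0<..<T} t \<partial>lborel)"
        by (rule nn_integral_cmult) measurable
      also have "\<dots> = (\<integral>\<^sup>+s. gagliardo \<sigma> v t s * indicator {0<..<T} s * indicator {0<..<T} t \<partial>lborel)"
        by (rule nn_integral_real_affine[symmetric]) (use t in auto)
      finally show ?thesis .
    qed simp
  qed
  also have "\<dots> < \<infinity>" by (rule I)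
  finally have fin: "(\<integral>\<^sup>+l. \<Phi> l * indicator {1/4<..<1/2} l \<partial>lborel) < \<infinity>" .
  have "\<exists>l. 1/4 < l \<and> l < 1/2 \<and> \<Phi> l < \<infinity>"
  proof (rule ccontr)
    assume neg: "\<not> ?thesis"
    have "\<Phi> l * indicator {1/4<..<1/2} l = \<infinity> * indicator {1/4<..<1/2} l" for l
    proof (cases "1/4 < l \<and> l < 1/2")
      case True
      with neg have "\<not> \<Phi> l < \<infinity>" by blast
      then have "\<Phi> l = \<infinity>" by (simp add: not_less top_unique)
      then show ?thesis by simp
    qed (auto simp: indicator_def)
    then have "(\<integral>\<^sup>+l. \<Phi> l * indicator {1/4<..<1/2} l \<partial>lborel) = \<infinity> * ennreal (1/4)"
      by (simp add: nn_integral_cmult)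
    also have "\<dots> = \<infinity>" by (simp add: ennreal_top_mult)
    finally show False using fin by simp
  qed
  then show thesis using that unfolding \<Phi>_def by blast
qed

lemma sq_add_weighted:
  fixes a b \<eta> :: real
  assumes "\<eta> > 0"
  shows "(a + b)\<^sup>2 \<le> (1 + 1 / \<eta>) * a\<^sup>2 + (1 + \<eta>) * b\<^sup>2"
proof -
  have "0 \<le> (a / sqrt \<eta> - sqrt \<eta> * b)\<^sup>2" by simp
  also have "\<dots> = a\<^sup>2 / \<eta> + \<eta> * b\<^sup>2 - 2 * a * b"
    using assms by (simp add: power2_diff power_divide power_mult_distrib)
  finally show ?thesis by (simp add: power2_sum algebra_simps)
qed

text \<open>
  Let \<open>B n\<close> be the weighted integral over \<open>[l\<^sup>nT, T)\<close>.  The substitution \<open>t \<mapsto> l t\<close> scales the weighted norm by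
  \<open>\<theta> = l\<^sup>1\<^sup>-\<^sup>2\<^sup>\<sigma> < 1\<close>, and replacing \<open>v(l t)\<close> by \<open>v(t)\<close> costs the finite quantity from
  \<open>exists_good_dilation\<close>.  This gives a recursion \<open>B (n + 1) \<le> A + q B n\<close> with \<open>q < 1\<close>, hence a bound uniform in
  \<open>n\<close>.
\<close>

lemma hardy_small:
  assumes vm [measurable]: "v \<in> borel_measurable borel" and T: "T > 0" and s: "0 < \<sigma>" "\<sigma> < 1/2"
    and v2: "(\<integral>\<^sup>+t. ennreal ((v t)\<^sup>2) * indicator {0<..<T} t \<partial>lborel) < \<infinity>"
    and I: "(\<integral>\<^sup>+t. (\<integral>\<^sup>+s. gagliardo \<sigma> v t s * indicator {0<..<T} s * indicator {0<..<T} t \<partial>lborel) \<partial>lborel) < \<infinity>"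
  shows "(\<integral>\<^sup>+t. ennreal ((v t)\<^sup>2 * t powr (- 2 * \<sigma>)) * indicator {0<..<T} t \<partial>lborel) < \<infinity>"
proof -
  obtain l where l: "1/4 < l" "l < 1/2"
    and fin: "(\<integral>\<^sup>+t. ennreal ((v t - v (l * t))\<^sup>2 * t powr (- 2 * \<sigma>)) * indicator {0<..<T} t \<partial>lborel) < \<infinity>" (is "?F < _")
    by (rule exists_good_dilation[OF vm I s(1)])
  obtain f where f: "?F = ennreal f" "0 \<le> f" using fin by (cases ?F) auto
  \<comment> \<open>half-open intervals, so that \<open>B 0\<close> vanishes and the substitution \<open>t \<mapsto> l t\<close> maps them onto each other exactly\<close>
  define B where "B n = (\<integral>\<^sup>+t. ennreal ((v t)\<^sup>2 * t powr (- 2 * \<sigma>)) * indicator {l ^ n * T..<T} t \<partial>lborel)" for n :: nat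
  have B1: "B 1 < \<infinity>"
  proof -
    have "B 1 \<le> (\<integral>\<^sup>+t. ennreal ((l * T) powr (- 2 * \<sigma>)) * (ennreal ((v t)\<^sup>2) * indicator {0<..<T} t) \<partial>lborel)"
      unfolding B_def
    proof (rule nn_integral_mono)
      fix t :: real
      show "ennreal ((v t)\<^sup>2 * t powr (- 2 * \<sigma>)) * indicator {l ^ 1 * T..<T} t \<le> ennreal ((l * T) powr (- 2 * \<sigma>)) * (ennreal ((v t)\<^sup>2) * indicator {0<..<T} t)"
      proof (cases "t \<in> {l ^ 1 * T..<T}")
        case True
        have p: "0 < l * T" using l T by simp
        then have "t powr (- 2 * \<sigma>) \<le> (l * T) powr (- 2 * \<sigma>)" using True s by (intro powr_mono2') auto
        then have "(v t)\<^sup>2 * t powr (- 2 * \<sigma>) \<le> (l * T) powr (- 2 * \<sigma>) * (v t)\<^sup>2" by (subst mult.commute) (rule mult_right_mono, auto)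
        from ennreal_leI[OF this] True p show ?thesis by (simp add: ennreal_mult)
      qed simp
    qed
    also have "\<dots> < \<infinity>" using v2 by (subst nn_integral_cmult) (auto simp: ennreal_mult_less_top)
    finally show ?thesis .
  qed
  then obtain b where b: "B 1 = ennreal b" "0 \<le> b" by (cases "B 1") auto
  define \<theta> where "\<theta> = l powr (1 - 2 * \<sigma>)"
  have th: "0 < \<theta>" "\<theta> < 1"
  proof -
    show "0 < \<theta>" using l by (simp add: \<theta>_def)
    have "l powr (1 - 2 * \<sigma>) < 1 powr (1 - 2 * \<sigma>)" using l s by (intro powr_less_mono2) auto
    then show "\<theta> < 1" by (simp add: \<theta>_def)
  qed
  define \<eta> where "\<eta> = (1 - \<theta>) / (2 * \<theta>)"
  have eta: "\<eta> > 0" using th by (simp add: \<eta>_def)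
  define A where "A = b + \<theta> * (1 + 1/\<eta>) * f"
  define q where "q = \<theta> * (1 + \<eta>)"
  have q: "0 \<le> q" "q < 1" using th eta by (auto simp: q_def \<eta>_def field_simps)
  have A0: "0 \<le> A" unfolding A_def using b f th eta by (intro add_nonneg_nonneg mult_nonneg_nonneg) auto
  have rec: "B (Suc n) \<le> ennreal A + ennreal q * B n" for n
  proof -
    let ?g = "\<lambda>t. ennreal ((v t)\<^sup>2 * t powr (- 2 * \<sigma>))"
    have "B (Suc n) \<le> (\<integral>\<^sup>+t. ?g t * indicator {l ^ 1 * T..<T} t + ?g t * indicator {l ^ Suc n * T..<l * T} t \<partial>lborel)"
      unfolding B_def by (rule nn_integral_mono) (auto simp: indicator_def)
    also have "\<dots> = B 1 + (\<integral>\<^sup>+t. ?g t * indicator {l ^ Suc n * T..<l * T} t \<partial>lborel)"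
      unfolding B_def by (rule nn_integral_add) measurable
    also have "(\<integral>\<^sup>+t. ?g t * indicator {l ^ Suc n * T..<l * T} t \<partial>lborel)
       = ennreal \<bar>l\<bar> * (\<integral>\<^sup>+t. ?g (0 + l * t) * indicator {l ^ Suc n * T..<l * T} (0 + l * t) \<partial>lborel)"
      by (rule nn_integral_real_affine) (use l in auto)
    also have "\<dots> = (\<integral>\<^sup>+t. ennreal \<bar>l\<bar> * (?g (0 + l * t) * indicator {l ^ Suc n * T..<l * T} (0 + l * t)) \<partial>lborel)"
      by (rule nn_integral_cmult[symmetric]) measurable
    also have "\<dots> \<le> (\<integral>\<^sup>+t. ennreal (\<theta> * (1 + 1/\<eta>)) * (ennreal ((v t - v (l * t))\<^sup>2 * t powr (- 2 * \<sigma>)) * indicator {0<..<T} t)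
        + ennreal q * (?g t * indicator {l ^ n * T..<T} t) \<partial>lborel)"
    proof (rule nn_integral_mono)
      fix t :: real
      have ind: "indicator {l ^ Suc n * T..<l * T} (0 + l * t) = (indicator {l ^ n * T..<T} t :: ennreal)"
        using l by (auto simp: indicator_def)
      show "ennreal \<bar>l\<bar> * (?g (0 + l * t) * indicator {l ^ Suc n * T..<l * T} (0 + l * t))
        \<le> ennreal (\<theta> * (1 + 1/\<eta>)) * (ennreal ((v t - v (l * t))\<^sup>2 * t powr (- 2 * \<sigma>)) * indicator {0<..<T} t)
        + ennreal q * (?g t * indicator {l ^ n * T..<T} t)"
      proof (cases "t \<in> {l ^ n * T..<T}")
        case True
        have "0 < l ^ n * T" using l T by simp
        then have t: "0 < t" "t < T" using True by auto
        define p where "p = t powr (- 2 * \<sigma>)"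
        have p0: "p \<ge> 0" by (simp add: p_def)
        have "\<bar>l\<bar> * ((v (l * t))\<^sup>2 * (l * t) powr (- 2 * \<sigma>)) = (l * l powr (- 2 * \<sigma>)) * ((v (l * t))\<^sup>2 * p)"
          using l t by (simp add: powr_mult p_def)
        also have "l * l powr (- 2 * \<sigma>) = \<theta>" using l by (simp add: \<theta>_def powr_mult_base)
        also have "\<theta> * ((v (l * t))\<^sup>2 * p) \<le> \<theta> * (((1 + 1/\<eta>) * (v t - v (l * t))\<^sup>2 + (1 + \<eta>) * (v t)\<^sup>2) * p)"
          using sq_add_weighted[OF eta, of "-(v t - v (l * t))" "v t"] th p0
          by (intro mult_left_mono mult_right_mono) (simp_all add: power2_commute)
        also have "\<dots> = \<theta> * (1 + 1/\<eta>) * ((v t - v (l * t))\<^sup>2 * p) + q * ((v t)\<^sup>2 * p)"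
          by (simp add: q_def algebra_simps)
        finally have "ennreal (\<bar>l\<bar> * ((v (l * t))\<^sup>2 * (l * t) powr (- 2 * \<sigma>))) \<le> ennreal (\<theta> * (1 + 1/\<eta>) * ((v t - v (l * t))\<^sup>2 * p) + q * ((v t)\<^sup>2 * p))"
          by (rule ennreal_leI)
        also have "\<dots> = ennreal (\<theta> * (1 + 1/\<eta>)) * ennreal ((v t - v (l * t))\<^sup>2 * p) + ennreal q * ennreal ((v t)\<^sup>2 * p)"
        proof -
          have "0 \<le> \<theta> * (1 + 1/\<eta>)" using th eta by simp
          then show ?thesis using q p0 by (simp add: ennreal_mult)
        qed
        finally show ?thesis using True t unfolding ind p_def by (simp add: ennreal_mult)
      next
        case False
        then show ?thesis unfolding ind by simp
      qed
    qed
    also have "\<dots> = ennreal (\<theta> * (1 + 1/\<eta>)) * ?F + ennreal q * B n"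
      unfolding B_def by (subst nn_integral_add) (auto simp: nn_integral_cmult)
    finally have "B (Suc n) \<le> ennreal b + (ennreal (\<theta> * (1 + 1/\<eta>)) * ennreal f + ennreal q * B n)"
      unfolding b f by (simp add: add_left_mono)
    also have "\<dots> = ennreal A + ennreal q * B n"
    proof -
      have "0 \<le> \<theta> * (1 + 1/\<eta>)" using th eta by simp
      then show ?thesis unfolding A_def using b f by (simp add: ennreal_mult add.assoc)
    qed
    finally show ?thesis .
  qed
  have B0: "B 0 = 0" by (simp add: B_def)
  have "(\<integral>\<^sup>+t. ennreal ((v t)\<^sup>2 * t powr (- 2 * \<sigma>)) * indicator {0<..<T} t \<partial>lborel) \<le> ennreal (A / (1 - q))"
  proof (rule nn_integral_fatou_bound)
    show "(\<integral>\<^sup>+t. ennreal ((v t)\<^sup>2 * t powr (- 2 * \<sigma>)) * indicator {l ^ n * T..<T} t \<partial>lborel) \<le> ennreal (A / (1 - q))" for n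
      using ennreal_recursion_bound[of B A q n, OF B0 rec A0 q] by (simp add: B_def)
    fix t :: real
    show "(\<lambda>n. ennreal ((v t)\<^sup>2 * t powr (- 2 * \<sigma>)) * indicator {l ^ n * T..<T} t)
       \<longlonglongrightarrow> ennreal ((v t)\<^sup>2 * t powr (- 2 * \<sigma>)) * indicator {0<..<T} t"
    proof (cases "0 < t")
      case True
      have "(\<lambda>n. l ^ n * T) \<longlonglongrightarrow> 0 * T" using l by (intro tendsto_mult LIMSEQ_power_zero tendsto_const) auto
      then have "\<forall>\<^sub>F n in sequentially. l ^ n * T < t" using True by (intro order_tendstoD) auto
      then have "\<forall>\<^sub>F n in sequentially. ennreal ((v t)\<^sup>2 * t powr (- 2 * \<sigma>)) * indicator {l ^ n * T..<T} t
         = ennreal ((v t)\<^sup>2 * t powr (- 2 * \<sigma>)) * indicator {0<..<T} t"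
        by eventually_elim (use True in \<open>auto simp: indicator_def\<close>)
      then show ?thesis by (rule tendsto_eventually)
    next
      case False
      have "0 < l ^ n * T" for n using l T by simp
      then have "t \<notin> {l ^ n * T..<T}" for n using False by (meson atLeastLessThan_iff le_less_trans not_less order.strict_trans1)
      then show ?thesis using False by simp
    qed
  qed measurable
  then show ?thesis by (rule le_less_trans) simp
qed

text \<open>
  For \<open>\<sigma> > 1/2\<close> the scaling factor of \<open>hardy_small\<close> exceeds \<open>1\<close>, so one iterates towards \<open>0\<close> instead: the
  differences \<open>v(t) - v(l\<^sup>n t)\<close> have weighted norms that obey a contracting recursion with factor
  \<open>\<theta> = l\<^sup>2\<^sup>\<sigma>\<^sup>-\<^sup>1\<close>, and \<open>v(l\<^sup>n t)\<close> tends to the boundary value \<open>0\<close>.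
\<close>

lemma hardy_large:
  assumes vm [measurable]: "v \<in> borel_measurable borel" and T: "T > 0" and s: "1/2 < \<sigma>"
    and v0: "(v \<longlongrightarrow> 0) (at_right 0)"
    and I: "(\<integral>\<^sup>+t. (\<integral>\<^sup>+s. gagliardo \<sigma> v t s * indicator {0<..<T} s * indicator {0<..<T} t \<partial>lborel) \<partial>lborel) < \<infinity>"
  shows "(\<integral>\<^sup>+t. ennreal ((v t)\<^sup>2 * t powr (- 2 * \<sigma>)) * indicator {0<..<T} t \<partial>lborel) < \<infinity>"
proof -
  have s0: "\<sigma> > 0" using s by simp
  obtain l where l: "1/4 < l" "l < 1/2"
    and fin: "(\<integral>\<^sup>+t. ennreal ((v t - v (l * t))\<^sup>2 * t powr (- 2 * \<sigma>)) * indicator {0<..<T} t \<partial>lborel) < \<infinity>" (is "?F < _")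
    by (rule exists_good_dilation[OF vm I s0])
  obtain f where f: "?F = ennreal f" "0 \<le> f" using fin by (cases ?F) auto
  define D where "D n t = v t - v (l ^ n * t)" for n t
  have [measurable]: "D n \<in> borel_measurable borel" for n unfolding D_def by measurable
  define B where "B n = (\<integral>\<^sup>+t. ennreal ((D n t)\<^sup>2 * t powr (- 2 * \<sigma>)) * indicator {0<..<T} t \<partial>lborel)" for n :: nat
  define \<theta> where "\<theta> = l powr (2 * \<sigma> - 1)"
  have th: "0 < \<theta>" "\<theta> < 1"
  proof -
    show "0 < \<theta>" using l by (simp add: \<theta>_def)
    have "l powr (2 * \<sigma> - 1) < 1 powr (2 * \<sigma> - 1)" using l s by (intro powr_less_mono2) auto
    then show "\<theta> < 1" by (simp add: \<theta>_def)
  qed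
  define \<eta> where "\<eta> = (1 - \<theta>) / (2 * \<theta>)"
  have eta: "\<eta> > 0" using th by (simp add: \<eta>_def)
  define A where "A = (1 + 1/\<eta>) * f"
  define q where "q = \<theta> * (1 + \<eta>)"
  have q: "0 \<le> q" "q < 1" using th eta by (auto simp: q_def \<eta>_def field_simps)
  have A0: "0 \<le> A" unfolding A_def using f eta by (intro mult_nonneg_nonneg) auto
  have rec: "B (Suc n) \<le> ennreal A + ennreal q * B n" for n
  proof -
    let ?g = "\<lambda>t. ennreal ((D n t)\<^sup>2 * t powr (- 2 * \<sigma>)) * indicator {0<..<T} t"
    have e1: "ennreal \<theta> * (\<integral>\<^sup>+t. ?g t \<partial>lborel) \<ge> (\<integral>\<^sup>+t. ennreal ((D n (l * t))\<^sup>2 * t powr (- 2 * \<sigma>)) * indicator {0<..<T} t \<partial>lborel)"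
    proof -
      have "(\<integral>\<^sup>+t. ennreal ((D n (l * t))\<^sup>2 * t powr (- 2 * \<sigma>)) * indicator {0<..<T} t \<partial>lborel)
         \<le> (\<integral>\<^sup>+t. ennreal (l powr (2 * \<sigma>)) * ?g (0 + l * t) \<partial>lborel)"
      proof (rule nn_integral_mono)
        fix t :: real
        show "ennreal ((D n (l * t))\<^sup>2 * t powr (- 2 * \<sigma>)) * indicator {0<..<T} t \<le> ennreal (l powr (2 * \<sigma>)) * ?g (0 + l * t)"
        proof (cases "t \<in> {0<..<T}")
          case True
          then have t: "0 < t" "t < T" by auto
          have "l * t < t" using l t by simp
          then have "l * t < T" using t(2) by linarith
          then have lt: "0 < l * t" "l * t < T" using t l by auto
          have "l powr (2 * \<sigma>) * (l * t) powr (- 2 * \<sigma>) = t powr (- 2 * \<sigma>)"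
            using l t by (simp add: powr_mult powr_minus_divide)
          then have "l powr (2 * \<sigma>) * ((D n (l * t))\<^sup>2 * (l * t) powr (- 2 * \<sigma>)) = (D n (l * t))\<^sup>2 * t powr (- 2 * \<sigma>)"
            by (metis mult.left_commute)
          then have "ennreal ((D n (l * t))\<^sup>2 * t powr (- 2 * \<sigma>)) = ennreal (l powr (2 * \<sigma>) * ((D n (l * t))\<^sup>2 * (l * t) powr (- 2 * \<sigma>)))"
            by (simp only:)
          also have "\<dots> = ennreal (l powr (2 * \<sigma>)) * ennreal ((D n (l * t))\<^sup>2 * (l * t) powr (- 2 * \<sigma>))"
            by (rule ennreal_mult) auto
          finally have "ennreal ((D n (l * t))\<^sup>2 * t powr (- 2 * \<sigma>)) = ennreal (l powr (2 * \<sigma>)) * ennreal ((D n (l * t))\<^sup>2 * (l * t) powr (- 2 * \<sigma>))" .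
          then show ?thesis using lt by (simp add: indicator_def)
        qed simp
      qed
      also have "\<dots> = ennreal (l powr (2 * \<sigma>)) * (\<integral>\<^sup>+t. ?g (0 + l * t) \<partial>lborel)"
        by (rule nn_integral_cmult) measurable
      also have "\<dots> = ennreal \<theta> * (ennreal \<bar>l\<bar> * (\<integral>\<^sup>+t. ?g (0 + l * t) \<partial>lborel))"
      proof -
        have "\<theta> * l = l powr (2 * \<sigma>)" using l by (simp add: \<theta>_def powr_mult_base mult.commute)
        then have "ennreal (l powr (2 * \<sigma>)) = ennreal \<theta> * ennreal \<bar>l\<bar>" using th l by (simp add: ennreal_mult[symmetric])
        then show ?thesis by (simp add: mult.assoc)
      qed
      also have "ennreal \<bar>l\<bar> * (\<integral>\<^sup>+t. ?g (0 + l * t) \<partial>lborel) = (\<integral>\<^sup>+t. ?g t \<partial>lborel)"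
        by (rule nn_integral_real_affine[symmetric]) (use l in auto)
      finally show ?thesis .
    qed
    have "B (Suc n) \<le> (\<integral>\<^sup>+t. ennreal (1 + 1/\<eta>) * (ennreal ((v t - v (l * t))\<^sup>2 * t powr (- 2 * \<sigma>)) * indicator {0<..<T} t)
        + ennreal (1 + \<eta>) * (ennreal ((D n (l * t))\<^sup>2 * t powr (- 2 * \<sigma>)) * indicator {0<..<T} t) \<partial>lborel)"
      unfolding B_def
    proof (rule nn_integral_mono)
      fix t :: real
      define p where "p = t powr (- 2 * \<sigma>)"
      have p0: "p \<ge> 0" by (simp add: p_def)
      have "D (Suc n) t = (v t - v (l * t)) + D n (l * t)" by (simp add: D_def mult_ac)
      then have "(D (Suc n) t)\<^sup>2 * p \<le> ((1 + 1/\<eta>) * (v t - v (l * t))\<^sup>2 + (1 + \<eta>) * (D n (l * t))\<^sup>2) * p"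
        using sq_add_weighted[OF eta] p0 by (intro mult_right_mono) auto
      also have "\<dots> = (1 + 1/\<eta>) * ((v t - v (l * t))\<^sup>2 * p) + (1 + \<eta>) * ((D n (l * t))\<^sup>2 * p)" by (simp add: algebra_simps)
      finally have "ennreal ((D (Suc n) t)\<^sup>2 * p) \<le> ennreal ((1 + 1/\<eta>) * ((v t - v (l * t))\<^sup>2 * p) + (1 + \<eta>) * ((D n (l * t))\<^sup>2 * p))"
        by (rule ennreal_leI)
      also have "\<dots> = ennreal (1 + 1/\<eta>) * ennreal ((v t - v (l * t))\<^sup>2 * p) + ennreal (1 + \<eta>) * ennreal ((D n (l * t))\<^sup>2 * p)"
      proof -
        have "0 \<le> 1 + 1/\<eta>" "0 \<le> 1 + \<eta>" using eta by auto
        then show ?thesis using p0 by (simp only: ennreal_plus[OF mult_nonneg_nonneg mult_nonneg_nonneg] ennreal_mult zero_le_power2 mult_nonneg_nonneg)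
      qed
      finally show "ennreal ((D (Suc n) t)\<^sup>2 * t powr (- 2 * \<sigma>)) * indicator {0<..<T} t
         \<le> ennreal (1 + 1/\<eta>) * (ennreal ((v t - v (l * t))\<^sup>2 * t powr (- 2 * \<sigma>)) * indicator {0<..<T} t)
        + ennreal (1 + \<eta>) * (ennreal ((D n (l * t))\<^sup>2 * t powr (- 2 * \<sigma>)) * indicator {0<..<T} t)"
        unfolding p_def by (auto simp: indicator_def)
    qed
    also have "\<dots> = ennreal (1 + 1/\<eta>) * ?F + ennreal (1 + \<eta>) * (\<integral>\<^sup>+t. ennreal ((D n (l * t))\<^sup>2 * t powr (- 2 * \<sigma>)) * indicator {0<..<T} t \<partial>lborel)"
      by (subst nn_integral_add) (auto simp: nn_integral_cmult)
    also have "\<dots> \<le> ennreal (1 + 1/\<eta>) * ?F + ennreal (1 + \<eta>) * (ennreal \<theta> * B n)"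
      using e1 unfolding B_def by (intro add_left_mono mult_left_mono) auto
    also have "\<dots> = ennreal A + ennreal q * B n"
    proof -
      have "0 \<le> 1 + 1/\<eta>" "0 \<le> 1 + \<eta>" using eta by auto
      then have "ennreal (1 + 1/\<eta>) * ennreal f = ennreal A" "ennreal (1 + \<eta>) * ennreal \<theta> = ennreal q"
        using f th by (simp_all only: A_def q_def ennreal_mult[symmetric] less_imp_le mult.commute)
      then show ?thesis by (simp only: f mult.assoc[symmetric])
    qed
    finally show ?thesis .
  qed
  have B0: "B 0 = 0" by (simp add: B_def D_def)
  have "(\<integral>\<^sup>+t. ennreal ((v t)\<^sup>2 * t powr (- 2 * \<sigma>)) * indicator {0<..<T} t \<partial>lborel) \<le> ennreal (A / (1 - q))"
  proof (rule nn_integral_fatou_bound)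
    show "(\<integral>\<^sup>+t. ennreal ((D n t)\<^sup>2 * t powr (- 2 * \<sigma>)) * indicator {0<..<T} t \<partial>lborel) \<le> ennreal (A / (1 - q))" for n
      using ennreal_recursion_bound[of B A q n, OF B0 rec A0 q] by (simp add: B_def)
    fix t :: real
    show "(\<lambda>n. ennreal ((D n t)\<^sup>2 * t powr (- 2 * \<sigma>)) * indicator {0<..<T} t)
       \<longlonglongrightarrow> ennreal ((v t)\<^sup>2 * t powr (- 2 * \<sigma>)) * indicator {0<..<T} t"
    proof (cases "0 < t")
      case True
      have "(\<lambda>n. l ^ n * t) \<longlonglongrightarrow> 0 * t" using l by (intro tendsto_mult LIMSEQ_power_zero tendsto_const) auto
      then have "filterlim (\<lambda>n. l ^ n * t) (at_right 0) sequentially"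
        using True l by (intro tendsto_imp_filterlim_at_right) (auto intro!: always_eventually)
      from filterlim_compose[OF v0 this] have "(\<lambda>n. D n t) \<longlonglongrightarrow> v t - 0"
        unfolding D_def by (intro tendsto_diff tendsto_const)
      then have "(\<lambda>n. ennreal ((D n t)\<^sup>2 * t powr (- 2 * \<sigma>))) \<longlonglongrightarrow> ennreal ((v t - 0)\<^sup>2 * t powr (- 2 * \<sigma>))"
        by (intro tendsto_ennrealI tendsto_mult tendsto_power tendsto_const)
      then show ?thesis by (auto simp: indicator_def)
    qed simp
  qed measurable
  then show ?thesis by (rule le_less_trans) simp
qed


section \<open>Extension by zero and reflection\<close>

lemma nn_integral_fold:
  fixes G :: "real \<Rightarrow> ennreal" and T :: real
  assumes [measurable]: "G \<in> borel_measurable borel"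
  shows "(\<integral>\<^sup>+t. G (min t (2 * T - t)) \<partial>lborel) = 2 * (\<integral>\<^sup>+t. G t * indicator {..<T} t \<partial>lborel)"
proof -
  have "(\<integral>\<^sup>+t. G (min t (2 * T - t)) \<partial>lborel)
     = (\<integral>\<^sup>+t. G t * indicator {..<T} t + G (2 * T - t) * indicator {..<T} (2 * T - t) \<partial>lborel)"
  proof (rule nn_integral_cong_AE)
    show "AE t in lborel. G (min t (2 * T - t)) = G t * indicator {..<T} t + G (2 * T - t) * indicator {..<T} (2 * T - t)"
      using AE_lborel_singleton[of T] by eventually_elim (auto simp: indicator_def min_def)
  qed
  also have "\<dots> = (\<integral>\<^sup>+t. G t * indicator {..<T} t \<partial>lborel) + (\<integral>\<^sup>+t. G (2 * T - t) * indicator {..<T} (2 * T - t) \<partial>lborel)"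
    by (rule nn_integral_add) measurable
  also have "(\<integral>\<^sup>+t. G (2 * T - t) * indicator {..<T} (2 * T - t) \<partial>lborel) = (\<integral>\<^sup>+t. G t * indicator {..<T} t \<partial>lborel)"
  proof -
    have m: "(\<lambda>t. G t * indicator {..<T} t) \<in> borel_measurable borel" by measurable
    show ?thesis using nn_integral_real_affine[OF m, of "-1" "2 * T"] by simp
  qed
  finally show ?thesis by (simp only: mult_2)
qed

text \<open>
  The new pairs have exactly one point to the left of \<open>0\<close>.  Integrating over that point produces the Hardy weight.
\<close>

lemma zero_extension_energy:
  assumes vm [measurable]: "v \<in> borel_measurable borel" and v0: "\<And>t. t \<le> 0 \<Longrightarrow> v t = 0" and s: "\<sigma> > 0"
    and I: "(\<integral>\<^sup>+t. (\<integral>\<^sup>+s. gagliardo \<sigma> v t s * indicator {0<..<T} s * indicator {0<..<T} t \<partial>lborel) \<partial>lborel) < \<infinity>"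
    and h: "(\<integral>\<^sup>+t. ennreal ((v t)\<^sup>2 * t powr (- 2 * \<sigma>)) * indicator {0<..<T} t \<partial>lborel) < \<infinity>"
  shows "(\<integral>\<^sup>+t. (\<integral>\<^sup>+s. gagliardo \<sigma> v t s * indicator {..<T} s * indicator {..<T} t \<partial>lborel) \<partial>lborel) < \<infinity>"
proof -
  define c where "c t s = gagliardo \<sigma> v t s * indicator {..0} t * indicator {0<..<T} s" for t s
  have [measurable]: "(\<lambda>x. c (f x) (g x)) \<in> borel_measurable M" if [measurable]: "f \<in> borel_measurable M" "g \<in> borel_measurable M" for f g M
    unfolding c_def by measurable
  have inner: "(\<integral>\<^sup>+t. c t s \<partial>lborel) = ennreal (1 / (2 * \<sigma>)) * (ennreal ((v s)\<^sup>2 * s powr (- 2 * \<sigma>)) * indicator {0<..<T} s)" for s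
  proof (cases "s \<in> {0<..<T}")
    case True
    then have s1: "0 < s" by simp
    have "(\<integral>\<^sup>+t. c t s \<partial>lborel) = ennreal \<bar>-1\<bar> * (\<integral>\<^sup>+h. c (s + -1 * h) s \<partial>lborel)"
      by (rule nn_integral_real_affine) auto
    also have "\<dots> = (\<integral>\<^sup>+h. ennreal ((v s)\<^sup>2) * ennreal (h powr (-1 - 2 * \<sigma>) * indicator {s..} h) \<partial>lborel)"
    proof -
      have "c (s + -1 * h) s = ennreal ((v s)\<^sup>2) * ennreal (h powr (-1 - 2 * \<sigma>) * indicator {s..} h)" for h
      proof (cases "s \<le> h")
        case True
        have "(v (s - h) - v s)\<^sup>2 / \<bar>s - h - s\<bar> powr (1 + 2 * \<sigma>) = (v s)\<^sup>2 * h powr (-1 - 2 * \<sigma>)"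
          using True s1 powr_minus_divide[of h "1 + 2 * \<sigma>"] v0[of "s - h"] by simp
        then show ?thesis using True \<open>s \<in> {0<..<T}\<close> by (simp add: c_def gagliardo_def ennreal_mult)
      qed (simp add: c_def)
      then show ?thesis by simp
    qed
    also have "\<dots> = ennreal ((v s)\<^sup>2) * ennreal (s powr (- 2 * \<sigma>) / (2 * \<sigma>))"
      unfolding powr_tail_nn[OF s s1, symmetric] by (rule nn_integral_cmult) measurable
    also have "\<dots> = ennreal (1 / (2 * \<sigma>)) * ennreal ((v s)\<^sup>2 * s powr (- 2 * \<sigma>))"
      using s by (simp add: ennreal_mult[symmetric] mult_ac)
    finally show ?thesis using True by simp
  qed (simp add: c_def)
  have cint: "(\<integral>\<^sup>+s. (\<integral>\<^sup>+t. c t s \<partial>lborel) \<partial>lborel) < \<infinity>"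
    unfolding inner using h by (subst nn_integral_cmult) (auto simp: ennreal_mult_less_top)
  have cint': "(\<integral>\<^sup>+t. (\<integral>\<^sup>+s. c t s \<partial>lborel) \<partial>lborel) < \<infinity>"
    using cint by (subst lborel_pair.Fubini') auto
  have "(\<integral>\<^sup>+t. (\<integral>\<^sup>+s. gagliardo \<sigma> v t s * indicator {..<T} s * indicator {..<T} t \<partial>lborel) \<partial>lborel)
     \<le> (\<integral>\<^sup>+t. (\<integral>\<^sup>+s. gagliardo \<sigma> v t s * indicator {0<..<T} s * indicator {0<..<T} t + (c t s + c s t) \<partial>lborel) \<partial>lborel)"
  proof (intro nn_integral_mono)
    fix t s :: real
    show "gagliardo \<sigma> v t s * indicator {..<T} s * indicator {..<T} t \<le> gagliardo \<sigma> v t s * indicator {0<..<T} s * indicator {0<..<T} t + (c t s + c s t)"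
    proof (cases "t \<le> 0 \<and> s \<le> 0")
      case True
      then show ?thesis using v0 by (simp add: gagliardo_def)
    next
      case False
      then show ?thesis using gagliardo_commute[of \<sigma> v t s] by (auto simp: c_def indicator_def)
    qed
  qed
  also have "\<dots> = (\<integral>\<^sup>+t. (\<integral>\<^sup>+s. gagliardo \<sigma> v t s * indicator {0<..<T} s * indicator {0<..<T} t \<partial>lborel) \<partial>lborel)
     + ((\<integral>\<^sup>+t. (\<integral>\<^sup>+s. c t s \<partial>lborel) \<partial>lborel) + (\<integral>\<^sup>+t. (\<integral>\<^sup>+s. c s t \<partial>lborel) \<partial>lborel))"
    by (simp add: nn_integral_add)
  also have "\<dots> < \<infinity>" using I cint cint' by (simp add: less_top)
  finally show ?thesis .
qed

text \<open>
  Reflection at \<open>T\<close> is the composition with \<open>t \<mapsto> min t (2T - t)\<close>.  This map does not increase distances, and it covers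
  \<open>(-\<infinity>, T)\<close> twice, so the double integral grows by a factor of at most four.
\<close>

lemma fold_energy:
  assumes vm [measurable]: "v \<in> borel_measurable borel" and s: "\<sigma> > 0"
    and P: "(\<integral>\<^sup>+t. (\<integral>\<^sup>+s. gagliardo \<sigma> v t s * indicator {..<T} s * indicator {..<T} t \<partial>lborel) \<partial>lborel) < \<infinity>"
  shows "slob_energy \<sigma> (\<lambda>t. v (min t (2 * T - t))) < \<infinity>"
proof -
  define \<psi> where "\<psi> t = min t (2 * T - t)" for t :: real
  have [measurable]: "\<psi> \<in> borel_measurable borel" unfolding \<psi>_def by measurable
  have "slob_energy \<sigma> (\<lambda>t. v (\<psi> t)) \<le> (\<integral>\<^sup>+t. (\<integral>\<^sup>+s. gagliardo \<sigma> (\<lambda>t. v (\<psi> t)) t s \<partial>lborel) \<partial>lborel)"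
    by (rule slob_energy_le_gagliardo) measurable
  also have "\<dots> \<le> (\<integral>\<^sup>+t. (\<integral>\<^sup>+s. gagliardo \<sigma> v (\<psi> t) (\<psi> s) \<partial>lborel) \<partial>lborel)"
  proof (intro nn_integral_mono)
    fix t s' :: real
    show "gagliardo \<sigma> (\<lambda>t. v (\<psi> t)) t s' \<le> gagliardo \<sigma> v (\<psi> t) (\<psi> s')"
    proof (cases "\<psi> t = \<psi> s'")
      case False
      have "\<bar>\<psi> t - \<psi> s'\<bar> \<le> \<bar>t - s'\<bar>" by (auto simp: \<psi>_def min_def)
      then have "\<bar>\<psi> t - \<psi> s'\<bar> powr (1 + 2 * \<sigma>) \<le> \<bar>t - s'\<bar> powr (1 + 2 * \<sigma>)" using s by (intro powr_mono2) auto
      moreover have p: "0 < \<bar>\<psi> t - \<psi> s'\<bar> powr (1 + 2 * \<sigma>)" using False by simp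
      moreover have "0 < \<bar>t - s'\<bar> powr (1 + 2 * \<sigma>) * \<bar>\<psi> t - \<psi> s'\<bar> powr (1 + 2 * \<sigma>)"
        using less_le_trans[OF p] calculation by (intro mult_pos_pos) auto
      ultimately show ?thesis unfolding gagliardo_def by (intro ennreal_leI divide_left_mono) auto
    qed (simp add: gagliardo_def)
  qed
  also have "\<dots> = (\<integral>\<^sup>+t. 2 * (\<integral>\<^sup>+s. gagliardo \<sigma> v (\<psi> t) s * indicator {..<T} s \<partial>lborel) \<partial>lborel)"
    unfolding \<psi>_def by (intro nn_integral_cong nn_integral_fold) measurable
  also have "\<dots> = 2 * (\<integral>\<^sup>+t. 2 * (\<integral>\<^sup>+s. gagliardo \<sigma> v t s * indicator {..<T} s \<partial>lborel) * indicator {..<T} t \<partial>lborel)"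
    unfolding \<psi>_def by (rule nn_integral_fold[of "\<lambda>t. 2 * (\<integral>\<^sup>+s. gagliardo \<sigma> v t s * indicator {..<T} s \<partial>lborel)"]) measurable
  also have "\<dots> = 4 * (\<integral>\<^sup>+t. (\<integral>\<^sup>+s. gagliardo \<sigma> v t s * indicator {..<T} s * indicator {..<T} t \<partial>lborel) \<partial>lborel)"
  proof -
    have "2 * (\<integral>\<^sup>+s. gagliardo \<sigma> v t s * indicator {..<T} s \<partial>lborel) * indicator {..<T} t
       = 2 * (\<integral>\<^sup>+s. gagliardo \<sigma> v t s * indicator {..<T} s * indicator {..<T} t \<partial>lborel)" for t
    proof -
      have "(\<integral>\<^sup>+s. gagliardo \<sigma> v t s * indicator {..<T} s * indicator {..<T} t \<partial>lborel)
        = (\<integral>\<^sup>+s. gagliardo \<sigma> v t s * indicator {..<T} s \<partial>lborel) * indicator {..<T} t"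
        by (rule nn_integral_multc) measurable
      then show ?thesis by (simp only: mult.assoc)
    qed
    then show ?thesis by (simp add: nn_integral_cmult mult.assoc[symmetric])
  qed
  also have "\<dots> < \<infinity>" using P by (simp add: ennreal_mult_less_top)
  finally show ?thesis unfolding \<psi>_def .
qed

section \<open>Functions on the interval as functions on the line\<close>

text \<open>
  Elements of \<open>L\<^sup>2(0,T)\<close> as Borel functions on the line that vanish off the interval.  In this form they can be convolved
  and Fubini's theorem applies with respect to \<open>lborel\<close>.
\<close>

definition L2_ext :: "real \<Rightarrow> (real \<Rightarrow> real) set" where
  "L2_ext T = {f \<in> L2R. \<forall>s. s \<notin> {0<..<T} \<longrightarrow> f s = 0}"

lemma L2_extD: "f \<in> L2_ext T \<Longrightarrow> f \<in> L2R" "f \<in> L2_ext T \<Longrightarrow> s \<notin> {0<..<T} \<Longrightarrow> f s = 0"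
  by (auto simp: L2_ext_def)

lemma indicator_L2_ext:
  assumes f: "f \<in> L2R"
  shows "(\<lambda>t. indicator {0<..<T} t * f t) \<in> L2_ext T"
proof -
  note [measurable] = f[THEN L2R_measurable]
  have "(\<lambda>t. indicator {0<..<T} t * f t) \<in> L2R"
  proof (rule L2R_I)
    show "integrable lborel (\<lambda>x. (indicator {0<..<T} x * f x)\<^sup>2)"
      by (rule Bochner_Integration.integrable_bound[OF L2R_square[OF f]]) (auto simp: indicator_def)
  qed measurable
  then show ?thesis by (simp add: L2_ext_def)
qed

lemma L2_ext_integrable:
  assumes f: "f \<in> L2_ext T"
  shows "integrable lborel f"
proof (rule Bochner_Integration.integrable_bound)
  note [measurable] = L2R_measurable[OF L2_extD(1)[OF f]]
  show "integrable lborel (\<lambda>x. (f x)\<^sup>2 + indicator {0<..<T} x)"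
  proof (cases "T > 0")
    case True
    then show ?thesis using L2R_square[OF L2_extD(1)[OF f]] by auto
  next
    case False
    then have "{0<..<T} = {}" by auto
    then show ?thesis using L2R_square[OF L2_extD(1)[OF f]] by simp
  qed
  show "AE x in lborel. norm (f x) \<le> norm ((f x)\<^sup>2 + indicator {0<..<T} x)"
  proof (intro AE_I2)
    fix x :: real
    show "norm (f x) \<le> norm ((f x)\<^sup>2 + indicator {0<..<T} x)"
    proof (cases "x \<in> {0<..<T}")
      case True
      have "0 \<le> (\<bar>f x\<bar> - 1/2)\<^sup>2" by simp
      then have "\<bar>f x\<bar> \<le> (f x)\<^sup>2 + 1" by (simp add: power2_diff) (simp add: power2_eq_square)
      then show ?thesis using True by simp
    qed (simp add: L2_extD(2)[OF f])
  qed
qed (use L2R_measurable[OF L2_extD(1)[OF f]] in auto)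

lemma ae_eq_iff: "ae_eq T u v \<longleftrightarrow> (AE t in lborel. t \<in> {0<..<T} \<longrightarrow> u t = v t)"
  unfolding ae_eq_def by (subst AE_restrict_space_iff) (auto simp: AE_completion_iff)

lemma ae_eq_refl: "ae_eq T u u"
  by (simp add: ae_eq_iff)

lemma ae_eq_sym: "ae_eq T u v \<Longrightarrow> ae_eq T v u"
  by (auto simp: ae_eq_iff elim!: eventually_mono)

lemma ae_eq_trans:
  assumes "ae_eq T u v" "ae_eq T v w" shows "ae_eq T u w"
  using assms unfolding ae_eq_iff by eventually_elim auto

lemma L2_ext_ae_eq:
  assumes f: "f \<in> L2_ext T" and g: "g \<in> L2_ext T"
  shows "ae_eq T f g \<longleftrightarrow> (AE t in lborel. f t = g t)"
proof
  assume "ae_eq T f g"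
  then have "AE t in lborel. t \<in> {0<..<T} \<longrightarrow> f t = g t" by (simp add: ae_eq_iff)
  then show "AE t in lborel. f t = g t"
  proof eventually_elim
    case (elim t)
    then show ?case using L2_extD(2)[OF f, of t] L2_extD(2)[OF g, of t] by (cases "t \<in> {0<..<T}") auto
  qed
qed (auto simp: ae_eq_iff elim!: eventually_mono)

lemma L2_obtain_ext:
  assumes v: "v \<in> L2 T"
  obtains f where "f \<in> L2_ext T" "ae_eq T v f"
proof -
  have vm: "(\<lambda>x. indicator {0<..<T} x *\<^sub>R v x) \<in> borel_measurable lebesgue"
    using v unfolding L2_def by (subst borel_measurable_restrict_space_iff[symmetric]) auto
  have vi: "integrable lebesgue (\<lambda>x. indicator {0<..<T} x *\<^sub>R (v x)\<^sup>2)"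
    using v unfolding L2_def by (subst integrable_restrict_space[symmetric]) auto
  obtain g where gm [measurable]: "g \<in> borel_measurable lborel" and ge: "AE x in lborel. indicator {0<..<T} x *\<^sub>R v x = g x"
    using completion_ex_borel_measurable_real[OF vm] by auto
  define f where "f x = indicator {0<..<T} x * g x" for x
  have fm [measurable]: "f \<in> borel_measurable borel" using gm unfolding f_def by measurable
  have "AE x in lborel. (f x)\<^sup>2 = indicator {0<..<T} x *\<^sub>R (v x)\<^sup>2"
    using ge by eventually_elim (auto simp: f_def indicator_def)
  then have e: "AE x in lebesgue. (f x)\<^sup>2 = indicator {0<..<T} x *\<^sub>R (v x)\<^sup>2" by (rule AE_completion)
  have "integrable lebesgue (\<lambda>x. (f x)\<^sup>2)"
    using vi e by (subst integrable_cong_AE[where g = "\<lambda>x. indicator {0<..<T} x *\<^sub>R (v x)\<^sup>2"])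
      (auto simp: borel_measurable_integrable intro!: measurable_completion)
  then have "integrable lborel (\<lambda>x. (f x)\<^sup>2)" by (subst (asm) integrable_completion) auto
  then have "f \<in> L2R" by (rule L2R_I[OF fm])
  then have "f \<in> L2_ext T" by (simp add: L2_ext_def f_def)
  moreover have "ae_eq T v f"
    unfolding ae_eq_iff using ge by eventually_elim (auto simp: f_def)
  ultimately show thesis by (rule that)
qed

lemma L2_I_ext:
  assumes f: "f \<in> L2_ext T" and e: "ae_eq T v f"
  shows "v \<in> L2 T"
proof -
  note [measurable] = L2R_measurable[OF L2_extD(1)[OF f]]
  have ae: "AE x in lborel. f x = indicator {0<..<T} x *\<^sub>R v x"
    using e L2_extD(2)[OF f] unfolding ae_eq_iff by (auto simp: indicator_def elim!: eventually_mono)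
  have m: "(\<lambda>x. indicator {0<..<T} x *\<^sub>R v x) \<in> borel_measurable lebesgue"
    by (rule borel_measurable_AE[OF _ AE_completion[OF ae]]) (rule measurable_completion, simp)
  have ae2: "AE x in lborel. (f x)\<^sup>2 = indicator {0<..<T} x *\<^sub>R (v x)\<^sup>2"
    using ae by eventually_elim (auto simp: indicator_def)
  have m2: "(\<lambda>x. indicator {0<..<T} x *\<^sub>R (v x)\<^sup>2) \<in> borel_measurable lebesgue"
    by (rule borel_measurable_AE[OF _ AE_completion[OF ae2]]) (rule measurable_completion, simp)
  have "integrable lebesgue (\<lambda>x. (f x)\<^sup>2)"
    using L2R_square[OF L2_extD(1)[OF f]] by (subst integrable_completion) auto
  then have "integrable lebesgue (\<lambda>x. indicator {0<..<T} x *\<^sub>R (v x)\<^sup>2)"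
    using m2 AE_completion[OF ae2] by (subst integrable_cong_AE[where g = "\<lambda>x. (f x)\<^sup>2"])
      (auto intro!: measurable_completion elim!: eventually_mono)
  then show ?thesis
    unfolding L2_def using m by (auto simp: borel_measurable_restrict_space_iff integrable_restrict_space)
qed

lemma L2_ext_subset_L2: "f \<in> L2_ext T \<Longrightarrow> f \<in> L2 T"
  by (rule L2_I_ext[OF _ ae_eq_refl])

lemma L2_pairing_ext:
  assumes f: "f \<in> L2_ext T" and e: "ae_eq T v f" and [measurable]: "\<phi> \<in> borel_measurable borel"
  shows "(LINT t:{0<..<T}|lebesgue. v t * \<phi> t) = (\<integral>t. f t * \<phi> t \<partial>lborel)"
proof -
  note [measurable] = L2R_measurable[OF L2_extD(1)[OF f]]
  have ae: "AE x in lborel. f x * \<phi> x = indicator {0<..<T} x *\<^sub>R (v x * \<phi> x)"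
    using e L2_extD(2)[OF f] unfolding ae_eq_iff by (auto simp: indicator_def elim!: eventually_mono)
  have m: "(\<lambda>x. indicator {0<..<T} x *\<^sub>R (v x * \<phi> x)) \<in> borel_measurable lebesgue"
    by (rule borel_measurable_AE[OF _ AE_completion[OF ae]]) (rule measurable_completion, simp)
  have "(LINT t:{0<..<T}|lebesgue. v t * \<phi> t) = (\<integral>t. f t * \<phi> t \<partial>lebesgue)"
    unfolding set_lebesgue_integral_def using AE_completion[OF ae] m
    by (intro integral_cong_AE) (auto intro!: measurable_completion elim!: eventually_mono)
  also have "\<dots> = (\<integral>t. f t * \<phi> t \<partial>lborel)" by (rule integral_completion) measurable
  finally show ?thesis .
qed

lemma J_ext:
  assumes f: "f \<in> L2_ext T" and e: "ae_eq T v f" and a: "\<alpha> > 0" and t: "t < T"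
  shows "J \<alpha> v t = rl \<alpha> f t"
proof -
  note [measurable] = L2R_measurable[OF L2_extD(1)[OF f]]
  define \<phi> where "\<phi> s = indicator {0<..<t} s * (t - s) powr (\<alpha> - 1)" for s
  have [measurable]: "\<phi> \<in> borel_measurable borel" unfolding \<phi>_def by measurable
  have "(LINT s:{0<..<t}|lebesgue. (t - s) powr (\<alpha> - 1) * v s) = (LINT s:{0<..<T}|lebesgue. v s * \<phi> s)"
    unfolding set_lebesgue_integral_def using t by (intro Bochner_Integration.integral_cong) (auto simp: \<phi>_def indicator_def)
  also have "\<dots> = (\<integral>s. f s * \<phi> s \<partial>lborel)" by (rule L2_pairing_ext[OF f e]) measurable
  also have "1 / Gamma \<alpha> * \<dots> = (\<integral>s. 1 / Gamma \<alpha> * (f s * \<phi> s) \<partial>lborel)" by (rule integral_mult_right_zero[symmetric])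
  also have "\<dots> = rl \<alpha> f t"
    unfolding rl_def
  proof (rule Bochner_Integration.integral_cong[OF refl])
    fix s :: real
    show "1 / Gamma \<alpha> * (f s * \<phi> s) = rlk \<alpha> (t - s) * f s"
      using L2_extD(2)[OF f, of s] by (auto simp: \<phi>_def rlk_def indicator_def)
  qed
  finally show ?thesis using a by (simp add: J_def)
qed

lemma gagliardo_ext:
  assumes f: "f \<in> L2_ext T" and e: "ae_eq T v f"
  shows "(\<integral>\<^sup>+t\<in>{0<..<T}. (\<integral>\<^sup>+s\<in>{0<..<T}. ennreal (\<bar>v t - v s\<bar>\<^sup>2 / \<bar>t - s\<bar> powr (1 + 2 * \<sigma>)) \<partial>lebesgue) \<partial>lebesgue)
     = (\<integral>\<^sup>+t. (\<integral>\<^sup>+s. gagliardo \<sigma> f t s * indicator {0<..<T} s * indicator {0<..<T} t \<partial>lborel) \<partial>lborel)"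
  unfolding nn_integral_completion
proof (rule nn_integral_cong_AE)
  note [measurable] = L2R_measurable[OF L2_extD(1)[OF f]]
  have ae: "AE t in lborel. t \<in> {0<..<T} \<longrightarrow> v t = f t" using e by (simp add: ae_eq_iff)
  then show "AE t in lborel. (\<integral>\<^sup>+s\<in>{0<..<T}. ennreal (\<bar>v t - v s\<bar>\<^sup>2 / \<bar>t - s\<bar> powr (1 + 2 * \<sigma>)) \<partial>lborel) * indicator {0<..<T} t
     = (\<integral>\<^sup>+s. gagliardo \<sigma> f t s * indicator {0<..<T} s * indicator {0<..<T} t \<partial>lborel)"
  proof eventually_elim
    case (elim t)
    have "(\<integral>\<^sup>+s\<in>{0<..<T}. ennreal (\<bar>v t - v s\<bar>\<^sup>2 / \<bar>t - s\<bar> powr (1 + 2 * \<sigma>)) \<partial>lborel)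
        = (\<integral>\<^sup>+s. gagliardo \<sigma> f t s * indicator {0<..<T} s \<partial>lborel)" if "t \<in> {0<..<T}"
    proof (rule nn_integral_cong_AE)
      show "AE s in lborel. ennreal (\<bar>v t - v s\<bar>\<^sup>2 / \<bar>t - s\<bar> powr (1 + 2 * \<sigma>)) * indicator {0<..<T} s = gagliardo \<sigma> f t s * indicator {0<..<T} s"
        using ae by eventually_elim (use elim that in \<open>auto simp: gagliardo_def indicator_def\<close>)
    qed
    then show ?case by (cases "t \<in> {0<..<T}") (auto simp: nn_integral_multc)
  qed
qed

section \<open>Fractional integration on the interval\<close>

text \<open>
  Fractional integration as a map of \<open>L2_ext T\<close> into itself; on \<open>(0,T)\<close> it agrees with \<open>J\<close>.
\<close>

definition Jx :: "real \<Rightarrow> real \<Rightarrow> (real \<Rightarrow> real) \<Rightarrow> real \<Rightarrow> real" where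
  "Jx T \<alpha> f t = (if \<alpha> = 0 then f t else indicator {0<..<T} t * rl \<alpha> f t)"

lemma J_ae_Jx:
  assumes f: "f \<in> L2_ext T" and e: "ae_eq T v f" and a: "\<alpha> \<ge> 0"
  shows "ae_eq T (J \<alpha> v) (Jx T \<alpha> f)"
proof (cases "\<alpha> = 0")
  case True
  then show ?thesis using e by (simp add: J_def Jx_def ae_eq_iff)
next
  case False
  then show ?thesis using J_ext[OF f e, of \<alpha>] a by (auto simp: Jx_def ae_eq_iff)
qed

lemma rlk_trunc_integrable: "\<alpha> > 0 \<Longrightarrow> T > 0 \<Longrightarrow> integrable lborel (\<lambda>x. rlk \<alpha> x * indicator {..T} x)"
  using rlk_integral_upto(1)[of \<alpha> T] by simp

lemma Jx_L2_ext:
  assumes f: "f \<in> L2_ext T" and a: "\<alpha> \<ge> 0" and T: "T > 0"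
  shows "Jx T \<alpha> f \<in> L2_ext T"
proof (cases "\<alpha> = 0")
  case True
  then have "Jx T \<alpha> f = f" by (simp add: Jx_def fun_eq_iff)
  then show ?thesis using f by simp
next
  case False
  then have a: "\<alpha> > 0" using a by simp
  have "Jx T \<alpha> f = (\<lambda>t. indicator {0<..<T} t * dconv (\<lambda>x. rlk \<alpha> x * indicator {..T} x) f 1 t)"
  proof
    fix t
    show "Jx T \<alpha> f t = indicator {0<..<T} t * dconv (\<lambda>x. rlk \<alpha> x * indicator {..T} x) f 1 t"
      using rl_trunc[of T f t \<alpha>] L2_extD(2)[OF f] a by (auto simp: Jx_def indicator_def)
  qed
  then show ?thesis using indicator_L2_ext[OF dconv_L2(1)[OF rlk_trunc_integrable[OF a T] L2_extD(1)[OF f]]] by simp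
qed

lemma rl_AE_integrable_interval:
  assumes f: "f \<in> L2_ext T" and a: "\<alpha> > 0" and T: "T > 0"
  shows "AE t in lborel. t < T \<longrightarrow> integrable lborel (\<lambda>s. rlk \<alpha> (t - s) * f s)"
  using dconv_AE_integrable[OF rlk_trunc_integrable[OF a T] L2_extD(1)[OF f], of 1]
proof eventually_elim
  case (elim t)
  show ?case
  proof
    assume t: "t < T"
    have e: "rlk \<alpha> x * indicator {..T} x * f (t - 1 * x) = rlk \<alpha> x * f (t - x)" for x
      using L2_extD(2)[OF f, of "t - x"] t by (auto simp: indicator_def)
    have "integrable lborel (\<lambda>x. rlk \<alpha> x * f (t - x))" using elim unfolding e .
    from lborel_integrable_real_affine[OF this, of "-1" t]
    show "integrable lborel (\<lambda>s. rlk \<alpha> (t - s) * f s)" by simp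
  qed
qed

lemma Jx_semigroup:
  assumes f: "f \<in> L2_ext T" and a: "\<alpha> \<ge> 0" and b: "\<beta> \<ge> 0" and T: "T > 0"
  shows "AE t in lborel. Jx T \<alpha> (Jx T \<beta> f) t = Jx T (\<alpha> + \<beta>) f t"
proof (cases "\<alpha> = 0 \<or> \<beta> = 0")
  case True
  then show ?thesis
  proof
    assume "\<beta> = 0"
    then have "Jx T \<beta> f = f" by (simp add: Jx_def fun_eq_iff)
    then show ?thesis using \<open>\<beta> = 0\<close> by simp
  qed (simp add: Jx_def)
next
  case False
  then have a: "\<alpha> > 0" and b: "\<beta> > 0" using a b by auto
  have ab: "\<alpha> + \<beta> > 0" using a b by simp
  show ?thesis using rl_AE_integrable_interval[OF f ab T]
  proof eventually_elim
    case (elim t)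
    show ?case
    proof (cases "t \<in> {0<..<T}")
      case True
      have z: "rl \<beta> f s = 0" if "s \<le> 0" for s
        by (rule rl_zero_left[OF _ that]) (use L2_extD(2)[OF f] in auto)
      have "Jx T \<beta> f = (\<lambda>s. indicator {0<..<T} s * rl \<beta> f s)" using b by (simp add: Jx_def fun_eq_iff)
      then have "rl \<alpha> (Jx T \<beta> f) t = rl \<alpha> (rl \<beta> f) t" using rl_restrict[of "rl \<beta> f", OF z, of t T \<alpha>] True by simp
      also have "\<dots> = rl (\<alpha> + \<beta>) f t"
        using elim True by (intro rl_semigroup_at(1)[OF a b L2R_measurable[OF L2_extD(1)[OF f]]]) auto
      finally show ?thesis using a ab by (simp add: Jx_def)
    qed (use a ab in \<open>simp add: Jx_def\<close>)
  qed
qed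

lemma Jx_cong_AE:
  assumes f: "f \<in> L2_ext T" and g: "g \<in> L2_ext T" and e: "AE t in lborel. f t = g t"
  shows "AE t in lborel. Jx T \<alpha> f t = Jx T \<alpha> g t"
proof (cases "\<alpha> = 0")
  case False
  note [measurable] = L2R_measurable[OF L2_extD(1)[OF f]] L2R_measurable[OF L2_extD(1)[OF g]]
  have "rl \<alpha> f t = rl \<alpha> g t" for t
    unfolding rl_def by (rule integral_cong_AE) (use e in \<open>auto elim!: eventually_mono\<close>)
  then show ?thesis using False by (simp add: Jx_def)
qed (use e in \<open>simp add: Jx_def\<close>)

section \<open>Smooth functions\<close>

definition smooth_fun :: "(real \<Rightarrow> real) \<Rightarrow> bool" where
  "smooth_fun f \<longleftrightarrow> (\<forall>n x. (deriv ^^ n) f differentiable at x)"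

text \<open>
  Differentiability of \<open>f\<close> and its first \<open>n\<close> derivatives, arranged as a recursion through \<open>deriv f\<close> so that closure
  properties can be proved by induction on \<open>n\<close>.
\<close>

fun diff_upto :: "nat \<Rightarrow> (real \<Rightarrow> real) \<Rightarrow> bool" where
  "diff_upto 0 f \<longleftrightarrow> (\<forall>x. f differentiable at x)"
| "diff_upto (Suc n) f \<longleftrightarrow> (\<forall>x. f differentiable at x) \<and> diff_upto n (deriv f)"

lemma diff_upto_iff: "diff_upto n f \<longleftrightarrow> (\<forall>k\<le>n. \<forall>x. (deriv ^^ k) f differentiable at x)"
proof (induction n arbitrary: f)
  case (Suc n)
  have "(\<forall>k\<le>Suc n. \<forall>x. (deriv ^^ k) f differentiable at x)
     \<longleftrightarrow> (\<forall>x. f differentiable at x) \<and> (\<forall>k\<le>n. \<forall>x. (deriv ^^ Suc k) f differentiable at x)"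
  proof -
    have "(\<forall>k\<le>Suc n. P k) \<longleftrightarrow> P 0 \<and> (\<forall>k\<le>n. P (Suc k))" for P
      by (metis Suc_le_mono le0 not0_implies_Suc)
    from this[of "\<lambda>k. \<forall>x. (deriv ^^ k) f differentiable at x"] show ?thesis by (simp only: funpow_0)
  qed
  then show ?case using Suc by (simp add: funpow_Suc_right del: funpow.simps)
qed auto

lemma smooth_fun_iff: "smooth_fun f \<longleftrightarrow> (\<forall>n. diff_upto n f)"
  unfolding smooth_fun_def diff_upto_iff by blast

lemma diff_uptoD: "diff_upto n f \<Longrightarrow> f differentiable at x"
  by (cases n) auto

lemma diff_upto_Suc: "diff_upto (Suc n) f \<Longrightarrow> diff_upto n f"
proof (induction n arbitrary: f)
  case (Suc n)
  then show ?case using Suc.IH[of "deriv f"] by auto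
qed auto

lemma deriv_eqI: "(\<And>x. (f has_real_derivative f' x) (at x)) \<Longrightarrow> deriv f = f'"
  by (intro ext DERIV_imp_deriv) auto

lemma differentiable_deriv: "f differentiable at x \<Longrightarrow> (f has_real_derivative deriv f x) (at x)" for f :: "real \<Rightarrow> real"
  using DERIV_deriv_iff_real_differentiable by blast

lemma diff_upto_const: "diff_upto n (\<lambda>x. c)"
proof (induction n arbitrary: c)
  case (Suc n)
  have "deriv (\<lambda>x::real. c) = (\<lambda>x. 0)" by (rule deriv_eqI) simp
  then show ?case using Suc by simp
qed simp

lemma diff_upto_add: "diff_upto n f \<Longrightarrow> diff_upto n g \<Longrightarrow> diff_upto n (\<lambda>x. f x + g x)"
proof (induction n arbitrary: f g)
  case (Suc n)
  have "deriv (\<lambda>x. f x + g x) = (\<lambda>x. deriv f x + deriv g x)"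
    using Suc.prems by (intro deriv_eqI DERIV_add differentiable_deriv) auto
  then show ?case using Suc by simp
qed simp

lemma diff_upto_mult: "diff_upto n f \<Longrightarrow> diff_upto n g \<Longrightarrow> diff_upto n (\<lambda>x. f x * g x)"
proof (induction n arbitrary: f g)
  case (Suc n)
  have "deriv (\<lambda>x. f x * g x) = (\<lambda>x. deriv f x * g x + deriv g x * f x)"
    using Suc.prems by (intro deriv_eqI DERIV_mult differentiable_deriv) auto
  moreover have "diff_upto n (\<lambda>x. deriv f x * g x + deriv g x * f x)"
    using Suc.prems by (intro diff_upto_add Suc.IH diff_upto_Suc[of n f] diff_upto_Suc[of n g]) auto
  ultimately show ?case using Suc.prems by simp
qed simp

lemma diff_upto_affine: "diff_upto n f \<Longrightarrow> diff_upto n (\<lambda>x. f (c * x + d))"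
proof (induction n arbitrary: f)
  case 0
  then show ?case
    by (auto intro!: differentiable_chain_at[of "\<lambda>x. c * x + d" _ f, unfolded o_def] derivative_intros)
next
  case (Suc n)
  have d: "((\<lambda>x. f (c * x + d)) has_real_derivative deriv f (c * x + d) * c) (at x)" for x
    by (rule DERIV_chain'[where f = "\<lambda>x. c * x + d"])
       (use Suc.prems in \<open>auto intro!: derivative_eq_intros differentiable_deriv\<close>)
  have "deriv (\<lambda>x. f (c * x + d)) = (\<lambda>x. deriv f (c * x + d) * c)" by (rule deriv_eqI[OF d])
  moreover have "diff_upto n (\<lambda>x. deriv f (c * x + d) * c)"
    using Suc by (intro diff_upto_mult diff_upto_const) auto
  ultimately show ?case using d by (auto simp: real_differentiable_def)
qed

lemma smooth_fun_mult: "smooth_fun f \<Longrightarrow> smooth_fun g \<Longrightarrow> smooth_fun (\<lambda>x. f x * g x)"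
  by (simp add: smooth_fun_iff diff_upto_mult)

lemma smooth_fun_add: "smooth_fun f \<Longrightarrow> smooth_fun g \<Longrightarrow> smooth_fun (\<lambda>x. f x + g x)"
  by (simp add: smooth_fun_iff diff_upto_add)

lemma smooth_fun_const: "smooth_fun (\<lambda>x. c)"
  by (simp add: smooth_fun_iff diff_upto_const)

lemma smooth_fun_affine: "smooth_fun f \<Longrightarrow> smooth_fun (\<lambda>x. f (c * x + d))"
  by (simp add: smooth_fun_iff diff_upto_affine)

lemma smooth_fun_deriv: "smooth_fun f \<Longrightarrow> smooth_fun (deriv f)"
  unfolding smooth_fun_iff by (metis diff_upto.simps(2))

lemma smooth_fun_has_deriv: "smooth_fun f \<Longrightarrow> (f has_real_derivative deriv f x) (at x)"
  unfolding smooth_fun_iff using diff_uptoD differentiable_deriv by blast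

lemma smooth_fun_antideriv:
  assumes "\<And>x. (F has_real_derivative f x) (at x)" "smooth_fun f"
  shows "smooth_fun F"
proof -
  have d: "deriv F = f" by (rule deriv_eqI[OF assms(1)])
  have dF: "F differentiable at x" for x using assms(1) by (auto simp: real_differentiable_def)
  have "diff_upto n F" for n
    by (cases n) (use assms(2) d dF in \<open>auto simp: smooth_fun_iff\<close>)
  then show ?thesis by (simp add: smooth_fun_iff)
qed

section \<open>Bump functions\<close>

text \<open>
  For \<open>P = 1\<close> the standard smooth function that is flat at \<open>0\<close>.  The polynomial factor in \<open>1/x\<close> makes the family closed under
  differentiation.
\<close>

definition flat_poly :: "real poly \<Rightarrow> real \<Rightarrow> real" where
  "flat_poly P x = (if x > 0 then poly P (1 / x) * exp (- (1 / x)) else 0)"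

lemma poly_exp_tendsto_0: "((\<lambda>y. poly Q y * exp (- y)) \<longlongrightarrow> 0) at_top" for Q :: "real poly"
proof -
  have "((\<lambda>y. \<Sum>i\<le>degree Q. coeff Q i * (y ^ i / exp y)) \<longlongrightarrow> (\<Sum>i\<le>degree Q. coeff Q i * 0)) at_top"
    by (intro tendsto_sum tendsto_mult tendsto_const tendsto_power_div_exp_0)
  moreover have "(\<Sum>i\<le>degree Q. coeff Q i * (y ^ i / exp y)) = poly Q y * exp (- y)" for y
    by (simp add: poly_altdef sum_distrib_right exp_minus divide_inverse mult.assoc)
  ultimately show ?thesis by simp
qed

lemma flat_poly_deriv:
  "(flat_poly P has_real_derivative flat_poly ([:0, 0, 1:] * (P - pderiv P)) x) (at x)"
proof (cases x "0::real" rule: linorder_cases)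
  case greater
  have "((\<lambda>x. poly P (1 / x) * exp (- (1 / x))) has_real_derivative
      (poly (pderiv P) (1 / x) * (- 1 / x\<^sup>2)) * exp (- (1 / x)) + exp (- (1 / x)) * (1 / x\<^sup>2) * poly P (1 / x)) (at x)"
    using greater
    by (auto intro!: derivative_eq_intros DERIV_chain'[OF _ poly_DERIV] simp: power2_eq_square)
  moreover have "(poly (pderiv P) (1 / x) * (- 1 / x\<^sup>2)) * exp (- (1 / x)) + exp (- (1 / x)) * (1 / x\<^sup>2) * poly P (1 / x)
      = flat_poly ([:0, 0, 1:] * (P - pderiv P)) x"
    using greater by (simp add: flat_poly_def power2_eq_square field_simps)
  moreover have "\<forall>\<^sub>F y in nhds x. flat_poly P y = poly P (1 / y) * exp (- (1 / y))"
    using greater by (intro eventually_mono[OF eventually_nhds_in_open[of "{0<..}"]]) (auto simp: flat_poly_def)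
  ultimately show ?thesis by (subst DERIV_cong_ev[OF refl _ refl]) auto
next
  case less
  have "\<forall>\<^sub>F y in nhds x. flat_poly P y = 0"
    using less by (intro eventually_mono[OF eventually_nhds_in_open[of "{..<0}"]]) (auto simp: flat_poly_def)
  then have "(flat_poly P has_real_derivative 0) (at x)" by (subst DERIV_cong_ev[OF refl _ refl]) auto
  then show ?thesis using less by (simp add: flat_poly_def)
next
  case equal
  have l: "((\<lambda>h. (flat_poly P (0 + h) - flat_poly P 0) / h) \<longlongrightarrow> 0) (at_left 0)"
  proof (rule tendsto_eventually)
    show "\<forall>\<^sub>F h in at_left 0. (flat_poly P (0 + h) - flat_poly P 0) / h = 0"
      unfolding eventually_at_filter by (simp add: flat_poly_def)
  qed
  have r: "((\<lambda>h. (flat_poly P (0 + h) - flat_poly P 0) / h) \<longlongrightarrow> 0) (at_right 0)"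
  proof (rule Lim_transform_eventually)
    show "((\<lambda>h. poly (pCons 0 P) (inverse h) * exp (- inverse h)) \<longlongrightarrow> 0) (at_right 0)"
      by (rule filterlim_compose[OF poly_exp_tendsto_0 filterlim_inverse_at_top_right])
    show "\<forall>\<^sub>F h in at_right 0. poly (pCons 0 P) (inverse h) * exp (- inverse h) = (flat_poly P (0 + h) - flat_poly P 0) / h"
      using eventually_at_right_less[of "0::real"] by eventually_elim (simp add: flat_poly_def field_simps)
  qed
  have "((\<lambda>h. (flat_poly P (0 + h) - flat_poly P 0) / h) \<longlongrightarrow> 0) (at 0)"
    by (rule filterlim_split_at[OF l r])
  then have "(flat_poly P has_real_derivative 0) (at 0)" by (simp add: DERIV_def)
  then show ?thesis using equal by (simp add: flat_poly_def)
qed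

lemma smooth_fun_flat_poly: "smooth_fun (flat_poly P)"
proof -
  have "diff_upto n (flat_poly P)" for n
  proof (induction n arbitrary: P)
    case 0
    then show ?case using flat_poly_deriv by (auto simp: real_differentiable_def)
  next
    case (Suc n)
    then show ?case using flat_poly_deriv[of P] deriv_eqI[OF flat_poly_deriv[of P]] by (auto simp: real_differentiable_def)
  qed
  then show ?thesis by (simp add: smooth_fun_iff)
qed

text \<open>
  The factor \<open>Suc n\<close> compresses the two flat ends.  Since \<open>e\<^sup>-\<^sup>1\<^sup>/\<^sup>x\<close> tends to \<open>1\<close> as \<open>x\<close> tends to infinity,
  the bumps converge boundedly to the indicator of \<open>(a, b)\<close>.
\<close>

definition bump :: "real \<Rightarrow> real \<Rightarrow> nat \<Rightarrow> real \<Rightarrow> real" where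
  "bump a b n x = flat_poly 1 (real (Suc n) * (x - a)) * flat_poly 1 (real (Suc n) * (b - x))"

lemma flat_1_bounds: "0 \<le> flat_poly 1 x" "flat_poly 1 x \<le> 1"
  by (auto simp: flat_poly_def)

lemma bump_bounds: "0 \<le> bump a b n x" "bump a b n x \<le> 1"
  using flat_1_bounds[of "real (Suc n) * (x - a)"] flat_1_bounds[of "real (Suc n) * (b - x)"]
  by (auto simp: bump_def intro!: mult_nonneg_nonneg mult_le_one)

lemma bump_zero: "x \<notin> {a<..<b} \<Longrightarrow> bump a b n x = 0"
  by (auto simp: bump_def flat_poly_def zero_less_mult_iff)

lemma bump_pos: "x \<in> {a<..<b} \<Longrightarrow> bump a b n x > 0"
  by (auto simp: bump_def flat_poly_def zero_less_mult_iff)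

lemma smooth_fun_bump: "smooth_fun (bump a b n)"
proof -
  have "smooth_fun (\<lambda>x. flat_poly 1 (real (Suc n) * x + (- real (Suc n) * a)) * flat_poly 1 ((- real (Suc n)) * x + real (Suc n) * b))"
    by (intro smooth_fun_mult smooth_fun_affine smooth_fun_flat_poly)
  moreover have "(\<lambda>x. flat_poly 1 (real (Suc n) * x + (- real (Suc n) * a)) * flat_poly 1 ((- real (Suc n)) * x + real (Suc n) * b)) = bump a b n"
    by (simp add: bump_def fun_eq_iff algebra_simps)
  ultimately show ?thesis by simp
qed

lemma flat_1_tendsto: "y > 0 \<Longrightarrow> (\<lambda>n. flat_poly 1 (real (Suc n) * y)) \<longlonglongrightarrow> 1"
proof -
  assume y: "y > 0"
  have "(\<lambda>n. exp (- (inverse (real (Suc n)) * (1 / y)))) \<longlonglongrightarrow> exp (- (0 * (1 / y)))"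
    by (intro tendsto_intros LIMSEQ_inverse_real_of_nat)
  moreover have "flat_poly 1 (real (Suc n) * y) = exp (- (inverse (real (Suc n)) * (1 / y)))" for n
  proof -
    have "0 < real (Suc n) * y" using y by simp
    then show ?thesis by (simp add: flat_poly_def inverse_eq_divide del: of_nat_Suc)
  qed
  ultimately show ?thesis by simp
qed

lemma bump_tendsto: "(\<lambda>n. bump a b n x) \<longlonglongrightarrow> indicator {a<..<b} x"
proof (cases "x \<in> {a<..<b}")
  case True
  then have "(\<lambda>n. bump a b n x) \<longlonglongrightarrow> 1 * 1"
    unfolding bump_def by (intro tendsto_mult flat_1_tendsto) auto
  then show ?thesis using True by simp
next
  case False
  then show ?thesis by (simp add: bump_zero)
qed

section \<open>Test functions\<close>

lemma test_functions_iff: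
  "\<phi> \<in> test_functions T \<longleftrightarrow> smooth_fun \<phi> \<and> (\<exists>a b. 0 < a \<and> b < T \<and> (\<forall>x. x \<notin> {a..b} \<longrightarrow> \<phi> x = 0))"
  by (simp add: test_functions_def smooth_fun_def)

lemma bump_test: "0 < a \<Longrightarrow> b < T \<Longrightarrow> bump a b n \<in> test_functions T"
proof -
  assume ab: "0 < a" "b < T"
  have "bump a b n x = 0" if "x \<notin> {a..b}" for x using that by (intro bump_zero) auto
  then show ?thesis unfolding test_functions_iff using smooth_fun_bump ab by blast
qed

lemma test_deriv: "\<phi> \<in> test_functions T \<Longrightarrow> deriv \<phi> \<in> test_functions T"
proof -
  assume "\<phi> \<in> test_functions T"
  then obtain a b where s: "smooth_fun \<phi>" and ab: "0 < a" "b < T" and z: "\<And>x. x \<notin> {a..b} \<Longrightarrow> \<phi> x = 0"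
    by (auto simp: test_functions_iff)
  have "deriv \<phi> x = 0" if x: "x \<notin> {a..b}" for x
  proof -
    have "\<forall>\<^sub>F y in nhds x. y \<in> - {a..b}" using x by (intro eventually_nhds_in_open) auto
    then have "\<forall>\<^sub>F y in nhds x. \<phi> y = 0" by eventually_elim (use z in auto)
    then have "(\<phi> has_real_derivative 0) (at x)" by (subst DERIV_cong_ev[OF refl _ refl]) auto
    then show ?thesis by (rule DERIV_imp_deriv)
  qed
  then show ?thesis using s ab smooth_fun_deriv by (auto simp: test_functions_iff)
qed

lemma test_funpow: "\<phi> \<in> test_functions T \<Longrightarrow> (deriv ^^ n) \<phi> \<in> test_functions T"
  by (induction n) (auto intro: test_deriv)

lemma test_isCont: "\<phi> \<in> test_functions T \<Longrightarrow> isCont \<phi> x"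
  using smooth_fun_has_deriv[of \<phi> x] by (auto simp: test_functions_iff intro: DERIV_isCont)

lemma test_measurable: "\<phi> \<in> test_functions T \<Longrightarrow> \<phi> \<in> borel_measurable borel"
  by (intro borel_measurable_continuous_onI continuous_at_imp_continuous_on ballI test_isCont)

lemma test_zero: "\<phi> \<in> test_functions T \<Longrightarrow> x \<notin> {0<..<T} \<Longrightarrow> \<phi> x = 0"
  by (fastforce simp: test_functions_iff)

lemma test_bounded:
  assumes "\<phi> \<in> test_functions T"
  obtains B where "B > 0" "\<And>x. \<bar>\<phi> x\<bar> \<le> B"
proof -
  have "compact (\<phi> ` {0..T})"
    by (intro compact_continuous_image continuous_at_imp_continuous_on ballI test_isCont[OF assms]) auto
  then obtain B where B: "B > 0" "\<And>y. y \<in> \<phi> ` {0..T} \<Longrightarrow> norm y \<le> B"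
    using compact_imp_bounded bounded_pos by metis
  have "\<bar>\<phi> x\<bar> \<le> B" for x
  proof (cases "x \<in> {0..T}")
    case True then show ?thesis using B(2)[of "\<phi> x"] by auto
  next
    case False then show ?thesis using test_zero[OF assms, of x] B(1) by auto
  qed
  then show thesis using B(1) that by blast
qed

lemma test_mult_integrable:
  assumes p: "\<phi> \<in> test_functions T" and f: "integrable lborel f"
  shows "integrable lborel (\<lambda>x. f x * \<phi> x)"
proof -
  obtain B where B: "B > 0" "\<And>x. \<bar>\<phi> x\<bar> \<le> B" using test_bounded[OF p] by auto
  have "norm (f x * \<phi> x) \<le> norm (B * f x)" for x
    using mult_left_mono[OF B(2)[of x], of "\<bar>f x\<bar>"] B(1) by (simp add: abs_mult mult.commute)
  then show ?thesis
    using f test_measurable[OF p] by (intro Bochner_Integration.integrable_bound[OF integrable_mult_right[OF f, of B]]) auto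
qed

lemma test_L2_ext: "\<phi> \<in> test_functions T \<Longrightarrow> T > 0 \<Longrightarrow> \<phi> \<in> L2_ext T"
proof -
  assume p: "\<phi> \<in> test_functions T" and T: "T > 0"
  obtain B where B: "B > 0" "\<And>x. \<bar>\<phi> x\<bar> \<le> B" using test_bounded[OF p] by auto
  have "integrable lborel (\<lambda>x. (\<phi> x)\<^sup>2)"
  proof (rule Bochner_Integration.integrable_bound)
    show "integrable lborel (\<lambda>x. B\<^sup>2 * indicator {0<..<T} x)" using T by (intro integrable_mult_right integrable_real_indicator) auto
    have "norm ((\<phi> x)\<^sup>2) \<le> norm (B\<^sup>2 * indicator {0<..<T} x)" for x
      using power_mono[OF B(2)[of x], of 2] test_zero[OF p, of x] by (cases "x \<in> {0<..<T}") auto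
    then show "AE x in lborel. norm ((\<phi> x)\<^sup>2) \<le> norm (B\<^sup>2 * indicator {0<..<T} x)" by simp
  qed (use test_measurable[OF p] in measurable)
  then show ?thesis using test_measurable[OF p] test_zero[OF p] by (auto simp: L2_ext_def intro: L2R_I)
qed

lemma test_integral_deriv:
  assumes p: "\<phi> \<in> test_functions T" and s: "s \<le> T"
  shows "(\<integral>t. deriv \<phi> t * indicator {s..T} t \<partial>lborel) = - \<phi> s"
proof -
  have "(\<integral>t. deriv \<phi> t * indicator {s..T} t \<partial>lborel) = \<phi> T - \<phi> s"
    by (rule integral_FTC_Icc_real[OF s])
       (use p in \<open>auto simp: test_functions_iff intro!: smooth_fun_has_deriv test_isCont[OF test_deriv[OF p]]\<close>)
  then show ?thesis using test_zero[OF p, of T] by simp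
qed

text \<open>
  The antiderivative that vanishes at \<open>0\<close> is constant on both sides of the support of \<open>\<psi>\<close>; on the right the constant
  is the integral of \<open>\<psi>\<close>.
\<close>

lemma test_antideriv:
  assumes p: "\<psi> \<in> test_functions T" and i: "(\<integral>t. \<psi> t \<partial>lborel) = 0" and T: "T > 0"
  obtains \<phi> where "\<phi> \<in> test_functions T" "deriv \<phi> = \<psi>"
proof -
  obtain a b where s: "smooth_fun \<psi>" and ab: "0 < a" "b < T" and z: "\<And>x. x \<notin> {a..b} \<Longrightarrow> \<psi> x = 0"
    using p by (auto simp: test_functions_iff)
  obtain F where F: "\<And>x. (F has_real_derivative \<psi> x) (at x)"
    using einterval_antiderivative[of "-\<infinity>" "\<infinity>" \<psi>] test_isCont[OF p]
    by (auto simp: has_real_derivative_iff_has_vector_derivative)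
  define \<phi> where "\<phi> x = F x - F 0" for x
  have D: "(\<phi> has_real_derivative \<psi> x) (at x)" for x unfolding \<phi>_def by (auto intro!: derivative_eq_intros F)
  have I: "(\<integral>t. \<psi> t * indicator {x..y} t \<partial>lborel) = \<phi> y - \<phi> x" if "x \<le> y" for x y
    by (rule integral_FTC_Icc_real[OF that D test_isCont[OF p]])
  have zz: "\<phi> x = \<phi> y" if "x \<le> y" "\<And>u. x \<le> u \<Longrightarrow> u \<le> y \<Longrightarrow> \<psi> u = 0" for x y
  proof -
    have "(\<integral>t. \<psi> t * indicator {x..y} t \<partial>lborel) = (\<integral>t. 0 \<partial>(lborel :: real measure))"
      using that(2) by (intro Bochner_Integration.integral_cong) (auto simp: indicator_def)
    then show ?thesis using I[OF that(1)] by simp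
  qed
  have p0: "\<phi> 0 = 0" by (simp add: \<phi>_def)
  have left: "\<phi> x = 0" if "x < a" for x
  proof (cases "x \<le> 0")
    case True
    then show ?thesis using zz[of x 0] z ab p0 by auto
  next
    case False
    then show ?thesis using zz[of 0 x] z that p0 by auto
  qed
  have pT: "\<phi> T = 0"
  proof -
    have "(\<integral>t. \<psi> t * indicator {0..T} t \<partial>lborel) = (\<integral>t. \<psi> t \<partial>lborel)"
    proof (rule Bochner_Integration.integral_cong[OF refl])
      fix t :: real
      show "\<psi> t * indicator {0..T} t = \<psi> t"
        using test_zero[OF p, of t] by (cases "t \<in> {0..T}") auto
    qed
    then show ?thesis using I[of 0 T] T i p0 by simp
  qed
  have right: "\<phi> x = 0" if "x > b" for x
  proof (cases "x \<le> T")
    case True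
    then show ?thesis using zz[of x T] z that pT by auto
  next
    case False
    then show ?thesis using zz[of T x] z ab pT by auto
  qed
  have "smooth_fun \<phi>" by (rule smooth_fun_antideriv[OF D s])
  moreover have "\<phi> x = 0" if "x \<notin> {a..b}" for x
    using left[of x] right[of x] that by (cases "x < a") auto
  ultimately have "\<phi> \<in> test_functions T"
    using ab unfolding test_functions_iff by blast
  then show thesis using that deriv_eqI[OF D] by blast
qed

section \<open>Fundamental lemma of the calculus of variations\<close>

text \<open>
  All one-sided averages of \<open>f\<close> are integrals over intervals and thus vanish, while they converge to \<open>f\<close> in
  \<open>L\<^sup>2\<close>.
\<close>

lemma AE_zero_of_interval_integrals:
  assumes f: "f \<in> L2_ext T"
    and I: "\<And>a b. 0 < a \<Longrightarrow> b < T \<Longrightarrow> (\<integral>x. f x * indicator {a<..<b} x \<partial>lborel) = 0"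
  shows "AE x in lborel. f x = 0"
proof -
  note fi = L2_ext_integrable[OF f] and z = L2_extD(2)[OF f] and f2 = L2_extD(1)[OF f]
  note [measurable] = L2R_measurable[OF f2]
  define d :: "nat \<Rightarrow> real" where "d n = inverse (real (Suc n))" for n
  have d1: "d n > 0" for n by (simp add: d_def)
  have d2: "d \<longlonglongrightarrow> 0" unfolding d_def by (rule LIMSEQ_inverse_real_of_nat)
  note d = d1 d2
  have all: "(\<integral>x. f x * indicator {a<..<b} x \<partial>lborel) = 0" for a b
  proof -
    have "(\<lambda>n. \<integral>x. f x * indicator {max a (d n)<..<min b (T - d n)} x \<partial>lborel) \<longlonglongrightarrow> (\<integral>x. f x * indicator {a<..<b} x \<partial>lborel)"
    proof (rule integral_dominated_convergence[where w = "\<lambda>x. norm (f x)"])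
      show "AE x in lborel. (\<lambda>n. f x * indicator {max a (d n)<..<min b (T - d n)} x) \<longlonglongrightarrow> f x * indicator {a<..<b} x"
      proof (intro AE_I2)
        fix x :: real
        show "(\<lambda>n. f x * indicator {max a (d n)<..<min b (T - d n)} x) \<longlonglongrightarrow> f x * indicator {a<..<b} x"
        proof (cases "x \<in> {0<..<T}")
          case True
          have "\<forall>\<^sub>F n in sequentially. d n < min x (T - x)" using True d(2) by (intro order_tendstoD) auto
          then have "\<forall>\<^sub>F n in sequentially. f x * indicator {max a (d n)<..<min b (T - d n)} x = f x * indicator {a<..<b} x"
            by eventually_elim (auto simp: indicator_def)
          then show ?thesis by (rule tendsto_eventually)
        qed (simp add: z)
      qed
      show "AE x in lborel. norm (f x * indicator {max a (d n)<..<min b (T - d n)} x) \<le> norm (f x)" for n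
        by (intro AE_I2) (simp add: indicator_def)
    qed (use fi in auto)
    moreover have "(\<integral>x. f x * indicator {max a (d n)<..<min b (T - d n)} x \<partial>lborel) = 0" for n
      using d(1)[of n] by (intro I) auto
    ultimately show ?thesis by (simp add: LIMSEQ_const_iff)
  qed
  have avg: "box_avg f (d n) t = 0" for n t
  proof -
    have "0 = (\<integral>x. f x * indicator {t - d n<..<t} x \<partial>lborel)" by (simp only: all)
    also have "\<dots> = \<bar>- d n\<bar> *\<^sub>R (\<integral>x. f (t + - d n * x) * indicator {t - d n<..<t} (t + - d n * x) \<partial>lborel)"
      by (rule lborel_integral_real_affine) (use d(1)[of n] in simp)
    also have "(\<integral>x. f (t + - d n * x) * indicator {t - d n<..<t} (t + - d n * x) \<partial>lborel) = box_avg f (d n) t"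
      unfolding dconv_def
    proof (rule integral_cong_AE)
      show "AE x in lborel. f (t + - d n * x) * indicator {t - d n<..<t} (t + - d n * x) = indicator {0..1} x * f (t - d n * x)"
        using AE_lborel_singleton[of "0::real"] AE_lborel_singleton[of "1::real"]
      proof eventually_elim
        case (elim x)
        have "indicator {t - d n<..<t} (t + - d n * x) = (indicator {0..1} x :: real)"
          using elim d(1)[of n] by (auto simp: indicator_def zero_less_mult_iff)
        then show ?case by (simp add: mult.commute)
      qed
    qed measurable
    finally show ?thesis using d(1)[of n] by simp
  qed
  have "(\<lambda>n. \<integral>\<^sup>+t. ennreal ((box_avg f (d n) t - f t)\<^sup>2) \<partial>lborel) \<longlonglongrightarrow> 0"
    by (rule box_avg_tendsto[OF f2 _ d(2)]) (use d(1) less_irrefl in metis)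
  then have "(\<integral>\<^sup>+t. ennreal ((f t)\<^sup>2) \<partial>lborel) = 0" by (simp add: avg LIMSEQ_const_iff)
  then have "AE t in lborel. ennreal ((f t)\<^sup>2) = 0" by (subst (asm) nn_integral_0_iff_AE) auto
  then show ?thesis by eventually_elim (simp add: ennreal_eq_0_iff)
qed

lemma fundamental_lemma:
  assumes f2: "f \<in> L2_ext T"
    and I: "\<And>\<phi>. \<phi> \<in> test_functions T \<Longrightarrow> (\<integral>x. f x * \<phi> x \<partial>lborel) = 0"
  shows "AE x in lborel. f x = 0"
proof (rule AE_zero_of_interval_integrals[OF f2])
  fix a b :: real assume ab: "0 < a" "b < T"
  note f = L2_ext_integrable[OF f2]
  note [measurable] = borel_measurable_integrable[OF f]
  have "(\<lambda>n. \<integral>x. f x * bump a b n x \<partial>lborel) \<longlonglongrightarrow> (\<integral>x. f x * indicator {a<..<b} x \<partial>lborel)"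
  proof (rule integral_dominated_convergence[where w = "\<lambda>x. norm (f x)"])
    show "AE x in lborel. (\<lambda>n. f x * bump a b n x) \<longlonglongrightarrow> f x * indicator {a<..<b} x"
      by (intro AE_I2 tendsto_mult tendsto_const bump_tendsto)
    show "AE x in lborel. norm (f x * bump a b n x) \<le> norm (f x)" for n
      using bump_bounds[of a b n] by (intro AE_I2) (simp add: abs_mult mult_left_le)
    show "(\<lambda>x. f x * bump a b n x) \<in> borel_measurable lborel" for n
      using borel_measurable_integrable[OF test_mult_integrable[OF bump_test[OF ab] f]] .
  qed (use f in auto)
  then show "(\<integral>x. f x * indicator {a<..<b} x \<partial>lborel) = 0"
    using I[OF bump_test[OF ab]] by (simp add: LIMSEQ_const_iff)
qed

text \<open>
  Fix a test function \<open>\<rho>\<close> with integral \<open>1\<close>.  Every test function \<open>\<psi>\<close> becomes a derivative of a test function once the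
  multiple of \<open>\<rho>\<close> with the same integral is subtracted; hence \<open>f\<close> minus its pairing with \<open>\<rho>\<close> annihilates all
  test functions.
\<close>

lemma du_Bois_Reymond:
  assumes f2: "f \<in> L2_ext T" and T: "T > 0"
    and I: "\<And>\<phi>. \<phi> \<in> test_functions T \<Longrightarrow> (\<integral>x. f x * deriv \<phi> x \<partial>lborel) = 0"
  obtains c where "AE x in lborel. x \<in> {0<..<T} \<longrightarrow> f x = c"
proof -
  note f = L2_ext_integrable[OF f2] and z = L2_extD(2)[OF f2]
  define \<rho>0 where "\<rho>0 = bump (T/4) (T/2) 0"
  have r0: "\<rho>0 \<in> test_functions T" unfolding \<rho>0_def using T by (intro bump_test) auto
  have r0i: "integrable lborel \<rho>0" by (rule L2_ext_integrable[OF test_L2_ext[OF r0 T]])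
  define K where "K = (\<integral>x. \<rho>0 x \<partial>lborel)"
  have K: "K \<noteq> 0"
  proof
    assume "K = 0"
    then have "AE x in lborel. \<rho>0 x = 0"
      using integral_nonneg_eq_0_iff_AE[OF r0i] bump_bounds by (auto simp: K_def \<rho>0_def)
    then have "AE x in lborel. x \<notin> {T/4<..<T/2}"
    proof eventually_elim
      case (elim x)
      then show ?case using bump_pos[of x "T/4" "T/2" 0] unfolding \<rho>0_def by (metis less_irrefl)
    qed
    then have "emeasure lborel {T/4<..<T/2} = 0"
      by (subst (asm) AE_iff_measurable[of "{T/4<..<T/2}"]) auto
    then show False using T by simp
  qed
  define \<rho> where "\<rho> x = \<rho>0 x / K" for x
  have r: "\<rho> \<in> test_functions T"
  proof -
    have "smooth_fun (\<lambda>x. (1 / K) * \<rho>0 x)" using r0 by (intro smooth_fun_mult smooth_fun_const) (auto simp: test_functions_iff)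
    then show ?thesis using r0 by (auto simp: test_functions_iff \<rho>_def[abs_def])
  qed
  have ri: "(\<integral>x. \<rho> x \<partial>lborel) = 1" using K r0i by (simp add: \<rho>_def K_def)
  have rint: "integrable lborel \<rho>" by (rule L2_ext_integrable[OF test_L2_ext[OF r T]])
  define c where "c = (\<integral>x. f x * \<rho> x \<partial>lborel)"
  define g where "g x = f x - c * indicator {0<..<T} x" for x
  have "AE x in lborel. g x = 0"
  proof (rule fundamental_lemma)
    have sq: "(\<lambda>x. (c * indicator {0<..<T} x :: real)\<^sup>2) = (\<lambda>x. c\<^sup>2 * indicator {0<..<T} x)" by (auto simp: indicator_def)
    have "(\<lambda>x. c * indicator {0<..<T} x) \<in> L2R"
      by (rule L2R_I) (use T in \<open>auto simp: sq intro!: integrable_mult_right integrable_real_indicator\<close>)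
    then have "g \<in> L2R" unfolding g_def by (rule L2R_diff[OF L2_extD(1)[OF f2]])
    then show "g \<in> L2_ext T" using z by (auto simp: L2_ext_def g_def)
    fix \<psi> assume p: "\<psi> \<in> test_functions T"
    have pint: "integrable lborel \<psi>" by (rule L2_ext_integrable[OF test_L2_ext[OF p T]])
    define m where "m = (\<integral>x. \<psi> x \<partial>lborel)"
    have q: "(\<lambda>x. \<psi> x + (- m) * \<rho> x) \<in> test_functions T"
    proof -
      have s: "smooth_fun (\<lambda>x. \<psi> x + (- m) * \<rho> x)"
        using p r by (intro smooth_fun_add smooth_fun_mult smooth_fun_const) (auto simp: test_functions_iff)
      obtain a b where ab: "0 < a" "b < T" "\<And>x. x \<notin> {a..b} \<Longrightarrow> \<psi> x = 0" using p by (auto simp: test_functions_iff)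
      obtain a' b' where ab': "0 < a'" "b' < T" "\<And>x. x \<notin> {a'..b'} \<Longrightarrow> \<rho> x = 0" using r by (auto simp: test_functions_iff)
      have "\<psi> x + (- m) * \<rho> x = 0" if "x \<notin> {min a a'..max b b'}" for x
      proof -
        have "x \<notin> {a..b}" "x \<notin> {a'..b'}" using that by auto
        then show ?thesis using ab(3) ab'(3) by simp
      qed
      then show ?thesis using s ab ab' unfolding test_functions_iff
        by (intro conjI exI[of _ "min a a'"] exI[of _ "max b b'"]) auto
    qed
    have "(\<integral>x. \<psi> x + (- m) * \<rho> x \<partial>lborel) = 0"
      using pint rint ri by (simp add: m_def)
    then obtain \<phi> where "\<phi> \<in> test_functions T" "deriv \<phi> = (\<lambda>x. \<psi> x + (- m) * \<rho> x)"
      using test_antideriv[OF q _ T] by blast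
    with I have "(\<integral>x. f x * (\<psi> x + (- m) * \<rho> x) \<partial>lborel) = 0" by metis
    moreover have "f x * (\<psi> x + (- m) * \<rho> x) = f x * \<psi> x - m * (f x * \<rho> x)" for x by (simp add: algebra_simps)
    ultimately have "(\<integral>x. f x * \<psi> x \<partial>lborel) - m * c = 0"
      using test_mult_integrable[OF p f] test_mult_integrable[OF r f] by (simp add: c_def)
    moreover have "(\<integral>x. g x * \<psi> x \<partial>lborel) = (\<integral>x. f x * \<psi> x - c * \<psi> x \<partial>lborel)"
      using test_zero[OF p] by (intro Bochner_Integration.integral_cong) (auto simp: g_def indicator_def algebra_simps)
    ultimately show "(\<integral>x. g x * \<psi> x \<partial>lborel) = 0"
      using test_mult_integrable[OF p f] pint by (simp add: m_def mult.commute)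
  qed
  then have "AE x in lborel. x \<in> {0<..<T} \<longrightarrow> f x = c" by eventually_elim (simp add: g_def)
  then show thesis by (rule that)
qed

section \<open>Weak derivatives and integer orders\<close>

lemma L2_ext_diff:
  assumes f: "f \<in> L2_ext T" and g: "g \<in> L2_ext T"
  shows "(\<lambda>x. f x - g x) \<in> L2_ext T"
  using L2R_diff[OF L2_extD(1)[OF f] L2_extD(1)[OF g]] L2_extD(2)[OF f] L2_extD(2)[OF g] by (simp add: L2_ext_def)

lemma weak_deriv_ext_iff:
  assumes f: "f \<in> L2_ext T" "ae_eq T v f" and g: "g \<in> L2_ext T" "ae_eq T w g"
  shows "weak_deriv T k v w \<longleftrightarrow>
    (\<forall>\<phi>\<in>test_functions T. (\<integral>t. f t * (deriv ^^ k) \<phi> t \<partial>lborel) = (- 1) ^ k * (\<integral>t. g t * \<phi> t \<partial>lborel))"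
proof -
  have "v \<in> L2 T" "w \<in> L2 T" using L2_I_ext f g by auto
  then show ?thesis
    unfolding weak_deriv_def
    by (simp add: L2_pairing_ext[OF f test_measurable[OF test_funpow]] L2_pairing_ext[OF g test_measurable] cong: ball_cong)
qed

lemma rlk_1: "rlk 1 x = indicator {0<..} x"
  by (simp add: rlk_def indicator_def)

text \<open>
  Exchange the order of integration over \<open>s < t\<close>; the integral of \<open>deriv \<phi>\<close> from \<open>s\<close> to the right end is \<open>-\<phi>(s)\<close>.
\<close>

lemma integration_by_parts_Jx:
  assumes f: "f \<in> L2_ext T" and p: "\<phi> \<in> test_functions T" and T: "T > 0"
  shows "(\<integral>t. Jx T 1 f t * deriv \<phi> t \<partial>lborel) = - (\<integral>t. f t * \<phi> t \<partial>lborel)"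
proof -
  note [measurable] = L2R_measurable[OF L2_extD(1)[OF f]] test_measurable[OF test_deriv[OF p]] test_measurable[OF p]
  note fi = L2_ext_integrable[OF f]
  have di: "integrable lborel (deriv \<phi>)" by (rule L2_ext_integrable[OF test_L2_ext[OF test_deriv[OF p] T]])
  define K where "K z = f (fst z) * deriv \<phi> (snd z) * indicator {0<..} (snd z - fst z)" for z
  have Km [measurable]: "K \<in> borel_measurable (lborel \<Otimes>\<^sub>M lborel)" unfolding K_def by measurable
  have Ki: "integrable (lborel \<Otimes>\<^sub>M lborel) K"
    by (rule Bochner_Integration.integrable_bound[OF integrable_tensor(1)[OF fi di]]) (auto simp: K_def indicator_def)
  have e1: "(\<integral>s. K (s, t) \<partial>lborel) = Jx T 1 f t * deriv \<phi> t" for t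
  proof (cases "t \<in> {0<..<T}")
    case True
    have "(\<integral>s. K (s, t) \<partial>lborel) = (\<integral>s. deriv \<phi> t * (indicator {0<..} (t - s) * f s) \<partial>lborel)"
      by (simp add: K_def mult_ac)
    then show ?thesis using True by (simp add: Jx_def rl_def rlk_1)
  next
    case False
    then show ?thesis using test_zero[OF test_deriv[OF p] False] by (simp add: K_def)
  qed
  have e2: "(\<integral>t. K (s, t) \<partial>lborel) = - (f s * \<phi> s)" for s
  proof (cases "s \<in> {0<..<T}")
    case True
    have "(\<integral>t. K (s, t) \<partial>lborel) = (\<integral>t. f s * (deriv \<phi> t * indicator {s..T} t) \<partial>lborel)"
    proof (rule integral_cong_AE)
      show "AE t in lborel. K (s, t) = f s * (deriv \<phi> t * indicator {s..T} t)"
        using AE_lborel_singleton[of s]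
      proof eventually_elim
        case (elim t)
        show ?case using elim test_zero[OF test_deriv[OF p], of t] True
          by (cases "t \<in> {0<..<T}") (auto simp: K_def indicator_def)
      qed
    qed (auto simp: K_def)
    then show ?thesis using test_integral_deriv[OF p, of s] True by simp
  qed (simp add: K_def L2_extD(2)[OF f])
  have "(\<integral>t. Jx T 1 f t * deriv \<phi> t \<partial>lborel) = (\<integral>z. (case z of (t, s) \<Rightarrow> K (s, t)) \<partial>(lborel \<Otimes>\<^sub>M lborel))"
    using lborel_pair.integral_fst'[OF lborel_pair.integrable_product_swap[OF Ki]] by (simp add: e1)
  also have "\<dots> = (\<integral>z. K z \<partial>(lborel \<Otimes>\<^sub>M lborel))" by (rule lborel_pair.integral_product_swap) measurable
  also have "\<dots> = - (\<integral>t. f t * \<phi> t \<partial>lborel)"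
    using lborel_pair.integral_fst'[OF Ki] by (simp add: e2)
  finally show ?thesis .
qed

text \<open>
  For \<open>\<sigma> > 1/2\<close> the kernel is square-integrable near \<open>0\<close>, so continuity of translations in \<open>L\<^sup>2\<close> applies to the
  kernel.
\<close>

lemma rl_isCont:
  assumes f: "f \<in> L2_ext T" and s: "\<sigma> > 1/2"
  shows "isCont (rl \<sigma> f) t"
proof -
  note [measurable] = L2R_measurable[OF L2_extD(1)[OF f]]
  \<comment> \<open>the kernel may be cut off at \<open>R\<close>: near \<open>t\<close> only arguments below \<open>R\<close> occur\<close>
  define R where "R = max T \<bar>t\<bar> + 2"
  have R: "R > 0" by (simp add: R_def)
  have fR: "f x = 0" if "x \<notin> {0<..<R}" for x proof (rule L2_extD(2)[OF f])
    show "x \<notin> {0<..<T}" using that by (auto simp: R_def)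
  qed
  define k where "k x = rlk \<sigma> x * indicator {..R} x" for x
  have km [measurable]: "k \<in> borel_measurable borel" unfolding k_def by measurable
  have k2: "k \<in> L2R"
  proof (rule L2R_I[OF km])
    have "((\<lambda>x. x powr (2 * (\<sigma> - 1))) has_integral (R powr (2 * (\<sigma> - 1) + 1) / (2 * (\<sigma> - 1) + 1))) {0..R}"
      by (rule has_integral_powr_from_0) (use s R in auto)
    from lborel_of_has_integral(1)[OF _ _ this]
    have i: "integrable lborel (\<lambda>x. 1 / (Gamma \<sigma>)\<^sup>2 * (x powr (2 * (\<sigma> - 1)) * indicator {0..R} x))" by simp
    have e: "(k x)\<^sup>2 = 1 / (Gamma \<sigma>)\<^sup>2 * (x powr (2 * (\<sigma> - 1)) * indicator {0..R} x)" for x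
      by (auto simp: k_def rlk_def indicator_def power_divide powr_power mult.commute)
    show "integrable lborel (\<lambda>x. (k x)\<^sup>2)" using i unfolding e .
  qed
  have rep: "rl \<sigma> f t' = (\<integral>s. f s * k (t' - s) \<partial>lborel)" if "t' < R" for t'
    unfolding rl_def
  proof (rule Bochner_Integration.integral_cong[OF refl])
    fix s' :: real
    show "rlk \<sigma> (t' - s') * f s' = f s' * k (t' - s')"
      using fR[of s'] that by (cases "s' \<in> {0<..<R}") (auto simp: k_def indicator_def)
  qed
  have kf: "(\<lambda>s. k (t' - s)) \<in> L2R" for t' using L2R_affine[OF k2, of "-1" t'] by simp
  show ?thesis
    unfolding continuous_at_sequentially
  proof (intro allI impI)
    fix x :: "nat \<Rightarrow> real" assume x: "x \<longlonglongrightarrow> t"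
    then have "(\<lambda>n. x n - t) \<longlonglongrightarrow> 0" using LIM_zero by blast
    note lim = L2R_translation_continuous[OF k2 this]
    let ?F = "sqrt (\<integral>s. (f s)\<^sup>2 \<partial>lborel)"
    have b: "\<bar>(\<integral>s. f s * k (x n - s) \<partial>lborel) - (\<integral>s. f s * k (t - s) \<partial>lborel)\<bar> \<le> ?F * sqrt (\<integral>s. (k (s + (x n - t)) - k s)\<^sup>2 \<partial>lborel)" for n
    proof -
      have "(\<integral>s. f s * k (x n - s) \<partial>lborel) - (\<integral>s. f s * k (t - s) \<partial>lborel) = (\<integral>s. f s * k (x n - s) - f s * k (t - s) \<partial>lborel)"
        by (intro Bochner_Integration.integral_diff[symmetric] L2R_mult_integrable L2_extD(1)[OF f] kf)
      also have "\<dots> = (\<integral>s. f s * (k (x n - s) - k (t - s)) \<partial>lborel)" by (simp add: right_diff_distrib)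
      finally have "\<bar>(\<integral>s. f s * k (x n - s) \<partial>lborel) - (\<integral>s. f s * k (t - s) \<partial>lborel)\<bar> \<le> ?F * sqrt (\<integral>s. (k (x n - s) - k (t - s))\<^sup>2 \<partial>lborel)"
        using L2R_Cauchy_Schwarz[OF L2_extD(1)[OF f] L2R_diff[OF kf kf], of "x n" t] by simp
      also have "(\<integral>s. (k (x n - s) - k (t - s))\<^sup>2 \<partial>lborel) = (\<integral>s. (k (s + (x n - t)) - k s)\<^sup>2 \<partial>lborel)"
        using lborel_integral_real_affine[of "-1" "\<lambda>s. (k (s + (x n - t)) - k s)\<^sup>2" t] by (simp add: algebra_simps)
      finally show ?thesis .
    qed
    have "(\<lambda>n. ?F * sqrt (\<integral>s. (k (s + (x n - t)) - k s)\<^sup>2 \<partial>lborel)) \<longlonglongrightarrow> ?F * sqrt 0"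
      by (intro tendsto_mult tendsto_const tendsto_real_sqrt lim)
    then have "(\<lambda>n. ?F * sqrt (\<integral>s. (k (s + (x n - t)) - k s)\<^sup>2 \<partial>lborel)) \<longlonglongrightarrow> 0" by simp
    then have "(\<lambda>n. \<bar>(\<integral>s. f s * k (x n - s) \<partial>lborel) - (\<integral>s. f s * k (t - s) \<partial>lborel)\<bar>) \<longlonglongrightarrow> 0"
      by (rule tendsto_sandwich[OF _ _ tendsto_const, rotated 2]) (auto intro!: always_eventually b)
    then have l: "(\<lambda>n. \<integral>s. f s * k (x n - s) \<partial>lborel) \<longlonglongrightarrow> (\<integral>s. f s * k (t - s) \<partial>lborel)"
      by (rule LIM_zero_cancel[OF tendsto_rabs_zero_cancel])
    have tR: "t < R" by (simp add: R_def)
    have "\<forall>\<^sub>F n in sequentially. x n < R" using x tR by (rule order_tendstoD)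
    then have "\<forall>\<^sub>F n in sequentially. (\<integral>s. f s * k (x n - s) \<partial>lborel) = (rl \<sigma> f \<circ> x) n"
      by eventually_elim (simp add: rep)
    from Lim_transform_eventually[OF l this] show "(rl \<sigma> f \<circ> x) \<longlonglongrightarrow> rl \<sigma> f t" by (simp add: rep[OF tR] o_def)
  qed
qed

lemma rl_zero_nonpos:
  assumes f: "f \<in> L2_ext T" and t: "t \<le> 0"
  shows "rl \<sigma> f t = 0"
  by (rule rl_zero_left[OF _ t]) (use L2_extD(2)[OF f] in auto)

lemma zero_trace_Jx:
  assumes f: "f \<in> L2_ext T" and s: "\<sigma> > 1/2" and e: "ae_eq T v (Jx T \<sigma> f)"
  shows "zero_trace T v"
  unfolding zero_trace_def
proof (intro exI conjI)
  show "continuous_on {0..T} (rl \<sigma> f)"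
    by (intro continuous_at_imp_continuous_on ballI rl_isCont[OF f s])
  show "ae_eq T v (rl \<sigma> f)"
    using e s unfolding ae_eq_iff by (auto simp: Jx_def elim!: eventually_mono)
  show "rl \<sigma> f 0 = 0" by (rule rl_zero_nonpos[OF f]) simp
qed

lemma continuous_ae_eq_at_0:
  fixes d :: "real \<Rightarrow> real"
  assumes c: "continuous_on {0..T} d" and e: "AE t in lborel. t \<in> {0<..<T} \<longrightarrow> d t = 0" and T: "T > 0"
  shows "d 0 = 0"
proof (rule ccontr)
  assume n: "d 0 \<noteq> 0"
  have "continuous (at 0 within {0..T}) d" using c T by (simp add: continuous_on_eq_continuous_within)
  then obtain \<delta> where d: "\<delta> > 0" "\<And>x. x \<in> {0..T} \<Longrightarrow> dist x 0 < \<delta> \<Longrightarrow> dist (d x) (d 0) < \<bar>d 0\<bar>"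
    using n unfolding continuous_within_eps_delta by (metis zero_less_abs_iff)
  define r where "r = min \<delta> T"
  have r: "r > 0" using d T by (simp add: r_def)
  have nz: "d x \<noteq> 0" if "x \<in> {0<..<r}" for x
    using d(2)[of x] that by (auto simp: r_def dist_real_def)
  have "AE x in lborel. x \<notin> {0<..<r}"
    using e
  proof eventually_elim
    case (elim x)
    then show ?case using nz[of x] by (auto simp: r_def)
  qed
  then have "emeasure lborel {0<..<r} = 0" by (subst (asm) AE_iff_measurable[of "{0<..<r}"]) auto
  then show False using r by simp
qed

text \<open>
  The difference of \<open>g\<close> and the primitive of \<open>h\<close> is a constant by du Bois-Reymond.  Both sides have continuous
  representatives that vanish at \<open>0\<close>, so the constant is \<open>0\<close>.
\<close>

lemma weak_primitive_zero_trace: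
  assumes g: "g \<in> L2_ext T" and h: "h \<in> L2_ext T" and T: "T > 0"
    and w: "\<And>\<phi>. \<phi> \<in> test_functions T \<Longrightarrow> (\<integral>t. g t * deriv \<phi> t \<partial>lborel) = - (\<integral>t. h t * \<phi> t \<partial>lborel)"
    and z: "zero_trace T g"
  shows "ae_eq T g (Jx T 1 h)"
proof -
  have J: "Jx T 1 h \<in> L2_ext T" using Jx_L2_ext[OF h _ T, of 1] by simp
  obtain c where c: "AE x in lborel. x \<in> {0<..<T} \<longrightarrow> g x - Jx T 1 h x = c"
  proof (rule du_Bois_Reymond[OF L2_ext_diff[OF g J] T])
    fix \<phi> assume p: "\<phi> \<in> test_functions T"
    have "(\<integral>x. (g x - Jx T 1 h x) * deriv \<phi> x \<partial>lborel) = (\<integral>x. g x * deriv \<phi> x \<partial>lborel) - (\<integral>x. Jx T 1 h x * deriv \<phi> x \<partial>lborel)"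
      using test_mult_integrable[OF test_deriv[OF p] L2_ext_integrable[OF g]] test_mult_integrable[OF test_deriv[OF p] L2_ext_integrable[OF J]]
      by (simp add: left_diff_distrib)
    then show "(\<integral>x. (g x - Jx T 1 h x) * deriv \<phi> x \<partial>lborel) = 0"
      using w[OF p] integration_by_parts_Jx[OF h p T] by simp
  qed
  obtain u where u: "continuous_on {0..T} u" "ae_eq T g u" "u 0 = 0" using z by (auto simp: zero_trace_def)
  have "u 0 - rl 1 h 0 - c = 0"
  proof (rule continuous_ae_eq_at_0[OF _ _ T])
    show "continuous_on {0..T} (\<lambda>t. u t - rl 1 h t - c)"
      by (intro continuous_intros u(1) continuous_at_imp_continuous_on ballI rl_isCont[OF h]) simp
    show "AE t in lborel. t \<in> {0<..<T} \<longrightarrow> u t - rl 1 h t - c = 0"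
      using c u(2) unfolding ae_eq_iff by eventually_elim (auto simp: Jx_def)
  qed
  then have "c = 0" using u(3) rl_zero_nonpos[OF h, of 0 1] by simp
  then show ?thesis using c unfolding ae_eq_iff by (auto elim!: eventually_mono)
qed

text \<open>
  Each derivative on the test function removes one integration, by the semigroup law and integration by parts.
\<close>

lemma weak_deriv_Jx:
  assumes z: "z \<in> L2_ext T" and T: "T > 0" and e: "ae_eq T v (Jx T \<gamma> z)" and k: "real k \<le> \<gamma>"
  shows "weak_deriv T k v (Jx T (\<gamma> - real k) z)"
proof -
  have g: "Jx T (\<gamma> - real j) z \<in> L2_ext T" if "real j \<le> \<gamma>" for j using Jx_L2_ext[OF z _ T] that by simp
  have "\<phi> \<in> test_functions T \<Longrightarrow> (\<integral>t. Jx T \<gamma> z t * (deriv ^^ k) \<phi> t \<partial>lborel) = (- 1) ^ k * (\<integral>t. Jx T (\<gamma> - real k) z t * \<phi> t \<partial>lborel)" for \<phi>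
    using k
  proof (induction k arbitrary: \<phi>)
    case (Suc k)
    have k: "real k \<le> \<gamma>" "real (Suc k) \<le> \<gamma>" using Suc.prems by auto
    note p = Suc.prems(1)
    have "(\<integral>t. Jx T \<gamma> z t * (deriv ^^ Suc k) \<phi> t \<partial>lborel) = (\<integral>t. Jx T \<gamma> z t * (deriv ^^ k) (deriv \<phi>) t \<partial>lborel)"
      by (simp add: funpow_Suc_right del: funpow.simps)
    also have "\<dots> = (- 1) ^ k * (\<integral>t. Jx T (\<gamma> - real k) z t * deriv \<phi> t \<partial>lborel)"
      by (rule Suc.IH[OF test_deriv[OF p] k(1)])
    also have "(\<integral>t. Jx T (\<gamma> - real k) z t * deriv \<phi> t \<partial>lborel) = (\<integral>t. Jx T 1 (Jx T (\<gamma> - real (Suc k)) z) t * deriv \<phi> t \<partial>lborel)"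
    proof (rule integral_cong_AE)
      have "AE t in lborel. Jx T 1 (Jx T (\<gamma> - real (Suc k)) z) t = Jx T (1 + (\<gamma> - real (Suc k))) z t"
        by (rule Jx_semigroup[OF z _ _ T]) (use k in auto)
      then show "AE t in lborel. Jx T (\<gamma> - real k) z t * deriv \<phi> t = Jx T 1 (Jx T (\<gamma> - real (Suc k)) z) t * deriv \<phi> t"
        by eventually_elim simp
      have J1: "Jx T 1 (Jx T (\<gamma> - real (Suc k)) z) \<in> L2_ext T" using Jx_L2_ext[OF g[OF k(2)] _ T, of 1] by simp
      note [measurable] = L2R_measurable[OF L2_extD(1)[OF g[OF k(1)]]] L2R_measurable[OF L2_extD(1)[OF J1]] test_measurable[OF test_deriv[OF p]]
      show "(\<lambda>t. Jx T (\<gamma> - real k) z t * deriv \<phi> t) \<in> borel_measurable lborel" by measurable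
      show "(\<lambda>t. Jx T 1 (Jx T (\<gamma> - real (Suc k)) z) t * deriv \<phi> t) \<in> borel_measurable lborel" by measurable
    qed
    also have "\<dots> = - (\<integral>t. Jx T (\<gamma> - real (Suc k)) z t * \<phi> t \<partial>lborel)"
      by (rule integration_by_parts_Jx[OF g[OF k(2)] p T])
    finally show ?case by simp
  qed simp
  then show ?thesis
    using weak_deriv_ext_iff[OF _ e g[OF k] ae_eq_refl, of k] g[of 0] k by simp
qed

lemma H_nat_of_Jx:
  assumes z: "z \<in> L2_ext T" and T: "T > 0" and e: "ae_eq T v (Jx T \<gamma> z)" and m: "real m \<le> \<gamma>"
  shows "v \<in> H_nat T m"
proof -
  have w: "weak_deriv T k v (Jx T (\<gamma> - real k) z)" if "k \<le> m" for k
    by (rule weak_deriv_Jx[OF z T e]) (use that m in linarith)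
  have "v \<in> L2 T" using w[of 0] by (simp add: weak_deriv_def)
  then have S: "v \<in> Sobolev T m" unfolding Sobolev_def using w by blast
  have "zero_trace T (Jx T (\<gamma> - real k) z)" if "k < m" for k
    by (rule zero_trace_Jx[OF z _ ae_eq_refl]) (use that m in linarith)
  then have "\<exists>w. weak_deriv T k v w \<and> zero_trace T w" if "k < m" for k
    using that w[of k] by (intro exI[of _ "Jx T (\<gamma> - real k) z"]) simp
  with S show ?thesis unfolding H_nat_def by blast
qed

lemma zero_trace_cong: "zero_trace T v \<Longrightarrow> ae_eq T v u \<Longrightarrow> zero_trace T u"
  unfolding zero_trace_def by (meson ae_eq_sym ae_eq_trans)

lemma ae_eq_Jx:
  assumes "f \<in> L2_ext T" "g \<in> L2_ext T" "ae_eq T f g"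
  shows "ae_eq T (Jx T \<alpha> f) (Jx T \<alpha> g)"
proof -
  have "AE t in lborel. f t = g t" using assms(3) unfolding L2_ext_ae_eq[OF assms(1,2)] .
  from Jx_cong_AE[OF assms(1,2) this, of \<alpha>] show ?thesis unfolding ae_eq_iff by eventually_elim simp
qed

lemma ae_eq_Jx_semigroup:
  assumes "f \<in> L2_ext T" "\<alpha> \<ge> 0" "\<beta> \<ge> 0" "T > 0"
  shows "ae_eq T (Jx T \<alpha> (Jx T \<beta> f)) (Jx T (\<alpha> + \<beta>) f)"
  using Jx_semigroup[OF assms] unfolding ae_eq_iff by (auto elim!: eventually_mono)

text \<open>
  Induction over the order of the weak derivative: the derivative of order \<open>k\<close> has zero trace, hence is the primitive of
  the one of order \<open>k + 1\<close>.
\<close>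

lemma H_nat_imp_Jx:
  assumes v: "v \<in> H_nat T m" and T: "T > 0" and w: "weak_deriv T k v w" and k: "k \<le> m"
    and g: "g \<in> L2_ext T" "ae_eq T w g"
  shows "ae_eq T v (Jx T (real k) g)"
  using w k g
proof (induction k arbitrary: w g)
  case 0
  have "v \<in> L2 T" using 0 by (simp add: weak_deriv_def)
  then obtain f where f: "f \<in> L2_ext T" "ae_eq T v f" by (rule L2_obtain_ext)
  have eq: "\<forall>\<phi>\<in>test_functions T. (\<integral>t. f t * \<phi> t \<partial>lborel) = (\<integral>t. g t * \<phi> t \<partial>lborel)"
    using 0(1) weak_deriv_ext_iff[OF f 0(3,4), of 0] by simp
  have "AE x in lborel. f x - g x = 0"
  proof (rule fundamental_lemma[OF L2_ext_diff[OF f(1) 0(3)]])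
    fix \<phi> assume p: "\<phi> \<in> test_functions T"
    show "(\<integral>x. (f x - g x) * \<phi> x \<partial>lborel) = 0"
      using eq p test_mult_integrable[OF p L2_ext_integrable[OF f(1)]] test_mult_integrable[OF p L2_ext_integrable[OF 0(3)]]
      by (simp add: left_diff_distrib)
  qed
  then have "ae_eq T f g" unfolding ae_eq_iff by (auto elim!: eventually_mono)
  then have "ae_eq T v g" by (rule ae_eq_trans[OF f(2)])
  then show ?case by (simp add: Jx_def ae_eq_iff)
next
  case (Suc k)
  then have "k < m" by simp
  then obtain u where u: "weak_deriv T k v u" "zero_trace T u" using v by (auto simp: H_nat_def)
  have "u \<in> L2 T" "v \<in> L2 T" using u(1) by (auto simp: weak_deriv_def)
  then obtain h f where h: "h \<in> L2_ext T" "ae_eq T u h" and f: "f \<in> L2_ext T" "ae_eq T v f" by (meson L2_obtain_ext)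
  have vh: "ae_eq T v (Jx T (real k) h)" using Suc.IH[OF u(1) _ h] Suc.prems by simp
  have "ae_eq T h (Jx T 1 g)"
  proof (rule weak_primitive_zero_trace[OF h(1) Suc.prems(3) T])
    show "zero_trace T h" by (rule zero_trace_cong[OF u(2) h(2)])
    fix \<phi> assume p: "\<phi> \<in> test_functions T"
    have a: "(\<integral>t. f t * (deriv ^^ k) (deriv \<phi>) t \<partial>lborel) = (- 1) ^ k * (\<integral>t. h t * deriv \<phi> t \<partial>lborel)"
      using u(1) test_deriv[OF p] unfolding weak_deriv_ext_iff[OF f h] by blast
    have "(\<integral>t. f t * (deriv ^^ Suc k) \<phi> t \<partial>lborel) = (- 1) ^ Suc k * (\<integral>t. g t * \<phi> t \<partial>lborel)"
      using Suc.prems(1) p unfolding weak_deriv_ext_iff[OF f Suc.prems(3,4)] by blast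
    then have "(- 1) ^ k * (\<integral>t. h t * deriv \<phi> t \<partial>lborel) = (- 1) ^ k * - (\<integral>t. g t * \<phi> t \<partial>lborel)"
      using a by (simp add: funpow_Suc_right del: funpow.simps)
    then show "(\<integral>t. h t * deriv \<phi> t \<partial>lborel) = - (\<integral>t. g t * \<phi> t \<partial>lborel)"
      by (metis mult_cancel_left power_not_zero zero_neq_neg_one)
  qed
  moreover have J1: "Jx T 1 g \<in> L2_ext T" using Jx_L2_ext[OF Suc.prems(3) _ T, of 1] by simp
  ultimately have "ae_eq T (Jx T (real k) h) (Jx T (real k) (Jx T 1 g))" by (intro ae_eq_Jx[OF h(1)])
  moreover have "ae_eq T (Jx T (real k) (Jx T 1 g)) (Jx T (real k + 1) g)"
    by (rule ae_eq_Jx_semigroup[OF Suc.prems(3) _ _ T]) auto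
  ultimately have "ae_eq T v (Jx T (real k + 1) g)" using vh ae_eq_trans by blast
  then show ?case by (simp add: add.commute)
qed

section \<open>Fractional orders below one\<close>

text \<open>
  On the whole line \<open>J\<^sup>\<sigma> z\<close> has finite energy by \<open>rl_energy\<close>.  Restriction to \<open>(0,T)\<close> only decreases the seminorm,
  the case \<open>\<sigma> = 1/2\<close> uses the Hardy part of the energy, and for \<open>\<sigma> > 1/2\<close> the function is continuous.
\<close>

lemma Jx_in_H_frac:
  assumes z: "z \<in> L2_ext T" and s: "0 < \<sigma>" "\<sigma> < 1" and T: "T > 0"
  shows "Jx T \<sigma> z \<in> H_frac T \<sigma>"
proof -
  note z2 = L2_extD(1)[OF z]
  note [measurable] = L2R_measurable[OF z2]
  let ?U = "rl \<sigma> z" and ?u = "Jx T \<sigma> z"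
  have u: "?u \<in> L2_ext T" by (rule Jx_L2_ext[OF z _ T]) (use s in simp)
  have um: "?U t = ?u t" if "t \<in> {0<..<T}" for t using that s by (simp add: Jx_def)
  have E: "slob_energy \<sigma> ?U < \<infinity>" unfolding rl_energy[OF s L2_ext_integrable[OF z] z2] by simp
  have "(\<integral>\<^sup>+t. (\<integral>\<^sup>+s. gagliardo \<sigma> ?u t s * indicator {0<..<T} s * indicator {0<..<T} t \<partial>lborel) \<partial>lborel)
     \<le> (\<integral>\<^sup>+t. (\<integral>\<^sup>+s. gagliardo \<sigma> ?U t s \<partial>lborel) \<partial>lborel)"
  proof (intro nn_integral_mono)
    fix t s' :: real
    show "gagliardo \<sigma> ?u t s' * indicator {0<..<T} s' * indicator {0<..<T} t \<le> gagliardo \<sigma> ?U t s'"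
      using um[of t] um[of s'] by (cases "t \<in> {0<..<T} \<and> s' \<in> {0<..<T}") (auto simp: gagliardo_def indicator_def)
  qed
  also have "\<dots> \<le> 2 * slob_energy \<sigma> ?U" by (rule gagliardo_le_slob_energy) measurable
  also have "\<dots> < \<infinity>" using E by (simp add: ennreal_mult_less_top)
  finally have S: "?u \<in> Slobodeckij T \<sigma>"
    unfolding Slobodeckij_def using L2_ext_subset_L2[OF u] gagliardo_ext[OF u ae_eq_refl, of \<sigma>] by simp
  have half: "(\<integral>\<^sup>+t\<in>{0<..<T}. ennreal (\<bar>?u t\<bar>\<^sup>2 / t) \<partial>lebesgue) < \<infinity>" if "\<sigma> = 1/2"
  proof -
    have "(\<integral>\<^sup>+t\<in>{0<..<T}. ennreal (\<bar>?u t\<bar>\<^sup>2 / t) \<partial>lborel) \<le> (\<integral>\<^sup>+t. ennreal ((?U t)\<^sup>2 * (t powr (- 2 * \<sigma>) / (2 * \<sigma>))) * indicator {0<..} t \<partial>lborel)"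
    proof (rule nn_integral_mono)
      fix t :: real
      show "ennreal (\<bar>?u t\<bar>\<^sup>2 / t) * indicator {0<..<T} t \<le> ennreal ((?U t)\<^sup>2 * (t powr (- 2 * \<sigma>) / (2 * \<sigma>))) * indicator {0<..} t"
      proof (cases "t \<in> {0<..<T}")
        case True
        then have "t powr (- 2 * \<sigma>) / (2 * \<sigma>) = 1 / t" unfolding that by (simp add: powr_minus_divide)
        then show ?thesis using um[OF True] True by simp
      qed simp
    qed
    also have "\<dots> \<le> slob_energy \<sigma> ?U"
      by (rule energy_ge_hardy[OF s(1) _ rl_zero_nonpos[OF z]]) measurable
    finally show ?thesis using E by (simp add: nn_integral_completion le_less_trans)
  qed
  show ?thesis
    unfolding H_frac_def using S half zero_trace_Jx[OF z _ ae_eq_refl, of \<sigma>] by auto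
qed

lemma L2_ext_sq_fin:
  assumes f: "f \<in> L2_ext T"
  shows "(\<integral>\<^sup>+t. ennreal ((f t)\<^sup>2) * indicator A t \<partial>lborel) < \<infinity>"
proof -
  have "(\<integral>\<^sup>+t. ennreal ((f t)\<^sup>2) * indicator A t \<partial>lborel) \<le> (\<integral>\<^sup>+t. ennreal ((f t)\<^sup>2) \<partial>lborel)"
    by (rule nn_integral_mono) (auto simp: indicator_def)
  also have "\<dots> < \<infinity>" unfolding L2R_nn[OF L2_extD(1)[OF f]] by simp
  finally show ?thesis .
qed

text \<open>
  The definition of \<open>H_frac\<close> distinguishes three cases so that Hardy's inequality holds in each: it follows from the
  seminorm for \<open>\<sigma> < 1/2\<close>, is required for \<open>\<sigma> = 1/2\<close>, and follows from the zero trace for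
  \<open>\<sigma> > 1/2\<close>.
\<close>

lemma H_frac_hardy_ext:
  assumes w: "w \<in> H_frac T \<sigma>" and s: "0 < \<sigma>" "\<sigma> < 1" and T: "T > 0"
  obtains f where "f \<in> L2_ext T" "ae_eq T w f"
    "(\<integral>\<^sup>+t. ennreal ((f t)\<^sup>2 * t powr (- 2 * \<sigma>)) * indicator {0<..<T} t \<partial>lborel) < \<infinity>"
    "(\<integral>\<^sup>+t. (\<integral>\<^sup>+s. gagliardo \<sigma> f t s * indicator {0<..<T} s * indicator {0<..<T} t \<partial>lborel) \<partial>lborel) < \<infinity>"
proof -
  have S: "w \<in> Slobodeckij T \<sigma>" using w by (auto simp: H_frac_def split: if_splits)
  then have "w \<in> L2 T" by (simp add: Slobodeckij_def)
  then obtain f where f: "f \<in> L2_ext T" "ae_eq T w f" by (rule L2_obtain_ext)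
  note [measurable] = L2R_measurable[OF L2_extD(1)[OF f(1)]]
  have I: "(\<integral>\<^sup>+t. (\<integral>\<^sup>+s. gagliardo \<sigma> g t s * indicator {0<..<T} s * indicator {0<..<T} t \<partial>lborel) \<partial>lborel) < \<infinity>"
    if "g \<in> L2_ext T" "ae_eq T w g" for g
    using S gagliardo_ext[OF that, of \<sigma>] by (simp add: Slobodeckij_def)
  consider "\<sigma> < 1/2" | "\<sigma> = 1/2" | "\<sigma> > 1/2" by linarith
  then show thesis
  proof cases
    case 1
    then show thesis
      using hardy_small[OF _ T s(1) 1 L2_ext_sq_fin[OF f(1)] I[OF f]] I[OF f] f by (intro that) auto
  next
    case 2
    have "(\<integral>\<^sup>+t\<in>{0<..<T}. ennreal (\<bar>w t\<bar>\<^sup>2 / t) \<partial>lborel) < \<infinity>"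
      using w 2 by (simp add: H_frac_def nn_integral_completion)
    moreover have "(\<integral>\<^sup>+t. ennreal ((f t)\<^sup>2 * t powr (- 2 * \<sigma>)) * indicator {0<..<T} t \<partial>lborel) = (\<integral>\<^sup>+t\<in>{0<..<T}. ennreal (\<bar>w t\<bar>\<^sup>2 / t) \<partial>lborel)"
    proof (rule nn_integral_cong_AE)
      show "AE t in lborel. ennreal ((f t)\<^sup>2 * t powr (- 2 * \<sigma>)) * indicator {0<..<T} t = ennreal (\<bar>w t\<bar>\<^sup>2 / t) * indicator {0<..<T} t"
        using f(2) unfolding ae_eq_iff
      proof eventually_elim
        case (elim t)
        show ?case
        proof (cases "t \<in> {0<..<T}")
          case True
          then have "t powr (- 2 * \<sigma>) = 1 / t" unfolding 2 by (simp add: powr_minus_divide)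
          then show ?thesis using elim True by simp
        qed simp
      qed
    qed
    ultimately show thesis using I[OF f] f by (intro that) auto
  next
    case 3
    then have "zero_trace T w" using w by (simp add: H_frac_def)
    then obtain u where u: "continuous_on {0..T} u" "ae_eq T w u" "u 0 = 0" by (auto simp: zero_trace_def)
    define g where "g t = indicator {0<..<T} t * u t" for t
    have gm [measurable]: "g \<in> borel_measurable borel"
    proof -
      have "continuous_on {0<..<T} u" by (rule continuous_on_subset[OF u(1)]) auto
      from borel_measurable_continuous_on_indicator[OF _ this] show ?thesis unfolding g_def by simp
    qed
    have wg: "ae_eq T w g" using u(2) unfolding ae_eq_iff by eventually_elim (auto simp: g_def)
    have fg: "AE t in lborel. f t = g t"
      using ae_eq_trans[OF ae_eq_sym[OF f(2)] wg] unfolding ae_eq_iff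
    proof eventually_elim
      case (elim t)
      then show ?case using L2_extD(2)[OF f(1), of t] by (cases "t \<in> {0<..<T}") (auto simp: g_def)
    qed
    have "g s = 0" if "s \<notin> {0<..<T}" for s using that by (simp add: g_def)
    with L2R_cong_AE[OF L2_extD(1)[OF f(1)] gm fg] have g: "g \<in> L2_ext T" by (simp add: L2_ext_def)
    have "(u \<longlongrightarrow> u 0) (at 0 within {0..T})" using u(1) T by (simp add: continuous_on_def)
    then have "(u \<longlongrightarrow> 0) (at_right 0)" using u(3) at_within_Icc_at_right[OF T] by simp
    moreover have "\<forall>\<^sub>F t in at_right 0. u t = g t"
      using eventually_at_right_real[OF T] by eventually_elim (auto simp: g_def)
    ultimately have "(g \<longlongrightarrow> 0) (at_right 0)" by (rule Lim_transform_eventually)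
    from hardy_large[OF gm T 3 this I[OF g wg]] show thesis using I[OF g wg] g wg by (intro that) auto
  qed
qed

text \<open>
  Extend by zero to the left and by reflection at \<open>T\<close> to the right; the extension has finite energy on the line, so
  \<open>finite_energy_imp_rl\<close> applies.
\<close>

lemma H_frac_imp_Jx:
  assumes w: "w \<in> H_frac T \<sigma>" and s: "0 < \<sigma>" "\<sigma> < 1" and T: "T > 0"
  obtains z where "z \<in> L2_ext T" "ae_eq T w (Jx T \<sigma> z)"
proof -
  obtain f where f: "f \<in> L2_ext T" "ae_eq T w f"
    and h: "(\<integral>\<^sup>+t. ennreal ((f t)\<^sup>2 * t powr (- 2 * \<sigma>)) * indicator {0<..<T} t \<partial>lborel) < \<infinity>"
    and I: "(\<integral>\<^sup>+t. (\<integral>\<^sup>+s. gagliardo \<sigma> f t s * indicator {0<..<T} s * indicator {0<..<T} t \<partial>lborel) \<partial>lborel) < \<infinity>"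
    by (rule H_frac_hardy_ext[OF w s T])
  have fm [measurable]: "f \<in> borel_measurable borel" by (rule L2R_measurable[OF L2_extD(1)[OF f(1)]])
  have f0: "f t = 0" if "t \<le> 0" for t using L2_extD(2)[OF f(1), of t] that by auto
  define V where "V t = f (min t (2 * T - t))" for t
  have Vm [measurable]: "V \<in> borel_measurable borel" unfolding V_def by measurable
  have E: "slob_energy \<sigma> V < \<infinity>"
    unfolding V_def by (rule fold_energy[OF fm s(1) zero_extension_energy[OF fm f0 s(1) I h]])
  have "V \<in> L2R"
  proof (rule L2R_I_nn[OF Vm])
    have "(\<integral>\<^sup>+t. ennreal ((V t)\<^sup>2) \<partial>lborel) = 2 * (\<integral>\<^sup>+t. ennreal ((f t)\<^sup>2) * indicator {..<T} t \<partial>lborel)"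
      unfolding V_def by (rule nn_integral_fold[of "\<lambda>t. ennreal ((f t)\<^sup>2)"]) measurable
    also have "\<dots> < \<infinity>" using L2_ext_sq_fin[OF f(1)] by (simp add: ennreal_mult_less_top)
    finally show "(\<integral>\<^sup>+t. ennreal ((V t)\<^sup>2) \<partial>lborel) < \<infinity>" .
  qed
  moreover have "V t = 0" if "t \<notin> {0<..<2 * T}" for t unfolding V_def by (rule f0) (use that in auto)
  ultimately have V: "V \<in> L2_ext (2 * T)" by (simp add: L2_ext_def)
  have V0: "V t = 0" if "t \<le> 0" for t unfolding V_def by (rule f0) (use that in auto)
  obtain z where z: "z \<in> L2R" "\<And>s. s \<notin> {0<..<T} \<Longrightarrow> z s = 0" "AE t in lborel. t \<in> {0<..<T} \<longrightarrow> rl \<sigma> z t = V t"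
    by (rule finite_energy_imp_rl[OF s L2_ext_integrable[OF V] L2_extD(1)[OF V] V0 E T]) (auto intro: that)
  have "ae_eq T f (Jx T \<sigma> z)"
    unfolding ae_eq_iff using z(3) by eventually_elim (use s in \<open>auto simp: Jx_def V_def min_def\<close>)
  then show thesis using z f(2) by (intro that[of z] ae_eq_trans[OF f(2)]) (auto simp: L2_ext_def)
qed

section \<open>The spaces as ranges of fractional integrals\<close>

text \<open>
  For \<open>\<gamma> = m + \<sigma>\<close> the weak derivative of order \<open>m\<close> is \<open>J\<^sup>\<sigma> z\<close>, and the semigroup law combines it with the
  \<open>m\<close> integrations.
\<close>

lemma H_iff_Jx:
  assumes T: "T > 0" and g: "\<gamma> \<ge> 0"
  shows "v \<in> H T \<gamma> \<longleftrightarrow> (\<exists>z\<in>L2_ext T. ae_eq T v (Jx T \<gamma> z))"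
proof (cases "\<gamma> \<in> \<nat>")
  case True
  then obtain m where m: "\<gamma> = real m" by (auto elim: Nats_cases)
  have "v \<in> H_nat T m \<Longrightarrow> \<exists>z\<in>L2_ext T. ae_eq T v (Jx T \<gamma> z)"
  proof -
    assume v: "v \<in> H_nat T m"
    then obtain w where w: "weak_deriv T m v w" by (auto simp: H_nat_def Sobolev_def)
    then have "w \<in> L2 T" by (simp add: weak_deriv_def)
    then obtain z where "z \<in> L2_ext T" "ae_eq T w z" by (rule L2_obtain_ext)
    then show ?thesis using H_nat_imp_Jx[OF v T w] m by auto
  qed
  moreover have "z \<in> L2_ext T \<Longrightarrow> ae_eq T v (Jx T \<gamma> z) \<Longrightarrow> v \<in> H_nat T m" for z
    using H_nat_of_Jx[OF _ T, of z v \<gamma> m] m by simp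
  ultimately show ?thesis using m by (auto simp: H_def)
next
  case False
  define m where "m = nat \<lfloor>\<gamma>\<rfloor>"
  define \<sigma> where "\<sigma> = frac \<gamma>"
  have m: "\<gamma> = real m + \<sigma>" using g by (simp add: m_def \<sigma>_def frac_def)
  have "\<sigma> \<noteq> 0" using False m by auto
  then have s: "0 < \<sigma>" "\<sigma> < 1" using frac_ge_0[of \<gamma>] frac_lt_1[of \<gamma>] by (auto simp: \<sigma>_def less_le)
  have H: "v \<in> H T \<gamma> \<longleftrightarrow> v \<in> H_nat T m \<and> (\<exists>w\<in>H_frac T \<sigma>. weak_deriv T m v w)"
    using False by (simp add: H_def m_def \<sigma>_def)
  show ?thesis
  proof
    assume "v \<in> H T \<gamma>"
    then obtain w where v: "v \<in> H_nat T m" and w: "w \<in> H_frac T \<sigma>" "weak_deriv T m v w" using H by auto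
    obtain z where z: "z \<in> L2_ext T" "ae_eq T w (Jx T \<sigma> z)" by (rule H_frac_imp_Jx[OF w(1) s T])
    have J: "Jx T \<sigma> z \<in> L2_ext T" by (rule Jx_L2_ext[OF z(1) _ T]) (use s in simp)
    have "ae_eq T v (Jx T (real m) (Jx T \<sigma> z))" by (rule H_nat_imp_Jx[OF v T w(2) _ J z(2)]) simp
    moreover have "ae_eq T (Jx T (real m) (Jx T \<sigma> z)) (Jx T \<gamma> z)"
      unfolding m by (rule ae_eq_Jx_semigroup[OF z(1) _ _ T]) (use s in auto)
    ultimately show "\<exists>z\<in>L2_ext T. ae_eq T v (Jx T \<gamma> z)" using z(1) ae_eq_trans by blast
  next
    assume "\<exists>z\<in>L2_ext T. ae_eq T v (Jx T \<gamma> z)"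
    then obtain z where z: "z \<in> L2_ext T" "ae_eq T v (Jx T \<gamma> z)" by auto
    have mg: "real m \<le> \<gamma>" using m s by simp
    have "weak_deriv T m v (Jx T \<sigma> z)" using weak_deriv_Jx[OF z(1) T z(2) mg] m by simp
    then show "v \<in> H T \<gamma>" unfolding H using H_nat_of_Jx[OF z(1) T z(2) mg] Jx_in_H_frac[OF z(1) s T] by auto
  qed
qed

lemma Jx_nat_injective:
  assumes f: "f \<in> L2_ext T" and T: "T > 0" and e: "AE t in lborel. Jx T (real n) f t = 0"
  shows "AE t in lborel. f t = 0"
  using e
proof (induction n)
  case 0
  then show ?case by (simp add: Jx_def)
next
  case (Suc n)
  have g: "Jx T (real n) f \<in> L2_ext T" by (rule Jx_L2_ext[OF f _ T]) simp
  have J1: "Jx T 1 (Jx T (real n) f) \<in> L2_ext T" using Jx_L2_ext[OF g _ T, of 1] by simp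
  have "AE t in lborel. Jx T 1 (Jx T (real n) f) t = Jx T (1 + real n) f t"
    by (rule Jx_semigroup[OF f _ _ T]) auto
  with Suc.prems have z: "AE t in lborel. Jx T 1 (Jx T (real n) f) t = 0" by eventually_elim simp
  have "AE t in lborel. Jx T (real n) f t = 0"
  proof (rule fundamental_lemma[OF g])
    fix \<phi> assume p: "\<phi> \<in> test_functions T"
    have "(\<integral>t. Jx T 1 (Jx T (real n) f) t * deriv \<phi> t \<partial>lborel) = (\<integral>t. 0 \<partial>(lborel :: real measure))"
    proof (rule integral_cong_AE)
      show "(\<lambda>t. Jx T 1 (Jx T (real n) f) t * deriv \<phi> t) \<in> borel_measurable lborel"
        using L2R_measurable[OF L2_extD(1)[OF J1]] test_measurable[OF test_deriv[OF p]] by measurable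
      show "AE t in lborel. Jx T 1 (Jx T (real n) f) t * deriv \<phi> t = 0" using z by eventually_elim simp
    qed simp
    then show "(\<integral>x. Jx T (real n) f x * \<phi> x \<partial>lborel) = 0"
      using integration_by_parts_Jx[OF g p T] by simp
  qed
  then show ?case by (rule Suc.IH)
qed

lemma Jx_diff:
  assumes f: "f \<in> L2_ext T" and g: "g \<in> L2_ext T" and a: "\<alpha> \<ge> 0" and T: "T > 0"
  shows "AE t in lborel. Jx T \<alpha> (\<lambda>t. f t - g t) t = Jx T \<alpha> f t - Jx T \<alpha> g t"
proof (cases "\<alpha> = 0")
  case False
  then have a: "\<alpha> > 0" using a by simp
  show ?thesis using rl_AE_integrable_interval[OF f a T] rl_AE_integrable_interval[OF g a T]
  proof eventually_elim
    case (elim t)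
    show ?case
      using elim a by (cases "t \<in> {0<..<T}") (auto simp: Jx_def rl_def right_diff_distrib)
  qed
qed (simp add: Jx_def)

text \<open>
  Raising the order to an integer by the semigroup law reduces the claim to \<open>Jx_nat_injective\<close>.
\<close>

lemma Jx_injective:
  assumes f: "f \<in> L2_ext T" and g: "g \<in> L2_ext T" and a: "\<alpha> \<ge> 0" and T: "T > 0"
    and e: "ae_eq T (Jx T \<alpha> f) (Jx T \<alpha> g)"
  shows "ae_eq T f g"
proof -
  let ?d = "\<lambda>t. f t - g t"
  have d: "?d \<in> L2_ext T" by (rule L2_ext_diff[OF f g])
  \<comment> \<open>an integer order to which the order can be raised\<close>
  obtain n :: nat where n: "\<alpha> \<le> n" using real_arch_simple by auto
  have Jd: "Jx T \<alpha> ?d \<in> L2_ext T" by (rule Jx_L2_ext[OF d a T])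
  have zero: "(\<lambda>x. 0) \<in> L2_ext T" by (simp add: L2_ext_def L2R_def)
  have "AE t in lborel. Jx T \<alpha> f t = Jx T \<alpha> g t"
    using e unfolding L2_ext_ae_eq[OF Jx_L2_ext[OF f a T] Jx_L2_ext[OF g a T]] .
  then have "AE t in lborel. Jx T \<alpha> ?d t = 0"
    using Jx_diff[OF f g a T] by eventually_elim simp
  from Jx_cong_AE[OF Jd zero this, of "real n - \<alpha>"]
  have "AE t in lborel. Jx T (real n - \<alpha>) (Jx T \<alpha> ?d) t = 0" 
  proof eventually_elim
    case (elim t)
    have "Jx T (real n - \<alpha>) (\<lambda>x. 0) t = 0" by (simp add: Jx_def rl_def)
    with elim show ?case by (simp only:)
  qed
  moreover have "AE t in lborel. Jx T (real n - \<alpha>) (Jx T \<alpha> ?d) t = Jx T (real n - \<alpha> + \<alpha>) ?d t"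
    by (rule Jx_semigroup[OF d _ a T]) (use n in simp)
  ultimately have "AE t in lborel. Jx T (real n) ?d t = 0" by eventually_elim simp
  from Jx_nat_injective[OF d T this] show ?thesis unfolding ae_eq_iff by eventually_elim simp
qed

text \<open>
  Injectivity makes the choice in \<open>frac_deriv\<close> unambiguous up to null sets.
\<close>

lemma frac_deriv_eq:
  assumes z: "z \<in> L2_ext T" and g: "\<gamma> \<ge> 0" and T: "T > 0" and e: "ae_eq T v (Jx T \<gamma> z)"
  shows "ae_eq T (frac_deriv T \<gamma> v) z"
proof -
  let ?w = "frac_deriv T \<gamma> v"
  have v: "v \<in> H T \<gamma>" using H_iff_Jx[OF T g] z e by auto
  have "z \<in> L2 T \<and> ae_eq T (J \<gamma> z) v"
    using L2_ext_subset_L2[OF z] ae_eq_trans[OF J_ae_Jx[OF z ae_eq_refl g] ae_eq_sym[OF e]] by simp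
  then have w: "?w \<in> L2 T \<and> ae_eq T (J \<gamma> ?w) v"
    unfolding frac_deriv_def using v by (simp add: someI[of "\<lambda>w. w \<in> L2 T \<and> ae_eq T (J \<gamma> w) v" z])
  then obtain f where f: "f \<in> L2_ext T" "ae_eq T ?w f" by (meson L2_obtain_ext)
  have "ae_eq T (Jx T \<gamma> f) (Jx T \<gamma> z)"
    using ae_eq_sym[OF J_ae_Jx[OF f g]] w e ae_eq_trans by blast
  from Jx_injective[OF f(1) z g T this] show ?thesis using f(2) ae_eq_trans by blast
qed

theorem theorem3p1:
  fixes T \<alpha> \<beta> :: real and v :: "real \<Rightarrow> real"
  assumes "T > 0" and "\<alpha> \<ge> 0" and "\<beta> \<ge> 0" and "v \<in> H T (\<alpha> + \<beta>)"
  shows "v \<in> H T \<beta> \<and> frac_deriv T \<beta> v \<in> H T \<alpha> \<and>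
         ae_eq T (frac_deriv T \<alpha> (frac_deriv T \<beta> v)) (frac_deriv T (\<alpha> + \<beta>) v)"
proof -
  note T = assms(1) and a = assms(2) and b = assms(3)
  have ab: "\<alpha> + \<beta> \<ge> 0" using a b by simp
  obtain z where z: "z \<in> L2_ext T" "ae_eq T v (Jx T (\<alpha> + \<beta>) z)" using H_iff_Jx[OF T ab] assms(4) by auto
  have J: "Jx T \<alpha> z \<in> L2_ext T" by (rule Jx_L2_ext[OF z(1) a T])
  have vb: "ae_eq T v (Jx T \<beta> (Jx T \<alpha> z))"
    using ae_eq_Jx_semigroup[OF z(1) b a T] z(2) ae_eq_sym ae_eq_trans by (metis add.commute)
  have d: "ae_eq T (frac_deriv T \<beta> v) (Jx T \<alpha> z)" by (rule frac_deriv_eq[OF J b T vb])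
  have "v \<in> H T \<beta>" using H_iff_Jx[OF T b] J vb by auto
  moreover have "frac_deriv T \<beta> v \<in> H T \<alpha>" using H_iff_Jx[OF T a] z(1) d by auto
  moreover have "ae_eq T (frac_deriv T \<alpha> (frac_deriv T \<beta> v)) (frac_deriv T (\<alpha> + \<beta>) v)"
    using frac_deriv_eq[OF z(1) a T d] frac_deriv_eq[OF z(1) ab T z(2)] ae_eq_sym ae_eq_trans by blast
  ultimately show ?thesis by blast
qed

end
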